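(* Let $\Omega\subset\mathbb{R}^2$ be a nonempty bounded open set with Lipschitz boundary, and let $\mathcal{A}$ be the set of admissible curves for $\Omega$. Then the minimization problem \[ \min_{\gamma\in\mathcal{A}} \mathcal{W}(\gamma) \] admits a solution, i.e. there exists $\gamma\in\mathcal{A}$ such that $\mathcal{W}(\gamma)\le \mathcal{W}(\tilde\gamma)$ for all $\tilde\gamma\in\mathcal{A}$.
   Context: $\mathbb{S}^1$ is the circle. A regular curve is a closed curve $\gamma:\mathbb{S}^1\to\mathbb{R}^2$ with $\gamma,\gamma',\gamma''\in L^2(\mathbb{S}^1,\mathbb{R}^2)$ (distributional derivatives; so $\gamma\in C^1$) and $|\gamma'(t)|>0$ for all $t\in\mathbb{S}^1$. Writing $\gamma:[0,L]\to\mathbb{R}^2$ for its arc-length parametrization, with $L$ the length, the bending energy is $\mathcal{W}(\gamma)=\int_0^L|\gamma''(s)|^2\,ds$. The curve $\gamma$ is confined in $\Omega$ if its image $(\gamma)$ is contained in $\overline{\Omega}$. The set $\mathcal{A}$ of admissible curves is the set of regular closed curves confined in $\Omega$ all of whose self-intersections (if any) are tangential: if $\gamma(t)=\gamma(s)$ with $t\neq s$, then $\gamma'(t)$ and $\gamma'(s)$ are parallel (with the same or opposite directions). *)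

theory Defs
  imports "HOL-Analysis.Analysis"
begin

(* A function on the circle of length T, i.e. on R/TZ, is represented by a T-periodic
   function on the real line. *)
definition periodic :: "real \<Rightarrow> (real \<Rightarrow> 'a) \<Rightarrow> bool" where
  "periodic T u \<longleftrightarrow> (\<forall>t. u (t + T) = u t)"

definition smooth_real :: "(real \<Rightarrow> real) \<Rightarrow> bool" where
  "smooth_real \<phi> \<longleftrightarrow> (\<forall>k t. ((deriv ^^ k) \<phi>) field_differentiable (at t))"

definition L2_circle :: "real \<Rightarrow> (real \<Rightarrow> real^2) \<Rightarrow> bool" where
  "L2_circle T u \<longleftrightarrow>
     periodic T u \<and> set_borel_measurable lborel {0..T} u \<and>
     set_integrable lborel {0..T} (\<lambda>t. (norm (u t))\<^sup>2)"

(* Distributional derivative on the circle of length T, for integrable functions.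
   Test functions are all smooth functions on the circle. *)
definition has_weak_derivative :: "real \<Rightarrow> (real \<Rightarrow> real^2) \<Rightarrow> (real \<Rightarrow> real^2) \<Rightarrow> bool" where
  "has_weak_derivative T u v \<longleftrightarrow>
     periodic T u \<and> periodic T v \<and>
     set_integrable lborel {0..T} u \<and> set_integrable lborel {0..T} v \<and>
     (\<forall>\<phi>. smooth_real \<phi> \<longrightarrow> periodic T \<phi> \<longrightarrow>
        (LBINT t:{0..T}. deriv \<phi> t *\<^sub>R u t) = - (LBINT t:{0..T}. \<phi> t *\<^sub>R v t))"

(* Determined only up to null sets. *)
definition weak_derivative :: "real \<Rightarrow> (real \<Rightarrow> real^2) \<Rightarrow> real \<Rightarrow> real^2" where
  "weak_derivative T u = (SOME v. has_weak_derivative T u v)"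

definition W22_circle :: "real \<Rightarrow> (real \<Rightarrow> real^2) \<Rightarrow> bool" where
  "W22_circle T u \<longleftrightarrow>
     (\<exists>v w. L2_circle T u \<and> L2_circle T v \<and> L2_circle T w \<and>
            has_weak_derivative T u v \<and> has_weak_derivative T v w)"

(* Closed curves are parametrized over R/(2 pi)Z.  The C1 condition only selects the C1
   representative of the W22 class, so that the pointwise conditions make sense. *)
definition regular_curve :: "(real \<Rightarrow> real^2) \<Rightarrow> bool" where
  "regular_curve \<gamma> \<longleftrightarrow>
     W22_circle (2 * pi) \<gamma> \<and> \<gamma> C1_differentiable_on UNIV \<and>
     (\<forall>t. norm (vector_derivative \<gamma> (at t)) > 0)"

(* The signed arc length from 0 to t; t may be negative. *)
definition arc_length :: "(real \<Rightarrow> real^2) \<Rightarrow> real \<Rightarrow> real" where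
  "arc_length \<gamma> t = (LBINT r=0..ereal t. norm (vector_derivative \<gamma> (at r)))"

definition curve_length :: "(real \<Rightarrow> real^2) \<Rightarrow> real" where
  "curve_length \<gamma> = arc_length \<gamma> (2 * pi)"

(* For a regular curve, arc_length is a bijection of the real line, and the result is
   periodic with period curve_length. *)
definition arc_length_param :: "(real \<Rightarrow> real^2) \<Rightarrow> real \<Rightarrow> real^2" where
  "arc_length_param \<gamma> = \<gamma> \<circ> inv (arc_length \<gamma>)"

definition bending_energy :: "(real \<Rightarrow> real^2) \<Rightarrow> real" where
  "bending_energy \<gamma> =
     (let L = curve_length \<gamma>
      in LBINT s:{0..L}.
           (norm (weak_derivative L (weak_derivative L (arc_length_param \<gamma>)) s))\<^sup>2)"

definition confined :: "(real^2) set \<Rightarrow> (real \<Rightarrow> real^2) \<Rightarrow> bool" where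
  "confined \<Omega> \<gamma> \<longleftrightarrow> range \<gamma> \<subseteq> closure \<Omega>"

(* The half-open interval contains each point of the circle exactly once. *)
definition tangential_self_intersections :: "(real \<Rightarrow> real^2) \<Rightarrow> bool" where
  "tangential_self_intersections \<gamma> \<longleftrightarrow>
     (\<forall>t\<in>{0..<2 * pi}. \<forall>s\<in>{0..<2 * pi}. t \<noteq> s \<longrightarrow> \<gamma> t = \<gamma> s \<longrightarrow>
        (\<exists>c. vector_derivative \<gamma> (at t) = c *\<^sub>R vector_derivative \<gamma> (at s)))"

definition admissible_curves :: "(real^2) set \<Rightarrow> (real \<Rightarrow> real^2) set" where
  "admissible_curves \<Omega> =
     {\<gamma>. regular_curve \<gamma> \<and> confined \<Omega> \<gamma> \<and> tangential_self_intersections \<gamma>}"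

(* Near each boundary point the set is, in suitable orthonormal coordinates, the part of a
   disc lying strictly above the graph of a Lipschitz function. *)
definition lipschitz_boundary :: "(real^2) set \<Rightarrow> bool" where
  "lipschitz_boundary \<Omega> \<longleftrightarrow>
     (\<forall>p\<in>frontier \<Omega>. \<exists>r>0. \<exists>e n. \<exists>f :: real \<Rightarrow> real. \<exists>C.
        norm e = 1 \<and> norm n = 1 \<and> e \<bullet> n = 0 \<and> C-lipschitz_on UNIV f \<and>
        \<Omega> \<inter> ball p r = {x \<in> ball p r. x \<bullet> n > f (x \<bullet> e)})"

end

theory Submission
  imports Defs "HOL-Complex_Analysis.Great_Picard"
begin

text \<open>
  The proof is the direct method. Along a minimizing sequence, parametrize each curve by arc length,
  say \<open>\<sigma>\<close> with period \<open>L\<close> and bending energy \<open>W\<close>. By Cauchy--Schwarz the unit tangent satisfies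
  \<open>\<bar>\<sigma>' b - \<sigma>' a\<bar>\<^sup>2 \<le> (b - a) W\<close>, so bounded energy makes the tangents uniformly Hoelder continuous. The
  lengths stay away from zero, since by Rolle's theorem the tangent of a closed curve turns by a
  right angle somewhere (\<open>unit_speed_loop_length_lower_bound\<close>). They also stay bounded, because
  \<open>L = \<integral>\<bar>\<sigma>'\<bar>\<^sup>2 = - \<integral>\<sigma> \<bullet> \<sigma>''\<close> and the curves live in a bounded set
  (\<open>unit_speed_loop_length_upper_bound\<close>). After rescaling to the period \<open>2\<pi>\<close>, Arzela--Ascoli gives a
  subsequence converging uniformly together with its tangents (\<open>unit_speed_loops_converge\<close>); the
  limit is a closed curve of constant positive speed in the closure of \<open>\<Omega>\<close>.

  That the limit only touches itself tangentially is a stability statement: a transversal crossing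
  is a nondegenerate zero of \<open>(x, y) \<mapsto> \<gamma> x - \<gamma> y\<close>, and by Brouwer's theorem it cannot disappear under
  uniform perturbation (\<open>transversal_crossing_stable\<close>). The approximating curves would then have
  crossings nearby, with tangents that are parallel but converge to nonparallel ones
  (\<open>tangential_closed\<close>).

  Lower semicontinuity of the energy needs no weak compactness. The bending energy is tested through
  the dyadic difference quotients of the tangent,
  \<open>\<Sum>\<^sub>k \<bar>\<sigma>' t\<^sub>k\<^sub>+\<^sub>1 - \<sigma>' t\<^sub>k\<bar>\<^sup>2 / (t\<^sub>k\<^sub>+\<^sub>1 - t\<^sub>k)\<close>, a finite sum for each dyadic level, which is continuous
  under pointwise convergence. These sums are bounded by the energy (\<open>dyadic_energy_le_L2\<close>), and
  conversely a continuous function for which they are bounded by \<open>M\<close> is the primitive of some \<open>g\<close> in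
  \<open>L\<^sup>2\<close> with \<open>\<integral>\<bar>g\<bar>\<^sup>2 \<le> M\<close>; this is the theorem of F. Riesz, \<open>L2_primitive_if_dyadic_energy_bounded\<close>.
  The same theorem shows that the limit, and the arc length parametrization of any regular curve,
  has a second derivative in \<open>L\<^sup>2\<close>.

  The link with distributional derivatives is that a continuous function whose weak derivative is
  \<open>w\<close> is a primitive of \<open>w\<close> (\<open>weak_derivative_imp_primitive\<close>) and conversely
  (\<open>primitive_has_weak_derivative\<close>), and that \<open>w\<close> is unique up to null sets. Hence the energy, which
  is defined through arbitrarily chosen weak derivatives, can be computed from any primitive
  relation (\<open>bending_energy_eq_L2\<close>).
\<close>

section \<open>Primitives of integrable functions\<close>

definition primitive_on :: "real \<Rightarrow> (real \<Rightarrow> 'a::euclidean_space) \<Rightarrow> (real \<Rightarrow> 'a) \<Rightarrow> bool" where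
  "primitive_on T u v \<longleftrightarrow> set_integrable lborel {0..T} v \<and>
     (\<forall>a b. 0 \<le> a \<longrightarrow> a \<le> b \<longrightarrow> b \<le> T \<longrightarrow> (LBINT t:{a..b}. v t) = u b - u a)"

lemma primitive_on_integral:
  "primitive_on T u v \<Longrightarrow> 0 \<le> a \<Longrightarrow> a \<le> b \<Longrightarrow> b \<le> T \<Longrightarrow> (LBINT t:{a..b}. v t) = u b - u a"
  unfolding primitive_on_def by blast

lemma primitive_on_integrable:
  "primitive_on T u v \<Longrightarrow> 0 \<le> a \<Longrightarrow> b \<le> T \<Longrightarrow> set_integrable lborel {a..b} v"
  unfolding primitive_on_def by (auto intro: set_integrable_subset)

lemma set_integral_split_Icc:
  fixes v :: "real \<Rightarrow> 'a::{banach, second_countable_topology}"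
  assumes "a \<le> c" "c \<le> b" "set_integrable lborel {a..b} v"
  shows "(LBINT t:{a..b}. v t) = (LBINT t:{a..c}. v t) + (LBINT t:{c..b}. v t)"
proof -
  have "AE t in lborel. \<not> (t \<in> {a..c} \<and> t \<in> {c..b})"
    by (rule eventually_mono[OF AE_lborel_singleton[of c]]) auto
  then have "(LBINT t:{a..c} \<union> {c..b}. v t) = (LBINT t:{a..c}. v t) + (LBINT t:{c..b}. v t)"
    using assms by (intro set_integral_Un_AE) (auto intro: set_integrable_subset)
  moreover have "{a..c} \<union> {c..b} = {a..b}" using assms by auto
  ultimately show ?thesis by simp
qed

lemma primitive_on_indefinite_integral:
  fixes v :: "real \<Rightarrow> 'a::euclidean_space"
  assumes v: "set_integrable lborel {0..T} v"
  shows "primitive_on T (\<lambda>t. LBINT s:{0..t}. v s) v"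
  unfolding primitive_on_def
proof (intro conjI allI impI v)
  fix a b :: real assume ab: "0 \<le> a" "a \<le> b" "b \<le> T"
  then have "set_integrable lborel {0..b} v" by (intro set_integrable_subset[OF v]) auto
  from set_integral_split_Icc[OF ab(1,2) this]
  show "(LBINT t:{a..b}. v t) = (LBINT s:{0..b}. v s) - (LBINT s:{0..a}. v s)" by simp
qed

lemma primitive_on_continuous:
  fixes u v :: "real \<Rightarrow> 'a::euclidean_space"
  assumes uv: "primitive_on T u v"
  shows "continuous_on {0..T} u"
proof -
  have iv: "set_integrable lborel {0..T} v" using uv by (simp add: primitive_on_def)
  have c: "continuous_on {0..T} (\<lambda>t. u 0 + integral {0..t} v)"
    by (intro continuous_on_add continuous_on_const indefinite_integral_continuous_1)
       (rule set_borel_integral_eq_integral(1)[OF iv])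
  have e: "u t = u 0 + integral {0..t} v" if "t \<in> {0..T}" for t
  proof -
    have "(LBINT s:{0..t}. v s) = integral {0..t} v"
      by (rule set_borel_integral_eq_integral(2)) (use that in \<open>auto intro: set_integrable_subset[OF iv]\<close>)
    then show ?thesis using primitive_on_integral[OF uv, of 0 t] that by simp
  qed
  show ?thesis by (rule continuous_on_eq[OF c e[symmetric]])
qed

lemma set_integrable_continuous_scaleR:
  fixes v :: "real \<Rightarrow> 'a::euclidean_space"
  assumes "continuous_on {a..b} f" "set_integrable lborel {a..b} v"
  shows "set_integrable lborel {a..b} (\<lambda>t. f t *\<^sub>R v t)"
proof -
  have "bounded (f ` {a..b})"
    using assms(1) compact_Icc compact_continuous_image compact_imp_bounded by blast
  then obtain B where B: "\<And>t. t \<in> {a..b} \<Longrightarrow> norm (f t) \<le> B"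
    unfolding bounded_iff by blast
  have f: "set_borel_measurable lborel {a..b} f"
    using borel_integrable_atLeastAtMost'[OF assms(1)]
    unfolding set_integrable_def set_borel_measurable_def by auto
  have m: "set_borel_measurable lborel {a..b} (\<lambda>t. f t *\<^sub>R v t)"
  proof -
    have "(\<lambda>t. (indicat_real {a..b} t *\<^sub>R f t) *\<^sub>R (indicat_real {a..b} t *\<^sub>R v t)) \<in> borel_measurable lborel"
      using f borel_measurable_integrable[OF assms(2)[unfolded set_integrable_def]]
      unfolding set_borel_measurable_def by (rule borel_measurable_scaleR)
    also have "(\<lambda>t. (indicat_real {a..b} t *\<^sub>R f t) *\<^sub>R (indicat_real {a..b} t *\<^sub>R v t))
       = (\<lambda>t. indicat_real {a..b} t *\<^sub>R (f t *\<^sub>R v t))" by (auto simp: indicator_def)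
    finally show ?thesis unfolding set_borel_measurable_def .
  qed
  show ?thesis
    by (rule set_integrable_bound[OF set_integrable_scaleR_right[OF assms(2), of B] m])
       (use B in \<open>auto intro!: AE_I2 mult_right_mono order_trans[OF _ abs_ge_self]\<close>)
qed

text \<open>
  Integration by parts when only \<open>\<phi>\<close> is differentiable: apply Fubini's theorem to
  \<open>\<phi>' t *\<^sub>R v r\<close> on the triangle \<open>0 \<le> r \<le> t \<le> T\<close>.
\<close>
lemma primitive_on_by_parts:
  fixes u v :: "real \<Rightarrow> 'a::euclidean_space" and \<phi> :: "real \<Rightarrow> real"
  assumes uv: "primitive_on T u v" and T: "0 \<le> T"
    and d: "\<And>t. t \<in> {0..T} \<Longrightarrow> (\<phi> has_vector_derivative \<phi>' t) (at t within {0..T})"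
    and c: "continuous_on {0..T} \<phi>'"
  shows "(LBINT t:{0..T}. \<phi>' t *\<^sub>R u t) + (LBINT t:{0..T}. \<phi> t *\<^sub>R v t) = \<phi> T *\<^sub>R u T - \<phi> 0 *\<^sub>R u 0"
proof -
  have iv: "set_integrable lborel {0..T} v" using uv by (simp add: primitive_on_def)
  have ip: "set_integrable lborel {0..T} \<phi>'" by (rule borel_integrable_atLeastAtMost'[OF c])
  define V where "V = (\<lambda>r. indicat_real {0..T} r *\<^sub>R v r)"
  define P where "P = (\<lambda>t. indicat_real {0..T} t *\<^sub>R \<phi>' t)"
  have V[simp]: "integrable lborel V" and P[simp]: "integrable lborel P"
    using iv ip by (auto simp: V_def P_def set_integrable_def)
  have [measurable]: "V \<in> borel_measurable borel" "P \<in> borel_measurable borel"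
    using V P borel_measurable_integrable by fastforce+
  define F where "F = (\<lambda>t r. if r \<le> t then P t *\<^sub>R V r else 0)"
  have Fm[measurable]: "case_prod F \<in> borel_measurable (lborel \<Otimes>\<^sub>M lborel)"
    unfolding F_def split_def by measurable
  have bd: "integrable (lborel \<Otimes>\<^sub>M lborel) (\<lambda>(t,r). P t *\<^sub>R V r)"
  proof (rule lborel_pair.Fubini_integrable)
    show "integrable lborel (\<lambda>x. LBINT y. norm (case (x, y) of (t, r) \<Rightarrow> P t *\<^sub>R V r))"
      by (simp add: integrable_norm)
  qed auto
  have intF: "integrable (lborel \<Otimes>\<^sub>M lborel) (case_prod F)"
    by (rule Bochner_Integration.integrable_bound[OF bd]) (auto simp: F_def)
  have phic: "continuous_on {0..T} \<phi>"
    using d by (meson continuous_on_eq_continuous_within has_vector_derivative_continuous)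
  have i1: "(LBINT r. F t r) = P t *\<^sub>R (u t - u 0)" for t
  proof (cases "t \<in> {0..T}")
    case True
    have "(LBINT r. F t r) = (LBINT r. P t *\<^sub>R (indicat_real {0..t} r *\<^sub>R v r))"
      using True by (intro Bochner_Integration.integral_cong) (auto simp: F_def V_def indicator_def)
    also have "\<dots> = P t *\<^sub>R (LBINT r:{0..t}. v r)"
      unfolding set_lebesgue_integral_def by (rule integral_scaleR_right)
    also have "(LBINT r:{0..t}. v r) = u t - u 0"
      using True by (intro primitive_on_integral[OF uv]) auto
    finally show ?thesis .
  next
    case False
    then have "P t = 0" by (simp add: P_def)
    then show ?thesis unfolding F_def by (simp cong: if_cong)
  qed
  have i2: "(LBINT t. F t r) = indicat_real {0..T} r *\<^sub>R ((\<phi> T - \<phi> r) *\<^sub>R v r)" for r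
  proof (cases "r \<in> {0..T}")
    case True
    have "(LBINT t. F t r) = (LBINT t. (indicat_real {r..T} t *\<^sub>R \<phi>' t) *\<^sub>R v r)"
      using True by (intro Bochner_Integration.integral_cong) (auto simp: F_def V_def P_def indicator_def)
    also have "\<dots> = (LBINT t:{r..T}. \<phi>' t) *\<^sub>R v r"
      using set_integrable_subset[OF ip, of "{r..T}"] True
      by (simp add: set_lebesgue_integral_def set_integrable_def)
    also have "(LBINT t:{r..T}. \<phi>' t) = \<phi> T - \<phi> r"
    proof -
      have "set_integrable lborel {r..T} \<phi>'" using set_integrable_subset[OF ip, of "{r..T}"] True by auto
      then have "(LBINT t:{r..T}. \<phi>' t) = integral {r..T} \<phi>'" by (rule set_borel_integral_eq_integral)
      also have "\<dots> = \<phi> T - \<phi> r"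
        using True by (intro integral_unique fundamental_theorem_of_calculus)
          (auto intro: has_vector_derivative_within_subset[OF d])
      finally show ?thesis .
    qed
    finally show ?thesis using True by simp
  next
    case False
    then have "V r = 0" by (simp add: V_def)
    then show ?thesis using False unfolding F_def by (simp cong: if_cong)
  qed
  have "(LBINT t. P t *\<^sub>R (u t - u 0)) = (LBINT r:{0..T}. (\<phi> T - \<phi> r) *\<^sub>R v r)"
    using lborel_pair.Fubini_integral[OF intF] by (simp add: i1 i2 set_lebesgue_integral_def)
  also have "(LBINT t. P t *\<^sub>R (u t - u 0)) = (LBINT t:{0..T}. \<phi>' t *\<^sub>R (u t - u 0))"
    by (simp add: set_lebesgue_integral_def P_def)
  finally have eq: "(LBINT t:{0..T}. \<phi>' t *\<^sub>R (u t - u 0)) = (LBINT r:{0..T}. (\<phi> T - \<phi> r) *\<^sub>R v r)" .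
  have ipv: "set_integrable lborel {0..T} (\<lambda>t. \<phi> t *\<^sub>R v t)"
    by (rule set_integrable_continuous_scaleR[OF phic iv])
  have "(LBINT r:{0..T}. (\<phi> T - \<phi> r) *\<^sub>R v r) = (LBINT r:{0..T}. \<phi> T *\<^sub>R v r) - (LBINT r:{0..T}. \<phi> r *\<^sub>R v r)"
    unfolding scaleR_diff_left by (rule set_integral_diff) (use iv ipv in auto)
  also have "(LBINT r:{0..T}. \<phi> T *\<^sub>R v r) = \<phi> T *\<^sub>R (u T - u 0)"
    using primitive_on_integral[OF uv, of 0 T] T by simp
  finally have r: "(LBINT t:{0..T}. \<phi>' t *\<^sub>R (u t - u 0)) = \<phi> T *\<^sub>R (u T - u 0) - (LBINT r:{0..T}. \<phi> r *\<^sub>R v r)"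
    using eq by simp
  have ipu0: "set_integrable lborel {0..T} (\<lambda>t. \<phi>' t *\<^sub>R u 0)"
    by (rule set_integrable_continuous_scaleR[OF c]) (intro borel_integrable_atLeastAtMost' continuous_intros)
  have "integrable lborel (\<lambda>t. P t *\<^sub>R (u t - u 0))"
    using lborel_pair.integrable_fst[OF intF] by (simp add: i1)
  then have ipu: "set_integrable lborel {0..T} (\<lambda>t. \<phi>' t *\<^sub>R (u t - u 0))"
    by (simp add: set_integrable_def P_def)
  have p0: "(LBINT t:{0..T}. \<phi>' t) = \<phi> T - \<phi> 0"
    unfolding set_borel_integral_eq_integral(2)[OF ip]
    using T by (intro integral_unique fundamental_theorem_of_calculus) (auto intro: d)
  have "(LBINT t:{0..T}. \<phi>' t *\<^sub>R u t) = (LBINT t:{0..T}. \<phi>' t *\<^sub>R (u t - u 0) + \<phi>' t *\<^sub>R u 0)"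
    by (simp add: algebra_simps)
  also have "\<dots> = (LBINT t:{0..T}. \<phi>' t *\<^sub>R (u t - u 0)) + (LBINT t:{0..T}. \<phi>' t *\<^sub>R u 0)"
    by (rule set_integral_add[OF ipu ipu0])
  also have "(LBINT t:{0..T}. \<phi>' t *\<^sub>R u 0) = (\<phi> T - \<phi> 0) *\<^sub>R u 0"
  proof -
    have "(LBINT t:{0..T}. \<phi>' t *\<^sub>R u 0) = (LBINT t. (indicat_real {0..T} t *\<^sub>R \<phi>' t) *\<^sub>R u 0)"
      by (simp add: set_lebesgue_integral_def)
    also have "\<dots> = (LBINT t:{0..T}. \<phi>' t) *\<^sub>R u 0"
      unfolding set_lebesgue_integral_def
      using ip[unfolded set_integrable_def] by (intro integral_scaleR_left) auto
    finally show ?thesis using p0 by simp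
  qed
  finally show ?thesis unfolding r by (simp add: algebra_simps)
qed

text \<open>
  The difference has integral zero over every interval, hence over every Borel set, since the
  intervals form an intersection-stable generator.
\<close>
lemma primitive_on_unique_AE:
  fixes v w :: "real \<Rightarrow> 'a::euclidean_space"
  assumes v: "primitive_on T u v" and w: "primitive_on T u w"
  shows "AE t in lborel. t \<in> {0..T} \<longrightarrow> v t = w t"
proof -
  define h where "h = (\<lambda>t. indicat_real {0..T} t *\<^sub>R (v t - w t))"
  have vw: "set_integrable lborel {0..T} v" "set_integrable lborel {0..T} w"
    using v w by (auto simp: primitive_on_def)
  have h: "integrable lborel h"
    using set_integral_diff(1)[OF vw] by (simp add: set_integrable_def h_def)
  have I: "(LBINT t:{a..b}. h t) = 0" for a b
  proof (cases "max 0 a \<le> min T b")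
    case True
    let ?a = "max 0 a" and ?b = "min T b"
    have "(LBINT t:{a..b}. h t) = (LBINT t:{?a..?b}. v t - w t)"
      unfolding set_lebesgue_integral_def
      by (intro Bochner_Integration.integral_cong) (auto simp: h_def indicator_def)
    also have "\<dots> = (LBINT t:{?a..?b}. v t) - (LBINT t:{?a..?b}. w t)"
      by (intro set_integral_diff primitive_on_integrable[OF v] primitive_on_integrable[OF w]) auto
    also have "\<dots> = 0"
      using True by (simp add: primitive_on_integral[OF v] primitive_on_integral[OF w])
    finally show ?thesis .
  next
    case False
    then have "indicat_real {a..b} t *\<^sub>R h t = 0" for t by (auto simp: h_def indicator_def)
    then have "(\<lambda>t. indicat_real {a..b} t *\<^sub>R h t) = (\<lambda>t. 0)" by blast
    then show ?thesis unfolding set_lebesgue_integral_def by simp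
  qed
  have hU: "set_integrable lborel UNIV h" using h by (simp add: set_integrable_def)
  have U: "(LBINT t:UNIV. h t) = 0"
  proof -
    have "(LBINT t:UNIV. h t) = (LBINT t:{0..T}. h t)" unfolding set_lebesgue_integral_def
      by (intro Bochner_Integration.integral_cong) (auto simp: h_def indicator_def)
    then show ?thesis using I by simp
  qed
  have "(LBINT t:A. h t) = 0" if "A \<in> sets borel" for A
    using that
  proof (induction rule: borel_set_induct)
    case (interval a b) then show ?case using I by simp
  next
    case (compl A)
    have "(LBINT t:A \<union> -A. h t) = (LBINT t:A. h t) + (LBINT t:-A. h t)"
      by (rule set_integral_Un) (use compl in \<open>auto intro: set_integrable_subset[OF hU]\<close>)
    then show ?case using compl U by simp
  next
    case (union f)
    have "(LBINT t:(\<Union>i. f i). h t) = (\<Sum>i. (LBINT t:f i. h t))"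
      by (rule lebesgue_integral_countable_add)
         (use union in \<open>auto simp: disjoint_family_on_def intro!: set_integrable_subset[OF hU]\<close>)
    then show ?case using union by simp
  qed (simp add: set_lebesgue_integral_def)
  then have "AE t in lborel. h t = 0" by (intro sigma_finite_measure.density_zero[OF sigma_finite_lborel h]) auto
  then show ?thesis by (rule eventually_mono) (auto simp: h_def)
qed

section \<open>Weak derivatives and primitives\<close>

lemma smooth_real_deriv: "smooth_real \<phi> \<Longrightarrow> smooth_real (deriv \<phi>)"
  unfolding smooth_real_def by (metis funpow_Suc_right comp_apply)

lemma smooth_real_has_deriv: "smooth_real \<phi> \<Longrightarrow> (\<phi> has_real_derivative deriv \<phi> t) (at t)"
  unfolding smooth_real_def
  by (metis DERIV_deriv_iff_field_differentiable funpow_0)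

lemma smooth_real_continuous: "smooth_real \<phi> \<Longrightarrow> continuous_on A \<phi>"
  by (meson smooth_real_has_deriv DERIV_continuous continuous_at_imp_continuous_on)

lemma smooth_realI:
  assumes "\<And>t. (\<phi> has_real_derivative \<psi> t) (at t)" "smooth_real \<psi>"
  shows "smooth_real \<phi>"
  unfolding smooth_real_def
proof (intro allI)
  fix k t
  have d: "deriv \<phi> = \<psi>" using assms(1) DERIV_imp_deriv by blast
  show "(deriv ^^ k) \<phi> field_differentiable at t"
  proof (cases k)
    case 0 then show ?thesis using assms(1) by (auto simp: field_differentiable_def)
  next
    case (Suc j) then show ?thesis using assms(2)
      by (simp add: funpow_Suc_right d smooth_real_def del: funpow.simps)
  qed
qed

lemma periodic_deriv:
  assumes "periodic T \<phi>" "smooth_real \<phi>"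
  shows "periodic T (deriv \<phi>)"
  unfolding periodic_def
proof
  fix t
  have "((\<lambda>s. \<phi> (s + T)) has_real_derivative deriv \<phi> (t + T) * 1) (at t)"
    by (rule DERIV_chain2[OF smooth_real_has_deriv[OF assms(2)]]) (auto intro!: derivative_eq_intros)
  moreover have "(\<lambda>s. \<phi> (s + T)) = \<phi>" using assms(1) by (auto simp: periodic_def)
  ultimately show "deriv \<phi> (t + T) = deriv \<phi> t" using DERIV_imp_deriv by fastforce
qed

lemma primitive_has_weak_derivative:
  fixes u v :: "real \<Rightarrow> real^2"
  assumes "primitive_on T u v" "0 < T" "periodic T u" "periodic T v"
  shows "has_weak_derivative T u v"
  unfolding has_weak_derivative_def
proof (intro conjI allI impI)
  show "set_integrable lborel {0..T} u" by (intro borel_integrable_atLeastAtMost' primitive_on_continuous[OF assms(1)])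
  show "set_integrable lborel {0..T} v" using assms(1) by (simp add: primitive_on_def)
  fix \<phi> assume p: "smooth_real \<phi>" "periodic T \<phi>"
  have "\<phi> T = \<phi> 0" "u T = u 0" using p assms(3) by (metis add_0 periodic_def)+
  moreover have "(LBINT t:{0..T}. deriv \<phi> t *\<^sub>R u t) + (LBINT t:{0..T}. \<phi> t *\<^sub>R v t) = \<phi> T *\<^sub>R u T - \<phi> 0 *\<^sub>R u 0"
    using assms(1,2) smooth_real_has_deriv[OF p(1)]
    by (intro primitive_on_by_parts smooth_real_continuous smooth_real_deriv p(1))
       (auto intro: has_field_derivative_at_within simp flip: has_real_derivative_iff_has_vector_derivative)
  ultimately show "(LBINT t:{0..T}. deriv \<phi> t *\<^sub>R u t) = - (LBINT t:{0..T}. \<phi> t *\<^sub>R v t)"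
    by (simp add: eq_neg_iff_add_eq_0)
qed (use assms in auto)

text \<open>
  The functions \<open>t \<mapsto> g (cis (\<omega> t))\<close> with \<open>g\<close> a polynomial are closed under differentiation, hence
  smooth. They are the test functions used below; being polynomials on the circle, they are dense
  by Stone--Weierstrass.
\<close>
lemma polynomial_on_circle_has_derivative:
  fixes g :: "complex \<Rightarrow> real"
  assumes "real_polynomial_function g"
  shows "\<exists>g'. real_polynomial_function g' \<and>
           (\<forall>t. ((\<lambda>t. g (cis (\<omega> * t))) has_real_derivative g' (cis (\<omega> * t))) (at t))"
  using assms
proof induction
  case (linear f)
  have "((\<lambda>t. cis (\<omega> * t)) has_vector_derivative of_real \<omega> * \<i> * cis (\<omega> * t)) (at t)" for t
    unfolding cis_conv_exp
    by (auto intro!: derivative_eq_intros has_vector_derivative_real_field simp: mult_ac)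
  from bounded_linear.has_vector_derivative[OF linear this]
  have "((\<lambda>t. f (cis (\<omega> * t))) has_real_derivative f (of_real \<omega> * \<i> * cis (\<omega> * t))) (at t)" for t
    by (simp add: has_real_derivative_iff_has_vector_derivative)
  moreover have "bounded_linear (\<lambda>z. f (of_real \<omega> * \<i> * z))"
    using bounded_linear_compose[OF linear bounded_linear_mult_right] .
  ultimately show ?case by (intro exI[of _ "\<lambda>z. f (of_real \<omega> * \<i> * z)"]) auto
next
  case (const c)
  then show ?case by (intro exI[of _ "\<lambda>z. 0"]) auto
next
  case (add f g)
  then obtain f' g' where "real_polynomial_function f'" "real_polynomial_function g'"
    "\<And>t. ((\<lambda>t. f (cis (\<omega> * t))) has_real_derivative f' (cis (\<omega> * t))) (at t)"
    "\<And>t. ((\<lambda>t. g (cis (\<omega> * t))) has_real_derivative g' (cis (\<omega> * t))) (at t)" by metis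
  then show ?case by (intro exI[of _ "\<lambda>z. f' z + g' z"]) (auto intro!: DERIV_add)
next
  case (mult f g)
  then obtain f' g' where "real_polynomial_function f'" "real_polynomial_function g'"
    and d: "\<And>t. ((\<lambda>t. f (cis (\<omega> * t))) has_real_derivative f' (cis (\<omega> * t))) (at t)"
    "\<And>t. ((\<lambda>t. g (cis (\<omega> * t))) has_real_derivative g' (cis (\<omega> * t))) (at t)" by metis
  then show ?case using mult by (intro exI[of _ "\<lambda>z. f z * g' z + f' z * g z"])
     (auto intro!: DERIV_mult'[OF d])
qed

lemma smooth_polynomial_on_circle:
  fixes g :: "complex \<Rightarrow> real"
  assumes "real_polynomial_function g"
  shows "smooth_real (\<lambda>t. g (cis (\<omega> * t)))"
  unfolding smooth_real_def
proof (intro allI)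
  fix k t
  have "\<exists>h. real_polynomial_function h \<and> (deriv ^^ k) (\<lambda>t. g (cis (\<omega> * t))) = (\<lambda>t. h (cis (\<omega> * t)))"
  proof (induction k)
    case 0 then show ?case using assms by auto
  next
    case (Suc k)
    then obtain h where h: "real_polynomial_function h"
      "(deriv ^^ k) (\<lambda>t. g (cis (\<omega> * t))) = (\<lambda>t. h (cis (\<omega> * t)))" by blast
    from polynomial_on_circle_has_derivative[OF h(1), of \<omega>] obtain h' where
      "real_polynomial_function h'"
      "\<And>t. ((\<lambda>t. h (cis (\<omega> * t))) has_real_derivative h' (cis (\<omega> * t))) (at t)" by blast
    then show ?case using h(2) by (auto intro!: exI[of _ h'] DERIV_imp_deriv)
  qed
  then obtain h where h: "real_polynomial_function h"
    "(deriv ^^ k) (\<lambda>t. g (cis (\<omega> * t))) = (\<lambda>t. h (cis (\<omega> * t)))" by blast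
  then show "(deriv ^^ k) (\<lambda>t. g (cis (\<omega> * t))) field_differentiable at t"
    using polynomial_on_circle_has_derivative[OF h(1), of \<omega>] by (auto simp: field_differentiable_def)
qed

text \<open>
  A function with \<open>h 0 = h T\<close> descends to the unit circle, where Stone--Weierstrass applies.
\<close>
lemma continuous_loop_approx_smooth:
  fixes h :: "real \<Rightarrow> real"
  assumes T: "0 < T" and h: "continuous_on {0..T} h" "h 0 = h T" and e: "0 < e"
  obtains \<psi> where "smooth_real \<psi>" "periodic T \<psi>" "\<And>t. t \<in> {0..T} \<Longrightarrow> \<bar>h t - \<psi> t\<bar> < e"
proof -
  define p where "p = (\<lambda>x. h (T * x))"
  have pc: "continuous_on {0..1} p"
    unfolding p_def using T
    by (intro continuous_on_compose2[OF h(1)] continuous_intros) (auto simp: mult_left_le)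
  \<comment> \<open>Continuity of the induced function at the base point of the circle is read off from the
        map between loops and circle maps, applied to the constant homotopy.\<close>
  have "homotopic_loops UNIV p p"
    using pc h(2) by (simp add: homotopic_loops_refl path_def pathstart_def pathfinish_def p_def)
  then have c: "continuous_on (sphere 0 1) (p \<circ> (\<lambda>z. Arg2pi z / (2 * pi)))"
    using homotopic_loops_imp_homotopic_circlemaps homotopic_with_imp_continuous by blast
  obtain g where g: "polynomial_function g"
    "\<And>z. z \<in> sphere 0 1 \<Longrightarrow> norm ((p \<circ> (\<lambda>z. Arg2pi z / (2 * pi))) z - g z) < e"
    using Stone_Weierstrass_polynomial_function[OF compact_sphere c e] by blast
  have rg: "real_polynomial_function g" using g(1) by (simp add: real_polynomial_function_eq)
  define \<psi> where "\<psi> = (\<lambda>t. g (cis (2 * pi / T * t)))"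
  have per: "periodic T \<psi>"
    unfolding periodic_def \<psi>_def
  proof
    fix t
    have "2 * pi / T * (t + T) = 2 * pi / T * t + 2 * pi" using T by (simp add: field_simps)
    then have "cis (2 * pi / T * (t + T)) = cis (2 * pi / T * t)"
      by (simp flip: cis_mult)
    then show "g (cis (2 * pi / T * (t + T))) = g (cis (2 * pi / T * t))" by simp
  qed
  have ap: "\<bar>h t - \<psi> t\<bar> < e" if t: "0 \<le> t" "t < T" for t
  proof -
    have "Arg2pi (cis (2 * pi / T * t)) = 2 * pi / T * t"
    proof (rule Arg2pi_unique[of 1])
      show "of_real 1 * exp (\<i> * of_real (2 * pi / T * t)) = cis (2 * pi / T * t)"
        by (simp only: cis_conv_exp of_real_1 mult_1_left)
      have "2 * pi * (t / T) < 2 * pi * 1" using t T by (intro mult_strict_left_mono) auto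
      then show "2 * pi / T * t < 2 * pi" by simp
    qed (use t T in auto)
    then have "(p \<circ> (\<lambda>z. Arg2pi z / (2 * pi))) (cis (2 * pi / T * t)) = h t"
      using T by (simp add: p_def)
    then show ?thesis using g(2)[of "cis (2 * pi / T * t)"] by (simp add: \<psi>_def)
  qed
  have "\<psi> T = \<psi> 0" using per by (metis add_0 periodic_def)
  then have "\<bar>h T - \<psi> T\<bar> < e" using ap[of 0] T h(2) by simp
  then have "\<bar>h t - \<psi> t\<bar> < e" if "t \<in> {0..T}" for t
    using ap[of t] that by (cases "t = T") auto
  then show ?thesis using that smooth_polynomial_on_circle[OF rg] per unfolding \<psi>_def by blast
qed

lemma smooth_mean_zero_antiderivative:
  assumes T: "0 < T" and \<psi>: "smooth_real \<psi>" "periodic T \<psi>" "(LBINT t:{0..T}. \<psi> t) = 0"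
  obtains \<phi> where "smooth_real \<phi>" "periodic T \<phi>" "deriv \<phi> = \<psi>"
proof -
  have "\<exists>F. \<forall>x::real. - \<infinity> < ereal x \<longrightarrow> ereal x < \<infinity> \<longrightarrow> (F has_vector_derivative \<psi> x) (at x)"
    by (rule einterval_antiderivative)
       (use smooth_real_continuous[OF \<psi>(1), of UNIV] in \<open>auto simp: continuous_on_eq_continuous_at\<close>)
  then obtain F where F: "\<And>x. (F has_real_derivative \<psi> x) (at x)"
    by (auto simp: has_real_derivative_iff_has_vector_derivative)
  have "((\<lambda>t. F (t + T) - F t) has_real_derivative 0) (at t)" for t
  proof -
    have "((\<lambda>t. F (t + T) - F t) has_real_derivative \<psi> (t + T) * 1 - \<psi> t) (at t)"
      by (intro DERIV_diff DERIV_chain2[OF F] F) (auto intro!: derivative_eq_intros)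
    then show ?thesis using \<psi>(2) by (simp add: periodic_def)
  qed
  then have "F (t + T) - F t = F (0 + T) - F 0" for t
    by (intro DERIV_isconst_all) auto
  moreover have "F T - F 0 = 0"
  proof -
    have i: "set_integrable lborel {0..T} \<psi>"
      by (intro borel_integrable_atLeastAtMost' smooth_real_continuous \<psi>)
    have "(\<psi> has_integral F T - F 0) {0..T}"
      using T F by (intro fundamental_theorem_of_calculus)
        (auto intro: has_field_derivative_at_within simp flip: has_real_derivative_iff_has_vector_derivative)
    then show ?thesis using set_borel_integral_eq_integral(2)[OF i] \<psi>(3) by (simp add: integral_unique)
  qed
  ultimately have "periodic T F" by (simp add: periodic_def)
  moreover have "deriv F = \<psi>" using F DERIV_imp_deriv by blast
  ultimately show ?thesis using that smooth_realI[OF F \<psi>(1)] by blast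
qed

text \<open>
  The derivatives of periodic test functions are exactly the test functions of mean zero. So, after
  subtraction of its mean, \<open>u\<close> is orthogonal to every test function, and by density to itself.
\<close>
lemma constant_if_weak_derivative_zero:
  fixes u :: "real \<Rightarrow> real^2"
  assumes T: "0 < T" and u: "continuous_on {0..T} u" "u 0 = u T"
    and w: "\<And>\<phi>. smooth_real \<phi> \<Longrightarrow> periodic T \<phi> \<Longrightarrow> (LBINT t:{0..T}. deriv \<phi> t *\<^sub>R u t) = 0"
    and t: "t \<in> {0..T}"
  shows "u t = u 0"
proof -
  have "u t $ i = u 0 $ i" for i
  proof -
    define m where "m = (LBINT t:{0..T}. u t $ i) / T"
    define h where "h = (\<lambda>t. u t $ i - m)"
    have ui: "continuous_on {0..T} (\<lambda>t. u t $ i)" by (intro continuous_intros u)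
    have h: "continuous_on {0..T} h" unfolding h_def by (intro continuous_intros u)
    have h0: "h 0 = h T" using u by (simp add: h_def)
    have int: "set_integrable lborel {0..T} f" if "continuous_on {0..T} f" for f :: "real \<Rightarrow> real"
      using that by (rule borel_integrable_atLeastAtMost')
    have c: "(LBINT t:{0..T}. c) = c * T" for c :: real
      using T by (simp add: set_lebesgue_integral_def)
    have hm: "(LBINT t:{0..T}. h t) = 0"
    proof -
      have "(LBINT t:{0..T}. h t) = (LBINT t:{0..T}. u t $ i) - (LBINT t:{0..T}. m)"
        unfolding h_def by (rule set_integral_diff) (intro int ui continuous_intros)+
      then show ?thesis unfolding c using T by (simp add: m_def)
    qed
    have mz: "(LBINT t:{0..T}. \<psi> t * h t) = 0" if \<psi>: "smooth_real \<psi>" "periodic T \<psi>" for \<psi>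
    proof -
      define c where "c = (LBINT t:{0..T}. \<psi> t) / T"
      have \<psi>c: "continuous_on {0..T} \<psi>" by (rule smooth_real_continuous[OF \<psi>(1)])
      have "smooth_real (\<lambda>t. \<psi> t - c)"
        by (rule smooth_realI[of _ "deriv \<psi>"])
           (auto intro!: derivative_eq_intros smooth_real_has_deriv smooth_real_deriv \<psi>)
      moreover have "periodic T (\<lambda>t. \<psi> t - c)" using \<psi>(2) by (simp add: periodic_def)
      moreover have mc: "(LBINT t:{0..T}. \<psi> t - c) = 0"
      proof -
        have "(LBINT t:{0..T}. \<psi> t - c) = (LBINT t:{0..T}. \<psi> t) - (LBINT t:{0..T}. c)"
          by (rule set_integral_diff) (intro int \<psi>c continuous_intros)+
        then show ?thesis unfolding \<open>\<And>c. (LBINT t:{0..T}. c) = c * T\<close> using T by (simp add: c_def)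
      qed
      ultimately obtain \<phi> where \<phi>: "smooth_real \<phi>" "periodic T \<phi>" "deriv \<phi> = (\<lambda>t. \<psi> t - c)"
        using smooth_mean_zero_antiderivative[OF T] by blast
      have ic: "set_integrable lborel {0..T} (\<lambda>t. (\<psi> t - c) *\<^sub>R u t)"
        by (intro borel_integrable_atLeastAtMost' continuous_intros \<psi>c u)
      have "(LBINT t:{0..T}. (\<psi> t - c) * u t $ i) = (LBINT t:{0..T}. (\<psi> t - c) *\<^sub>R u t) $ i"
        using integral_bounded_linear[OF bounded_linear_vec_nth ic[unfolded set_integrable_def], of i]
        by (simp add: set_lebesgue_integral_def mult.assoc)
      also have "\<dots> = 0" using w[OF \<phi>(1,2)] \<phi>(3) by simp
      finally have z: "(LBINT t:{0..T}. (\<psi> t - c) * u t $ i) = 0" .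
      have "(LBINT t:{0..T}. \<psi> t * h t) = (LBINT t:{0..T}. ((\<psi> t - c) * u t $ i - m * (\<psi> t - c)) + c * h t)"
        by (simp add: h_def algebra_simps)
      also have "\<dots> = (LBINT t:{0..T}. (\<psi> t - c) * u t $ i - m * (\<psi> t - c)) + (LBINT t:{0..T}. c * h t)"
        by (rule set_integral_add) (intro int \<psi>c continuous_intros ui h)+
      also have "(LBINT t:{0..T}. (\<psi> t - c) * u t $ i - m * (\<psi> t - c))
          = (LBINT t:{0..T}. (\<psi> t - c) * u t $ i) - (LBINT t:{0..T}. m * (\<psi> t - c))"
        by (rule set_integral_diff) (intro int \<psi>c continuous_intros ui h)+
      finally show ?thesis using z mc hm by simp
    qed
    have hb: "(LBINT t:{0..T}. (h t)\<^sup>2) \<le> e * (LBINT t:{0..T}. \<bar>h t\<bar>)" if e: "0 < e" for e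
    proof -
      obtain \<psi> where \<psi>: "smooth_real \<psi>" "periodic T \<psi>" "\<And>t. t \<in> {0..T} \<Longrightarrow> \<bar>h t - \<psi> t\<bar> < e"
        using continuous_loop_approx_smooth[OF T h h0 e] by blast
      have \<psi>c: "continuous_on {0..T} \<psi>" by (rule smooth_real_continuous[OF \<psi>(1)])
      have "(LBINT t:{0..T}. (h t)\<^sup>2) = (LBINT t:{0..T}. (h t - \<psi> t) * h t + \<psi> t * h t)"
        by (simp add: power2_eq_square algebra_simps)
      also have "\<dots> = (LBINT t:{0..T}. (h t - \<psi> t) * h t) + (LBINT t:{0..T}. \<psi> t * h t)"
        by (rule set_integral_add) (intro int \<psi>c continuous_intros h)+
      also have "\<dots> = (LBINT t:{0..T}. (h t - \<psi> t) * h t)" using mz \<psi> by simp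
      also have "\<dots> \<le> (LBINT t:{0..T}. e * \<bar>h t\<bar>)"
      proof (rule set_integral_mono)
        fix t assume "t \<in> {0..T}"
        then have "\<bar>(h t - \<psi> t) * h t\<bar> \<le> e * \<bar>h t\<bar>"
          using \<psi>(3)[of t] by (auto simp: abs_mult intro!: mult_right_mono)
        then show "(h t - \<psi> t) * h t \<le> e * \<bar>h t\<bar>" by linarith
      qed (intro int \<psi>c continuous_intros h)+
      finally show ?thesis by simp
    qed
    define A where "A = (LBINT t:{0..T}. \<bar>h t\<bar>)"
    have "(LBINT t:{0..T}. (h t)\<^sup>2) \<le> 0"
    proof (rule field_le_epsilon)
      fix e :: real assume e: "0 < e"
      have A0: "0 \<le> A" unfolding A_def set_lebesgue_integral_def by (intro integral_nonneg_AE) auto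
      have "(LBINT t:{0..T}. (h t)\<^sup>2) \<le> e / (A + 1) * A"
        using hb[of "e / (A+1)"] e A0 unfolding A_def by simp
      also have "\<dots> \<le> e" using e A0 by (simp add: field_simps)
      finally show "(LBINT t:{0..T}. (h t)\<^sup>2) \<le> 0 + e" by simp
    qed
    moreover have i2: "set_integrable lborel {0..T} (\<lambda>t. (h t)\<^sup>2)" by (intro int continuous_intros h)
    ultimately have "integral {0..T} (\<lambda>t. (h t)\<^sup>2) \<le> 0"
      using set_borel_integral_eq_integral[OF i2] by simp
    moreover have "0 \<le> integral {0..T} (\<lambda>t. (h t)\<^sup>2)" by (rule integral_nonneg)
      (use set_borel_integral_eq_integral[OF i2] in auto)
    ultimately have "((\<lambda>t. (h t)\<^sup>2) has_integral 0) (cbox 0 T)"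
      using set_borel_integral_eq_integral(1)[OF i2] by (simp add: has_integral_iff)
    moreover have "continuous_on (cbox 0 T) (\<lambda>t. (h t)\<^sup>2)" using h by (auto intro: continuous_intros)
    ultimately have "(h s)\<^sup>2 = 0" if "s \<in> {0..T}" for s
      using has_integral_0_cbox_imp_0[of 0 T "\<lambda>t. (h t)\<^sup>2" s] T that by auto
    then show ?thesis using t T by (simp add: h_def)
  qed
  then show ?thesis by (simp add: vec_eq_iff)
qed

text \<open>
  Testing with the constant function shows that \<open>w\<close> has mean zero, so its indefinite integral is
  periodic and has the same weak derivative as \<open>u\<close>.
\<close>
lemma weak_derivative_imp_primitive:
  fixes u w :: "real \<Rightarrow> real^2"
  assumes T: "0 < T" and u: "continuous_on {0..T} u" and w: "has_weak_derivative T u w"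
  shows "primitive_on T u w"
proof -
  have iw: "set_integrable lborel {0..T} w" and pu: "periodic T u"
    and test: "\<And>\<phi>. smooth_real \<phi> \<Longrightarrow> periodic T \<phi> \<Longrightarrow>
        (LBINT t:{0..T}. deriv \<phi> t *\<^sub>R u t) = - (LBINT t:{0..T}. \<phi> t *\<^sub>R w t)"
    using w by (auto simp: has_weak_derivative_def)
  have u0: "u 0 = u T" using pu by (metis add_0 periodic_def)
  define W where "W = (\<lambda>t. LBINT s:{0..t}. w s)"
  have prim: "primitive_on T W w"
    unfolding W_def by (rule primitive_on_indefinite_integral[OF iw])
  have "(LBINT t:{0..T}. deriv (\<lambda>_. 1) t *\<^sub>R u t) = - (LBINT t:{0..T}. 1 *\<^sub>R w t)"
  proof (rule test)
    have "smooth_real (\<lambda>t. (\<lambda>_::complex. 1) (cis (1 * t)))"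
      by (rule smooth_polynomial_on_circle) auto
    then show "smooth_real (\<lambda>_. 1)" by simp
  qed (simp add: periodic_def)
  then have WT: "W T = 0" by (simp add: W_def)
  have W0: "W 0 = 0"
    using primitive_on_integral[OF prim, of 0 0] T by (simp add: W_def)
  have Wc: "continuous_on {0..T} W" by (rule primitive_on_continuous[OF prim])
  have "u t - W t = u 0 - W 0" if t: "t \<in> {0..T}" for t
  proof (rule constant_if_weak_derivative_zero[where u = "\<lambda>t. u t - W t", OF T _ _ _ t])
    show "continuous_on {0..T} (\<lambda>t. u t - W t)" by (intro continuous_intros u Wc)
    show "u 0 - W 0 = u T - W T" using u0 W0 WT by simp
    fix \<phi> assume \<phi>: "smooth_real \<phi>" "periodic T \<phi>"
    have c: "continuous_on {0..T} (deriv \<phi>)" by (intro smooth_real_continuous smooth_real_deriv \<phi>)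
    have "(LBINT t:{0..T}. deriv \<phi> t *\<^sub>R W t) + (LBINT t:{0..T}. \<phi> t *\<^sub>R w t) = \<phi> T *\<^sub>R W T - \<phi> 0 *\<^sub>R W 0"
      using T smooth_real_has_deriv[OF \<phi>(1)]
      by (intro primitive_on_by_parts[OF prim] c)
         (auto intro: has_field_derivative_at_within simp flip: has_real_derivative_iff_has_vector_derivative)
    then have "(LBINT t:{0..T}. deriv \<phi> t *\<^sub>R W t) = - (LBINT t:{0..T}. \<phi> t *\<^sub>R w t)"
      using W0 WT by (simp add: eq_neg_iff_add_eq_0)
    then have "(LBINT t:{0..T}. deriv \<phi> t *\<^sub>R u t) - (LBINT t:{0..T}. deriv \<phi> t *\<^sub>R W t) = 0"
      using test[OF \<phi>] by simp
    moreover have "(LBINT t:{0..T}. deriv \<phi> t *\<^sub>R u t - deriv \<phi> t *\<^sub>R W t)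
        = (LBINT t:{0..T}. deriv \<phi> t *\<^sub>R u t) - (LBINT t:{0..T}. deriv \<phi> t *\<^sub>R W t)"
      by (rule set_integral_diff) (intro borel_integrable_atLeastAtMost' continuous_intros c u Wc)+
    ultimately show "(LBINT t:{0..T}. deriv \<phi> t *\<^sub>R (u t - W t)) = 0"
      by (simp add: scaleR_diff_right)
  qed
  then have "u b - u a = W b - W a" if "a \<in> {0..T}" "b \<in> {0..T}" for a b
    using that by (smt (verit) add_diff_cancel_left' diff_add_cancel diff_diff_add)
  then show ?thesis using prim unfolding primitive_on_def by auto
qed

section \<open>Dyadic difference quotients and square integrable derivatives\<close>

lemma L2_Icc_integrable:
  fixes f :: "real \<Rightarrow> 'a::euclidean_space"
  assumes m: "set_borel_measurable lborel {a..b} f"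
    and sq: "set_integrable lborel {a..b} (\<lambda>t. (norm (f t))\<^sup>2)"
  shows "set_integrable lborel {a..b} f"
proof (rule set_integrable_bound[OF _ m])
  have "set_integrable lborel {a..b} (\<lambda>t. 1::real)"
    by (intro borel_integrable_atLeastAtMost' continuous_intros)
  then show "set_integrable lborel {a..b} (\<lambda>t. 1 + (norm (f t))\<^sup>2)"
    using sq by (rule set_integral_add)
  have "norm (f t) \<le> norm (1 + (norm (f t))\<^sup>2)" for t
  proof -
    have "0 \<le> (norm (f t) - 1)\<^sup>2" by simp
    then have "2 * norm (f t) \<le> 1 + (norm (f t))\<^sup>2" by (simp add: power2_diff)
    then show ?thesis using norm_ge_zero[of "f t"] by (simp del: norm_ge_zero)
  qed
  then show "AE t in lborel. t \<in> {a..b} \<longrightarrow> norm (f t) \<le> norm (1 + (norm (f t))\<^sup>2)" by simp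
qed

text \<open>
  Both follow from \<open>0 \<le> \<integral>(\<bar>f\<bar> - m)\<^sup>2\<close>, with \<open>m\<close> the mean value of \<open>\<bar>f\<bar>\<close>.
\<close>
lemma Cauchy_Schwarz_Icc:
  fixes f :: "real \<Rightarrow> 'a::euclidean_space"
  assumes m: "set_borel_measurable lborel {a..b} f"
    and sq: "set_integrable lborel {a..b} (\<lambda>t. (norm (f t))\<^sup>2)"
    and ab: "a \<le> b"
  shows "(LBINT t:{a..b}. norm (f t))\<^sup>2 \<le> (b - a) * (LBINT t:{a..b}. (norm (f t))\<^sup>2)"
    and "(norm (LBINT t:{a..b}. f t))\<^sup>2 \<le> (b - a) * (LBINT t:{a..b}. (norm (f t))\<^sup>2)"
proof -
  have f: "set_integrable lborel {a..b} f" by (rule L2_Icc_integrable[OF m sq])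
  have n: "set_integrable lborel {a..b} (\<lambda>t. norm (f t))" by (rule set_integrable_norm[OF f])
  define I where "I = (LBINT t:{a..b}. norm (f t))"
  define J where "J = (LBINT t:{a..b}. (norm (f t))\<^sup>2)"
  have c: "(LBINT t:{a..b}. c) = c * (b - a)" "set_integrable lborel {a..b} (\<lambda>t. c)" for c :: real
    using ab by (auto simp: set_lebesgue_integral_def intro: borel_integrable_atLeastAtMost' continuous_intros)
  have pos: "0 \<le> J - 2 * m * I + m\<^sup>2 * (b - a)" for m
  proof -
    have "0 \<le> (LBINT t:{a..b}. (norm (f t) - m)\<^sup>2)"
      unfolding set_lebesgue_integral_def by (intro integral_nonneg_AE) auto
    also have "\<dots> = (LBINT t:{a..b}. ((norm (f t))\<^sup>2 - (2 * m) * norm (f t)) + m\<^sup>2)"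
      by (simp add: power2_diff algebra_simps)
    also have "\<dots> = (LBINT t:{a..b}. (norm (f t))\<^sup>2 - (2 * m) * norm (f t)) + (LBINT t:{a..b}. m\<^sup>2)"
      using sq n c(2) by (intro set_integral_add set_integral_diff set_integrable_mult_right) auto
    also have "(LBINT t:{a..b}. (norm (f t))\<^sup>2 - (2 * m) * norm (f t)) = J - (LBINT t:{a..b}. (2 * m) * norm (f t))"
      unfolding J_def using sq n by (intro set_integral_diff set_integrable_mult_right) auto
    finally show ?thesis unfolding c set_integral_mult_right by (simp add: I_def)
  qed
  have "I\<^sup>2 \<le> (b - a) * J"
  proof (cases "a = b")
    case True
    have "AE t in lborel. indicat_real {a..b} t *\<^sub>R norm (f t) = 0"
      by (rule eventually_mono[OF AE_lborel_singleton[of a]]) (use True in auto)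
    then have "I = 0"
      unfolding I_def set_lebesgue_integral_def
      using n[unfolded set_integrable_def] by (simp add: integral_eq_zero_AE)
    then show ?thesis using True by simp
  next
    case False
    then have ba: "0 < b - a" using ab by simp
    have "0 \<le> J - 2 * (I / (b - a)) * I + (I / (b - a))\<^sup>2 * (b - a)" by (rule pos)
    also have "\<dots> = J - I\<^sup>2 / (b - a)"
      using ba by (simp add: power2_eq_square)
    finally show ?thesis using ba by (simp add: field_simps)
  qed
  then show 1: "(LBINT t:{a..b}. norm (f t))\<^sup>2 \<le> (b - a) * (LBINT t:{a..b}. (norm (f t))\<^sup>2)"
    by (simp add: I_def J_def)
  have "norm (LBINT t:{a..b}. f t) \<le> (LBINT t:{a..b}. norm (f t))"
    by (rule set_integral_norm_bound[OF f])
  then have "(norm (LBINT t:{a..b}. f t))\<^sup>2 \<le> (LBINT t:{a..b}. norm (f t))\<^sup>2"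
    by (intro power_mono) auto
  with 1 show "(norm (LBINT t:{a..b}. f t))\<^sup>2 \<le> (b - a) * (LBINT t:{a..b}. (norm (f t))\<^sup>2)"
    by linarith
qed

text \<open>
  The Dirichlet energy of the function that interpolates \<open>f\<close> linearly between the points
  \<open>T k / 2\<^sup>n\<close> of \<open>[0, T]\<close>.
\<close>
definition dyadic_energy :: "real \<Rightarrow> (real \<Rightarrow> 'a::euclidean_space) \<Rightarrow> nat \<Rightarrow> real" where
  "dyadic_energy T f n =
     (\<Sum>k<2^n. (norm (f (T * real (Suc k) / 2^n) - f (T * real k / 2^n)))\<^sup>2 / (T / 2^n))"

text \<open>
  A control function \<open>E\<close> replaces \<open>\<integral>\<^sub>0\<^sup>t \<bar>f'\<bar>\<^sup>2\<close>: unlike that integral, it behaves well under a change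
  of variables that is only known to be bi-Lipschitz.
\<close>
lemma dyadic_energy_le_control:
  assumes T: "0 < T"
    and E: "\<And>a b. 0 \<le> a \<Longrightarrow> a \<le> b \<Longrightarrow> b \<le> T \<Longrightarrow> (norm (f b - f a))\<^sup>2 \<le> (b - a) * (E b - E a)"
  shows "dyadic_energy T f n \<le> E T - E 0"
proof -
  define x where "x k = T * real k / 2^n" for k
  have "dyadic_energy T f n \<le> (\<Sum>k<2^n. E (x (Suc k)) - E (x k))"
    unfolding dyadic_energy_def
  proof (rule sum_mono)
    fix k :: nat assume "k \<in> {..<2^n}"
    then have "Suc k \<le> 2^n" by simp
    then have k: "real (Suc k) \<le> 2^n" by (metis of_nat_le_iff of_nat_numeral of_nat_power)
    have "T * real (Suc k) \<le> T * 2^n" using k T by (intro mult_left_mono) auto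
    then have "x (Suc k) \<le> T" unfolding x_def by (simp add: divide_le_eq)
    moreover have "0 \<le> x k" "x k \<le> x (Suc k)" using T by (auto simp: x_def field_simps)
    ultimately have "(norm (f (x (Suc k)) - f (x k)))\<^sup>2 \<le> (x (Suc k) - x k) * (E (x (Suc k)) - E (x k))"
      by (intro E)
    also have "x (Suc k) - x k = T / 2^n" by (simp add: x_def field_simps)
    finally show "(norm (f (T * real (Suc k) / 2^n) - f (T * real k / 2^n)))\<^sup>2 / (T / 2^n)
        \<le> E (x (Suc k)) - E (x k)"
      using T unfolding x_def[symmetric] by (simp add: field_simps)
  qed
  also have "\<dots> = E (x (2^n)) - E (x 0)" by (rule sum_lessThan_telescope)
  also have "\<dots> = E T - E 0" by (simp add: x_def)
  finally show ?thesis .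
qed

lemma primitive_increment_sq_le:
  fixes f g :: "real \<Rightarrow> 'a::euclidean_space"
  assumes p: "primitive_on T f g" and sq: "set_integrable lborel {0..T} (\<lambda>t. (norm (g t))\<^sup>2)"
    and ab: "0 \<le> a" "a \<le> b" "b \<le> T"
  shows "(norm (f b - f a))\<^sup>2 \<le> (b - a) * ((LBINT t:{0..b}. (norm (g t))\<^sup>2) - (LBINT t:{0..a}. (norm (g t))\<^sup>2))"
proof -
  have g: "set_integrable lborel {a..b} g" using p ab by (simp add: primitive_on_integrable)
  then have gm: "set_borel_measurable lborel {a..b} g"
    using borel_measurable_integrable unfolding set_integrable_def set_borel_measurable_def by blast
  have "(norm (LBINT t:{a..b}. g t))\<^sup>2 \<le> (b - a) * (LBINT t:{a..b}. (norm (g t))\<^sup>2)"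
    by (rule Cauchy_Schwarz_Icc(2)[OF gm]) (use ab in \<open>auto intro: set_integrable_subset[OF sq]\<close>)
  moreover have "(LBINT t:{0..b}. (norm (g t))\<^sup>2) = (LBINT t:{0..a}. (norm (g t))\<^sup>2) + (LBINT t:{a..b}. (norm (g t))\<^sup>2)"
    by (rule set_integral_split_Icc) (use ab in \<open>auto intro: set_integrable_subset[OF sq]\<close>)
  ultimately show ?thesis using primitive_on_integral[OF p ab] by simp
qed

lemma dyadic_energy_le_L2:
  fixes f g :: "real \<Rightarrow> 'a::euclidean_space"
  assumes T: "0 < T" and p: "primitive_on T f g"
    and sq: "set_integrable lborel {0..T} (\<lambda>t. (norm (g t))\<^sup>2)"
  shows "dyadic_energy T f n \<le> (LBINT t:{0..T}. (norm (g t))\<^sup>2)"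
proof -
  have "dyadic_energy T f n \<le> (LBINT t:{0..T}. (norm (g t))\<^sup>2) - (LBINT t:{0..0}. (norm (g t))\<^sup>2)"
    by (rule dyadic_energy_le_control[OF T primitive_increment_sq_le[OF p sq]])
  moreover have "0 \<le> (LBINT t:{0..0::real}. (norm (g t))\<^sup>2)"
    unfolding set_lebesgue_integral_def by (intro integral_nonneg_AE) auto
  ultimately show ?thesis by linarith
qed

text \<open>
  Fatou's lemma for squares. It is used with \<open>h = 0\<close> to place a limit in \<open>L\<^sup>2\<close>, and with \<open>h\<close> a member
  of the sequence to estimate the distance to the limit.
\<close>
lemma Fatou_L2:
  fixes g :: "real \<Rightarrow> 'a::euclidean_space"
  assumes [measurable]: "\<And>i. s i \<in> borel_measurable lborel" "g \<in> borel_measurable lborel"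
    "h \<in> borel_measurable lborel"
    and lim: "AE x in lborel. (\<lambda>i. s i x) \<longlonglongrightarrow> g x"
    and int: "\<And>i. N \<le> i \<Longrightarrow> integrable lborel (\<lambda>x. (norm (s i x - h x))\<^sup>2)"
    and le: "\<And>i. N \<le> i \<Longrightarrow> (LBINT x. (norm (s i x - h x))\<^sup>2) \<le> K"
  shows "integrable lborel (\<lambda>x. (norm (g x - h x))\<^sup>2)" "(LBINT x. (norm (g x - h x))\<^sup>2) \<le> K"
proof -
  have "(LBINT x. (norm (s N x - h x))\<^sup>2) \<ge> 0" by (intro integral_nonneg_AE) auto
  then have K: "0 \<le> K" using le[of N] by linarith
  have "(\<integral>\<^sup>+x. ennreal ((norm (g x - h x))\<^sup>2) \<partial>lborel)
      = (\<integral>\<^sup>+x. liminf (\<lambda>i. ennreal ((norm (s i x - h x))\<^sup>2)) \<partial>lborel)"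
  proof (rule nn_integral_cong_AE, rule eventually_mono[OF lim])
    fix x assume "(\<lambda>i. s i x) \<longlonglongrightarrow> g x"
    then have "(\<lambda>i. ennreal ((norm (s i x - h x))\<^sup>2)) \<longlonglongrightarrow> ennreal ((norm (g x - h x))\<^sup>2)"
      by (intro tendsto_intros)
    then show "ennreal ((norm (g x - h x))\<^sup>2) = liminf (\<lambda>i. ennreal ((norm (s i x - h x))\<^sup>2))"
      using lim_imp_Liminf[OF trivial_limit_sequentially] by metis
  qed
  also have "\<dots> \<le> liminf (\<lambda>i. (\<integral>\<^sup>+x. ennreal ((norm (s i x - h x))\<^sup>2) \<partial>lborel))"
    by (rule nn_integral_liminf) measurable
  also have "\<dots> \<le> liminf (\<lambda>i. ennreal K)"
  proof (rule Liminf_mono)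
    show "\<forall>\<^sub>F i in sequentially. (\<integral>\<^sup>+x. ennreal ((norm (s i x - h x))\<^sup>2) \<partial>lborel) \<le> ennreal K"
      unfolding eventually_sequentially
    proof (intro exI[of _ N] allI impI)
      fix i assume "N \<le> i"
      then show "(\<integral>\<^sup>+x. ennreal ((norm (s i x - h x))\<^sup>2) \<partial>lborel) \<le> ennreal K"
        using int le by (subst nn_integral_eq_integral) (auto intro: ennreal_leI)
    qed
  qed
  also have "\<dots> = ennreal K" by (simp add: Liminf_const)
  finally have nn: "(\<integral>\<^sup>+x. ennreal ((norm (g x - h x))\<^sup>2) \<partial>lborel) \<le> ennreal K" .
  show i: "integrable lborel (\<lambda>x. (norm (g x - h x))\<^sup>2)"
    by (rule integrableI_nonneg) (use nn in \<open>auto simp: top.not_eq_extremum intro: le_less_trans\<close>)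
  have "ennreal (LBINT x. (norm (g x - h x))\<^sup>2) \<le> ennreal K"
    using nn i by (subst (asm) nn_integral_eq_integral) auto
  then show "(LBINT x. (norm (g x - h x))\<^sup>2) \<le> K" using K by simp
qed

text \<open>
  Let \<open>s n\<close> be the step function of difference quotients at level \<open>n\<close>. Its integral over a dyadic
  interval of a coarser level is the increment of \<open>f\<close>, so that \<open>\<integral>s m \<bullet> s n\<close> is the energy \<open>S n\<close>
  whenever \<open>n \<le> m\<close>, and \<open>\<integral>\<bar>s m - s n\<bar>\<^sup>2 = S m - S n\<close>. Thus \<open>S\<close> increases, and boundedness makes
  \<open>s\<close> a Cauchy sequence in \<open>L\<^sup>2\<close>. Its limit integrates to the increments of \<open>f\<close> between dyadic points,
  and by continuity between all points.
\<close>
proposition L2_primitive_if_dyadic_energy_bounded: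
  fixes f :: "real \<Rightarrow> 'a::euclidean_space"
  assumes T: "0 < T" and fc: "continuous_on {0..T} f" and M: "\<And>n. dyadic_energy T f n \<le> M"
  obtains g where "primitive_on T f g" "set_integrable lborel {0..T} (\<lambda>t. (norm (g t))\<^sup>2)"
    "(LBINT t:{0..T}. (norm (g t))\<^sup>2) \<le> M"
proof -
  define x where "x n k = T * real k / 2^n" for n k :: nat
  define I where "I n k = {x n k..<x n (Suc k)}" for n k
  define q where "q n k = (2^n / T) *\<^sub>R (f (x n (Suc k)) - f (x n k))" for n k
  define s where "s n t = (\<Sum>k<2^n. indicat_real (I n k) t *\<^sub>R q n k)" for n t
  define S where "S n = dyadic_energy T f n" for n
  have x0: "x n 0 = 0" for n by (simp add: x_def)
  have xmono: "x n j \<le> x n k" if "j \<le> k" for n j k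
    using that T by (auto simp: x_def intro!: divide_right_mono mult_left_mono)
  have xT: "x n k \<le> T" if "k \<le> 2^n" for n k
  proof -
    have "real k \<le> 2^n" using that by (metis of_nat_le_iff of_nat_numeral of_nat_power)
    then have "T * real k \<le> T * 2^n" using T by (intro mult_left_mono) auto
    then show ?thesis by (simp add: x_def divide_le_eq)
  qed
  have xpos: "0 \<le> x n k" for n k using T by (simp add: x_def)
  have xstep: "x n (Suc k) - x n k = T / 2^n" for n k by (simp add: x_def field_simps)
  have Im[measurable]: "I n k \<in> sets borel" for n k by (simp add: I_def)
  have I_iff: "t \<in> I n k \<longleftrightarrow> real k \<le> t * 2^n / T \<and> t * 2^n / T < real k + 1" for n k t
    using T by (auto simp: I_def x_def field_simps)
  have s_eq: "s n t = q n k" if "t \<in> I n k" "k < 2^n" for n k t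
  proof -
    have "indicat_real (I n j) t = (if j = k then 1 else 0)" for j
    proof (cases "t \<in> I n j")
      case True
      then have "real k < real j + 1" "real j < real k + 1" using that(1) unfolding I_iff by linarith+
      then have "j = k" by linarith
      then show ?thesis using that by simp
    next
      case False then show ?thesis using that by auto
    qed
    then show ?thesis using that(2) by (simp add: s_def if_distrib[of "\<lambda>c. c *\<^sub>R _"] cong: if_cong)
  qed
  have s_out: "s n t = 0" if "t \<notin> {0..T}" for n t
  proof -
    have "t \<notin> I n k" if "k < 2^n" for k
      using \<open>t \<notin> {0..T}\<close> xpos[of n k] xT[of "Suc k" n] that by (auto simp: I_def)
    then show ?thesis by (simp add: s_def)
  qed
  have Ii: "integrable lborel (indicat_real (I n k))" for n k
    using xmono[of k "Suc k" n] by (intro integrable_real_indicator) (auto simp: I_def)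
  have si[simp]: "integrable lborel (s n)" for n
    unfolding s_def by (intro Bochner_Integration.integrable_sum integrable_scaleR_left Ii)
  have sm[measurable]: "s n \<in> borel_measurable lborel" for n
    using si borel_measurable_integrable by blast
  have sset: "set_integrable lborel A (s n)" if "A \<in> sets borel" for A n
    using integrable_mult_indicator[OF _ si[of n], of A] that by (simp add: set_integrable_def)
  have half: "(LBINT t:{a..<b}. s n t) = (LBINT t:{a..b}. s n t)" for a b n
    by (rule set_integral_cong_set)
       (auto simp: set_borel_measurable_def intro: eventually_mono[OF AE_lborel_singleton[of b]])
  have cell: "(LBINT t:I n k. s n t) = f (x n (Suc k)) - f (x n k)" if "k < 2^n" for n k
  proof -
    have "(LBINT t:I n k. s n t) = (LBINT t. indicat_real (I n k) t *\<^sub>R q n k)"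
      unfolding set_lebesgue_integral_def
      by (intro Bochner_Integration.integral_cong) (auto simp: indicator_def s_eq that)
    also have "\<dots> = (LBINT t. indicat_real (I n k) t) *\<^sub>R q n k"
      using Ii by (intro integral_scaleR_left) auto
    also have "(LBINT t. indicat_real (I n k) t) = T / 2^n"
      using xmono[of k "Suc k" n] xstep[of n k] by (simp add: I_def)
    finally show ?thesis using T by (simp add: q_def)
  qed
  have grid: "(LBINT t:{0..x n k}. s n t) = f (x n k) - f 0" if "k \<le> 2^n" for n k
    using that
  proof (induction k)
    case 0
    have "(LBINT t:{0..<0}. s n t) = 0" by (simp add: set_lebesgue_integral_def)
    then show ?case unfolding half x0 by simp
  next
    case (Suc k)
    have "(LBINT t:{0..x n (Suc k)}. s n t) = (LBINT t:{0..x n k}. s n t) + (LBINT t:{x n k..x n (Suc k)}. s n t)"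
      using xpos xmono by (intro set_integral_split_Icc sset) auto
    then show ?case using Suc cell[of k n] by (simp add: I_def half)
  qed
  have grid': "(LBINT t:{0..x n k}. s m t) = f (x n k) - f 0" if "n \<le> m" "k \<le> 2^n" for n m k
  proof -
    have p: "(2::nat)^m = 2^(m-n) * 2^n" "(2::real)^m = 2^(m-n) * 2^n"
      using that(1) by (simp_all flip: power_add)
    then have "x n k = x m (k * 2^(m-n))" by (simp add: x_def)
    moreover have "k * 2^(m-n) \<le> 2^m" using that p by simp
    ultimately show ?thesis using grid by simp
  qed
  have cell': "(LBINT t:I n k. s m t) = f (x n (Suc k)) - f (x n k)" if "n \<le> m" "k < 2^n" for n m k
  proof -
    have "(LBINT t:{0..x n (Suc k)}. s m t) = (LBINT t:{0..x n k}. s m t) + (LBINT t:{x n k..x n (Suc k)}. s m t)"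
      using xpos xmono by (intro set_integral_split_Icc sset) auto
    then show ?thesis using grid'[of n m k] grid'[of n m "Suc k"] that by (simp add: I_def half)
  qed
  have ip: "integrable lborel (\<lambda>t. s m t \<bullet> s n t)"
    and inner: "n \<le> m \<Longrightarrow> (LBINT t. s m t \<bullet> s n t) = S n" for m n
  proof -
    have e: "(\<lambda>t. s m t \<bullet> s n t) = (\<lambda>t. \<Sum>k<2^n. (indicat_real (I n k) t *\<^sub>R s m t) \<bullet> q n k)"
      by (simp add: s_def[of n] inner_sum_right)
    have i: "integrable lborel (\<lambda>t. indicat_real (I n k) t *\<^sub>R s m t)" for k
      using sset[of "I n k" m] by (simp add: set_integrable_def)
    show "integrable lborel (\<lambda>t. s m t \<bullet> s n t)"
      unfolding e by (intro Bochner_Integration.integrable_sum integrable_inner_left i)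
    assume nm: "n \<le> m"
    have "(LBINT t. s m t \<bullet> s n t) = (\<Sum>k<2^n. (LBINT t. (indicat_real (I n k) t *\<^sub>R s m t) \<bullet> q n k))"
      unfolding e by (intro Bochner_Integration.integral_sum integrable_inner_left i)
    also have "\<dots> = (\<Sum>k<2^n. (LBINT t:I n k. s m t) \<bullet> q n k)"
      unfolding set_lebesgue_integral_def by (intro sum.cong refl integral_inner_left i)
    also have "\<dots> = (\<Sum>k<2^n. (norm (f (x n (Suc k)) - f (x n k)))\<^sup>2 / (T / 2^n))"
      by (intro sum.cong refl) (simp add: cell' nm q_def power2_norm_eq_inner)
    finally show "(LBINT t. s m t \<bullet> s n t) = S n" by (simp add: S_def dyadic_energy_def x_def)
  qed
  have sq_eq: "(norm (s m t - s n t))\<^sup>2 = s m t \<bullet> s m t - 2 * (s m t \<bullet> s n t) + s n t \<bullet> s n t" for m n t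
    by (simp add: power2_norm_eq_inner inner_diff_left inner_diff_right inner_commute)
  have sqi: "integrable lborel (\<lambda>t. (norm (s m t - s n t))\<^sup>2)" for m n
    unfolding sq_eq by (intro Bochner_Integration.integrable_add Bochner_Integration.integrable_diff integrable_mult_right ip)
  have sqd: "(LBINT t. (norm (s m t - s n t))\<^sup>2) = S m - S n" if "n \<le> m" for m n
  proof -
    have "(LBINT t. (norm (s m t - s n t))\<^sup>2)
      = (LBINT t. s m t \<bullet> s m t) - 2 * (LBINT t. s m t \<bullet> s n t) + (LBINT t. s n t \<bullet> s n t)"
      unfolding sq_eq using ip by simp
    then show ?thesis using inner[OF that] inner[of m m] inner[of n n] by simp
  qed
  have "incseq S"
  proof (rule incseq_SucI)
    fix n
    have "0 \<le> (LBINT t. (norm (s (Suc n) t - s n t))\<^sup>2)" by (intro integral_nonneg_AE) auto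
    then show "S n \<le> S (Suc n)" using sqd[of n "Suc n"] by simp
  qed
  then obtain C where C: "S \<longlonglongrightarrow> C" "\<And>n. S n \<le> C"
    using incseq_convergent[of S M] M by (metis S_def)
  have gap: "\<exists>N. \<forall>n\<ge>N. C - S n < e" if e: "0 < e" for e
  proof -
    obtain N where "\<forall>n\<ge>N. norm (S n - C) < e" using LIMSEQ_D[OF C(1) e] by blast
    then have "\<forall>n\<ge>N. C - S n < e" by (auto simp: abs_less_iff)
    then show ?thesis by blast
  qed
  have L1: "(LBINT t:{0..T}. norm (d t))\<^sup>2 \<le> T * K" "(norm (LBINT t:{0..b}. d t))\<^sup>2 \<le> T * K"
      "set_integrable lborel {0..T} d"
    if d[measurable]: "d \<in> borel_measurable lborel" and di: "integrable lborel (\<lambda>t. (norm (d t))\<^sup>2)"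
      and K: "(LBINT t. (norm (d t))\<^sup>2) \<le> K" and b: "0 \<le> b" "b \<le> T" for d :: "real \<Rightarrow> 'a" and K b
  proof -
    have m: "set_borel_measurable lborel {0..c} d" for c by (simp add: set_borel_measurable_def)
    have i: "set_integrable lborel {0..c} (\<lambda>t. (norm (d t))\<^sup>2)" for c
      using integrable_mult_indicator[OF _ di, of "{0..c}"] by (simp add: set_integrable_def)
    show "set_integrable lborel {0..T} d" by (rule L2_Icc_integrable[OF m i])
    have le: "(LBINT t:{0..c}. (norm (d t))\<^sup>2) \<le> K" for c
    proof -
      have "(LBINT t:{0..c}. (norm (d t))\<^sup>2) \<le> (LBINT t. (norm (d t))\<^sup>2)"
        unfolding set_lebesgue_integral_def
        by (rule integral_mono[OF i[unfolded set_integrable_def] di]) (auto simp: indicator_def)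
      then show ?thesis using K by simp
    qed
    have nn: "0 \<le> (LBINT t:{0..c}. (norm (d t))\<^sup>2)" for c
      unfolding set_lebesgue_integral_def by (intro integral_nonneg_AE) auto
    have "(c - 0) * (LBINT t:{0..c}. (norm (d t))\<^sup>2) \<le> T * K" if "0 \<le> c" "c \<le> T" for c
      using that le[of c] nn[of c] by (intro mult_mono) auto
    then show "(LBINT t:{0..T}. norm (d t))\<^sup>2 \<le> T * K" "(norm (LBINT t:{0..b}. d t))\<^sup>2 \<le> T * K"
      using Cauchy_Schwarz_Icc(1)[OF m i, of T] Cauchy_Schwarz_Icc(2)[OF m i, of b] T b
      by (meson less_imp_le order.trans order_refl)+
  qed
  have cau: "\<exists>N. \<forall>i\<ge>N. \<forall>j\<ge>N. (LBINT t. norm (s i t - s j t)) < e" if e: "0 < e" for e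
  proof -
    obtain N where N: "\<And>n. n \<ge> N \<Longrightarrow> C - S n < e\<^sup>2 / T" using gap[of "e\<^sup>2 / T"] e T by auto
    have *: "(LBINT t. norm (s i t - s j t)) < e" if "N \<le> j" "j \<le> i" for i j
    proof -
      have "(LBINT t:{0..T}. norm (s i t - s j t))\<^sup>2 \<le> T * (S i - S j)"
        using T sqd[OF that(2)] by (intro L1(1)[where b = 0] sqi) auto
      also have "\<dots> < T * (e\<^sup>2 / T)"
        using N[OF that(1)] C(2)[of i] T by (intro mult_strict_left_mono) auto
      finally have "(LBINT t:{0..T}. norm (s i t - s j t))\<^sup>2 < e\<^sup>2" using T by simp
      then have lt: "(LBINT t:{0..T}. norm (s i t - s j t)) < e"
        using e by (simp add: power_less_imp_less_base)
      have ind: "indicat_real {0..T} t *\<^sub>R norm (s i t - s j t) = norm (s i t - s j t)" for t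
        by (cases "t \<in> {0..T}") (simp_all add: s_out)
      have "(LBINT t:{0..T}. norm (s i t - s j t)) = (LBINT t. norm (s i t - s j t))"
        by (simp only: set_lebesgue_integral_def ind)
      with lt show ?thesis by simp
    qed
    show ?thesis
    proof (intro exI[of _ N] allI impI)
      fix i j assume ij: "N \<le> i" "N \<le> j"
      show "(LBINT t. norm (s i t - s j t)) < e"
      proof (cases "j \<le> i")
        case True then show ?thesis using * ij by blast
      next
        case False then show ?thesis using *[of i j] ij by (simp add: norm_minus_commute)
      qed
    qed
  qed
  obtain r where r: "strict_mono r" "AE t in lborel. Cauchy (\<lambda>i. s (r i) t)"
    using cauchy_L1_AE_cauchy_subseq[OF si cau] by blast
  define g where "g t = lim (\<lambda>i. s (r i) t)" for t
  have gm[measurable]: "g \<in> borel_measurable lborel"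
    unfolding g_def by (rule borel_measurable_lim_metric) measurable
  have lim: "AE t in lborel. (\<lambda>i. s (r i) t) \<longlonglongrightarrow> g t"
    using r(2) by (rule eventually_mono) (simp add: g_def Cauchy_convergent_iff convergent_LIMSEQ_iff)
  have g2: "integrable lborel (\<lambda>t. (norm (g t))\<^sup>2)" "(LBINT t. (norm (g t))\<^sup>2) \<le> M"
  proof -
    have i: "integrable lborel (\<lambda>t. (norm (s n t - 0))\<^sup>2)" and e: "(LBINT t. (norm (s n t - 0))\<^sup>2) \<le> M" for n
      using ip[of n n] inner[of n n] M[of n] by (simp_all add: power2_norm_eq_inner S_def)
    show "integrable lborel (\<lambda>t. (norm (g t))\<^sup>2)" "(LBINT t. (norm (g t))\<^sup>2) \<le> M"
      using Fatou_L2[where h = "\<lambda>_. 0" and s = "\<lambda>i. s (r i)" and N = 0 and K = M, OF _ gm _ lim i e] by auto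
  qed
  have gs: "integrable lborel (\<lambda>t. (norm (g t - s n t))\<^sup>2)" "(LBINT t. (norm (g t - s n t))\<^sup>2) \<le> C - S n" for n
  proof -
    have le: "(LBINT t. (norm (s (r i) t - s n t))\<^sup>2) \<le> C - S n" if "n \<le> i" for i
      using sqd[of n "r i"] C(2)[of "r i"] seq_suble[OF r(1), of i] that by simp
    show "integrable lborel (\<lambda>t. (norm (g t - s n t))\<^sup>2)" "(LBINT t. (norm (g t - s n t))\<^sup>2) \<le> C - S n"
      using Fatou_L2[where h = "s n" and s = "\<lambda>i. s (r i)" and N = n, OF _ gm _ lim sqi le] by auto
  qed
  have gi: "set_integrable lborel {0..T} g" using L1(3)[OF gm g2, of 0] T by simp
  define W where "W t = (LBINT r:{0..t}. g r)" for t
  have W: "primitive_on T W g" unfolding W_def by (rule primitive_on_indefinite_integral[OF gi])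
  have Wgrid: "W (x n k) = f (x n k) - f 0" if k: "k \<le> 2^n" for n k
  proof -
    have xx: "0 \<le> x n k" "x n k \<le> T" using xpos xT[OF k] by auto
    have b: "(norm (W (x n k) - (f (x n k) - f 0)))\<^sup>2 \<le> T * (C - S m)" if "n \<le> m" for m
    proof -
      have "W (x n k) - (f (x n k) - f 0) = (LBINT t:{0..x n k}. g t - s m t)"
        unfolding W_def grid'[OF that k, symmetric]
        by (rule set_integral_diff(2)[symmetric]) (use xx in \<open>auto intro: sset set_integrable_subset[OF gi]\<close>)
      then show ?thesis using L1(2)[OF _ gs xx] by simp
    qed
    have "(\<lambda>m. T * (C - S m)) \<longlonglongrightarrow> T * (C - C)" by (intro tendsto_intros C)
    then have "(norm (W (x n k) - (f (x n k) - f 0)))\<^sup>2 \<le> T * (C - C)"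
      by (rule LIMSEQ_le_const) (use b in blast)
    then show ?thesis by simp
  qed
  have WW: "W b = f b - f 0" if b: "b \<in> {0..T}" for b
  proof -
    define k where "k n = nat \<lfloor>b * 2^n / T\<rfloor>" for n
    have kb: "real (k n) \<le> b * 2^n / T" "b * 2^n / T < real (k n) + 1" for n
      using b T by (auto simp: k_def)
    have k2: "k n \<le> 2^n" for n
    proof -
      have "b * 2^n / T \<le> 2^n" using b T by (simp add: divide_le_eq mult.commute)
      then have "real (k n) \<le> 2^n" using kb(1)[of n] by linarith
      then show ?thesis by (metis of_nat_le_iff of_nat_numeral of_nat_power)
    qed
    have lim: "(\<lambda>n. x n (k n)) \<longlonglongrightarrow> b"
    proof (rule real_tendsto_sandwich)
      have "b - T / 2^n \<le> x n (k n)" for n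
      proof -
        have "b = (b * 2^n / T) * (T / 2^n)" using T by simp
        also have "\<dots> \<le> (real (k n) + 1) * (T / 2^n)"
          using kb(2)[of n] T by (intro mult_right_mono) auto
        also have "\<dots> = x n (k n) + T / 2^n" by (simp add: x_def field_simps)
        finally show ?thesis by simp
      qed
      then show "\<forall>\<^sub>F n in sequentially. b - T / 2^n \<le> x n (k n)" by simp
      show "\<forall>\<^sub>F n in sequentially. x n (k n) \<le> b"
        using kb(1) T by (auto simp: x_def field_simps intro!: always_eventually)
      have "(\<lambda>n. b - T * (1/2)^n) \<longlonglongrightarrow> b - T * 0" by (intro tendsto_intros LIMSEQ_power_zero) auto
      then show "(\<lambda>n. b - T / 2^n) \<longlonglongrightarrow> b" by (simp add: power_divide)
    qed auto
    have in0: "\<forall>\<^sub>F n in sequentially. x n (k n) \<in> {0..T}" using xpos xT[OF k2] by auto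
    have "(\<lambda>n. W (x n (k n))) \<longlonglongrightarrow> W b"
      by (rule continuous_on_tendsto_compose[OF primitive_on_continuous[OF W] lim b in0])
    moreover have "(\<lambda>n. f (x n (k n)) - f 0) \<longlonglongrightarrow> f b - f 0"
      by (intro tendsto_intros continuous_on_tendsto_compose[OF fc lim b in0])
    ultimately show ?thesis using Wgrid[OF k2] LIMSEQ_unique by fastforce
  qed
  have "primitive_on T f g" using W WW unfolding primitive_on_def by auto
  moreover have "set_integrable lborel {0..T} (\<lambda>t. (norm (g t))\<^sup>2)"
    using integrable_mult_indicator[OF _ g2(1), of "{0..T}"] by (simp add: set_integrable_def)
  moreover have "(LBINT t:{0..T}. (norm (g t))\<^sup>2) \<le> M"
  proof -
    have "(LBINT t:{0..T}. (norm (g t))\<^sup>2) \<le> (LBINT t. (norm (g t))\<^sup>2)"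
      unfolding set_lebesgue_integral_def
      by (rule integral_mono[OF _ g2(1)])
         (use calculation(2) in \<open>auto simp: indicator_def set_integrable_def\<close>)
    then show ?thesis using g2(2) by simp
  qed
  ultimately show ?thesis using that by blast
qed

section \<open>Regular curves and their second derivatives\<close>

lemma set_integrable_imp_measurable:
  "set_integrable M A f \<Longrightarrow> set_borel_measurable M A f"
  unfolding set_integrable_def set_borel_measurable_def by (rule borel_measurable_integrable)

text \<open>
  \<open>v\<close> and \<open>v'\<close> give the same integrals against test functions, and the derivative of a test function
  is again one. So second weak derivatives do not depend on the chosen first weak derivative, and
  no statement about null sets is needed for it.
\<close>
lemma has_weak_derivative_second:
  assumes uv: "has_weak_derivative T u v" and uv': "has_weak_derivative T u v'"
    and vw: "has_weak_derivative T v w"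
  shows "has_weak_derivative T v' w"
  unfolding has_weak_derivative_def
proof (intro conjI allI impI)
  fix \<phi> assume \<phi>: "smooth_real \<phi>" "periodic T \<phi>"
  have \<phi>': "smooth_real (deriv \<phi>)" "periodic T (deriv \<phi>)"
    using \<phi> by (auto intro: smooth_real_deriv periodic_deriv)
  have e1: "(LBINT t:{0..T}. deriv (deriv \<phi>) t *\<^sub>R u t) = - (LBINT t:{0..T}. deriv \<phi> t *\<^sub>R v t)"
    using uv \<phi>' unfolding has_weak_derivative_def by blast
  have e2: "(LBINT t:{0..T}. deriv (deriv \<phi>) t *\<^sub>R u t) = - (LBINT t:{0..T}. deriv \<phi> t *\<^sub>R v' t)"
    using uv' \<phi>' unfolding has_weak_derivative_def by blast
  have e3: "(LBINT t:{0..T}. deriv \<phi> t *\<^sub>R v t) = - (LBINT t:{0..T}. \<phi> t *\<^sub>R w t)"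
    using vw \<phi> unfolding has_weak_derivative_def by blast
  show "(LBINT t:{0..T}. deriv \<phi> t *\<^sub>R v' t) = - (LBINT t:{0..T}. \<phi> t *\<^sub>R w t)"
    by (rule trans[OF neg_equal_iff_equal[THEN iffD1, OF trans[OF e2[symmetric] e1]] e3])
qed (use assms in \<open>auto simp: has_weak_derivative_def\<close>)

text \<open>
  Weak derivatives on the circle are required to be periodic everywhere; periodic extension from
  \<open>[0, T)\<close> changes \<open>g\<close> on \<open>[0, T]\<close> only at the end point \<open>T\<close>.
\<close>
lemma primitive_on_periodic_representative:
  fixes f g :: "real \<Rightarrow> 'a::euclidean_space"
  assumes T: "0 < T" and p: "primitive_on T f g"
    and sq: "set_integrable lborel {0..T} (\<lambda>t. (norm (g t))\<^sup>2)"
  obtains h where "periodic T h" "primitive_on T f h"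
    "set_integrable lborel {0..T} (\<lambda>t. (norm (h t))\<^sup>2)"
    "(LBINT t:{0..T}. (norm (h t))\<^sup>2) = (LBINT t:{0..T}. (norm (g t))\<^sup>2)"
proof -
  define h where "h t = g (t - T * of_int \<lfloor>t / T\<rfloor>)" for t
  have per: "periodic T h"
    unfolding periodic_def
  proof
    fix t
    have "(t + T) / T = t / T + of_int 1" using T by (simp add: field_simps)
    then have "\<lfloor>(t + T) / T\<rfloor> = \<lfloor>t / T\<rfloor> + 1" by linarith
    then show "h (t + T) = h t" by (simp add: h_def algebra_simps)
  qed
  have hg: "h t = g t" if "0 \<le> t" "t < T" for t
  proof -
    have "\<lfloor>t / T\<rfloor> = 0" using that T by (simp add: floor_eq_iff)
    then show ?thesis by (simp add: h_def)
  qed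
  have hT: "h T = g 0" using T by (simp add: h_def)
  have gi: "set_integrable lborel {0..T} g" using p by (simp add: primitive_on_def)
  have e: "indicat_real {0..T} t *\<^sub>R h t = indicat_real {0..T} t *\<^sub>R g t + indicat_real {T} t *\<^sub>R (g 0 - g T)" for t
    using T hg[of t] hT by (cases "t = T") (auto simp: indicator_def)
  have hm: "(\<lambda>t. indicat_real {0..T} t *\<^sub>R h t) \<in> borel_measurable lborel"
    unfolding e using set_integrable_imp_measurable[OF gi]
    by (intro borel_measurable_add) (auto simp: set_borel_measurable_def)
  have ae: "AE t in lborel. t \<noteq> T" by (rule AE_lborel_singleton)
  have hi: "set_integrable lborel {0..T} h"
    unfolding set_integrable_def
  proof (rule integrable_cong_AE_imp[OF gi[unfolded set_integrable_def] hm])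
    show "AE t in lborel. indicat_real {0..T} t *\<^sub>R g t = indicat_real {0..T} t *\<^sub>R h t"
      using ae by (rule eventually_mono) (auto simp: indicator_def hg)
  qed
  have sm: "(\<lambda>t. (norm (indicat_real {0..T} t *\<^sub>R h t))\<^sup>2) \<in> borel_measurable lborel"
    using hm by measurable
  have se: "(norm (indicat_real {0..T} t *\<^sub>R h t))\<^sup>2 = indicat_real {0..T} t *\<^sub>R (norm (h t))\<^sup>2" for t
    by (auto simp: indicator_def)
  have sae: "AE t in lborel. indicat_real {0..T} t *\<^sub>R (norm (h t))\<^sup>2 = indicat_real {0..T} t *\<^sub>R (norm (g t))\<^sup>2"
    using ae by (rule eventually_mono) (auto simp: indicator_def hg)
  have hs: "set_integrable lborel {0..T} (\<lambda>t. (norm (h t))\<^sup>2)"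
    unfolding set_integrable_def
  proof (rule integrable_cong_AE_imp[OF sq[unfolded set_integrable_def]])
    show "(\<lambda>t. indicat_real {0..T} t *\<^sub>R (norm (h t))\<^sup>2) \<in> borel_measurable lborel"
      using sm unfolding se .
    show "AE t in lborel. indicat_real {0..T} t *\<^sub>R (norm (g t))\<^sup>2 = indicat_real {0..T} t *\<^sub>R (norm (h t))\<^sup>2"
      using sae by eventually_elim (rule sym)
  qed
  have seq: "(LBINT t:{0..T}. (norm (h t))\<^sup>2) = (LBINT t:{0..T}. (norm (g t))\<^sup>2)"
    unfolding set_lebesgue_integral_def
    by (rule integral_cong_AE)
       (use hs sq sae in \<open>auto simp: set_integrable_def intro: borel_measurable_integrable\<close>)
  have "(LBINT t:{a..b}. h t) = (LBINT t:{a..b}. g t)" if "0 \<le> a" "b \<le> T" for a b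
    unfolding set_lebesgue_integral_def
  proof (rule integral_cong_AE)
    show "AE t in lborel. indicat_real {a..b} t *\<^sub>R h t = indicat_real {a..b} t *\<^sub>R g t"
      using ae by (rule eventually_mono) (use that in \<open>auto simp: indicator_def hg\<close>)
    have "set_integrable lborel {a..b} h" "set_integrable lborel {a..b} g"
      using that by (auto intro: set_integrable_subset[OF hi] set_integrable_subset[OF gi])
    then show "(\<lambda>t. indicat_real {a..b} t *\<^sub>R h t) \<in> borel_measurable lborel"
      "(\<lambda>t. indicat_real {a..b} t *\<^sub>R g t) \<in> borel_measurable lborel"
      unfolding set_integrable_def by (auto intro: borel_measurable_integrable)
  qed
  then have "primitive_on T f h" using p hi unfolding primitive_on_def by auto
  then show ?thesis using that per hs seq by blast
qed

lemma primitive_on_C1: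
  fixes u :: "real \<Rightarrow> 'a::euclidean_space"
  assumes "\<And>t. (u has_vector_derivative v t) (at t)" "continuous_on UNIV v"
  shows "primitive_on T u v"
  unfolding primitive_on_def
proof (intro conjI allI impI)
  have c: "continuous_on A v" for A using assms(2) continuous_on_subset by blast
  then show "set_integrable lborel {0..T} v" by (rule borel_integrable_atLeastAtMost')
  fix a b :: real assume ab: "0 \<le> a" "a \<le> b" "b \<le> T"
  have "(LBINT t:{a..b}. v t) = integral {a..b} v"
    by (intro set_borel_integral_eq_integral(2) borel_integrable_atLeastAtMost' c)
  also have "\<dots> = u b - u a"
    using ab assms(1) by (intro integral_unique fundamental_theorem_of_calculus)
      (auto intro: has_vector_derivative_at_within)
  finally show "(LBINT t:{a..b}. v t) = u b - u a" .
qed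

lemma periodic_vector_derivative:
  assumes "periodic T u" "\<And>t. (u has_vector_derivative v t) (at t)"
  shows "periodic T v"
  unfolding periodic_def
proof
  fix t
  have "((u \<circ> (\<lambda>s. s + T)) has_vector_derivative 1 *\<^sub>R v (t + T)) (at t)"
    by (rule vector_diff_chain_at) (auto intro!: derivative_eq_intros assms(2))
  moreover have "u \<circ> (\<lambda>s. s + T) = u" using assms(1) by (auto simp: periodic_def)
  ultimately show "v (t + T) = v t" using vector_derivative_unique_at[OF _ assms(2)[of t]] by simp
qed

text \<open>
  Weak derivatives are chosen by Hilbert's operator. The first choice does not matter by
  \<open>has_weak_derivative_second\<close>, and the second agrees with \<open>g\<close> almost everywhere.
\<close>
lemma weak_derivative_twice_L2:
  fixes u v g :: "real \<Rightarrow> real^2"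
  assumes T: "0 < T" and pu: "periodic T u"
    and d: "\<And>t. (u has_vector_derivative v t) (at t)" and c: "continuous_on UNIV v"
    and g: "primitive_on T v g" "set_integrable lborel {0..T} (\<lambda>t. (norm (g t))\<^sup>2)"
  shows "(LBINT t:{0..T}. (norm (weak_derivative T (weak_derivative T u) t))\<^sup>2)
    = (LBINT t:{0..T}. (norm (g t))\<^sup>2)"
proof -
  obtain h where h: "periodic T h" "primitive_on T v h"
    "(LBINT t:{0..T}. (norm (h t))\<^sup>2) = (LBINT t:{0..T}. (norm (g t))\<^sup>2)"
    using primitive_on_periodic_representative[OF T g] by blast
  have pv: "periodic T v" by (rule periodic_vector_derivative[OF pu d])
  have uv: "has_weak_derivative T u v"
    by (rule primitive_has_weak_derivative[OF primitive_on_C1[OF d c] T pu pv])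
  have vh: "has_weak_derivative T v h"
    by (rule primitive_has_weak_derivative[OF h(2) T pv h(1)])
  define v' where "v' = weak_derivative T u"
  define w where "w = weak_derivative T v'"
  have uv': "has_weak_derivative T u v'"
    unfolding v'_def weak_derivative_def by (rule someI[of _ v]) (rule uv)
  have "has_weak_derivative T v' h" by (rule has_weak_derivative_second[OF uv uv' vh])
  then have v'w: "has_weak_derivative T v' w"
    unfolding w_def weak_derivative_def by (rule someI[of "has_weak_derivative T v'"])
  have vw: "has_weak_derivative T v w" by (rule has_weak_derivative_second[OF uv' uv v'w])
  have w: "primitive_on T v w"
    by (rule weak_derivative_imp_primitive[OF T continuous_on_subset[OF c] vw]) simp
  have ae: "AE t in lborel. t \<in> {0..T} \<longrightarrow> w t = h t" by (rule primitive_on_unique_AE[OF w h(2)])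
  have m: "(\<lambda>t. indicat_real {0..T} t *\<^sub>R (norm (f t))\<^sup>2) \<in> borel_measurable lborel"
    if "primitive_on T v f" for f
  proof -
    have "(\<lambda>t. indicat_real {0..T} t *\<^sub>R f t) \<in> borel_measurable lborel"
      using that set_integrable_imp_measurable unfolding primitive_on_def set_borel_measurable_def by blast
    then have "(\<lambda>t. (norm (indicat_real {0..T} t *\<^sub>R f t))\<^sup>2) \<in> borel_measurable lborel" by measurable
    also have "(\<lambda>t. (norm (indicat_real {0..T} t *\<^sub>R f t))\<^sup>2) = (\<lambda>t. indicat_real {0..T} t *\<^sub>R (norm (f t))\<^sup>2)"
      by (auto simp: indicator_def)
    finally show ?thesis .
  qed
  have "(LBINT t:{0..T}. (norm (w t))\<^sup>2) = (LBINT t:{0..T}. (norm (h t))\<^sup>2)"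
    unfolding set_lebesgue_integral_def
    by (rule integral_cong_AE[OF m[OF w] m[OF h(2)]])
       (use ae in eventually_elim, auto simp: indicator_def)
  then show ?thesis using h(3) by (simp add: w_def v'_def)
qed

lemma L2_circle_continuous:
  assumes "periodic T u" "continuous_on {0..T} u"
  shows "L2_circle T u"
  unfolding L2_circle_def
  using assms by (auto intro!: set_integrable_imp_measurable borel_integrable_atLeastAtMost' continuous_intros)

lemma regular_curveI:
  fixes \<gamma> d :: "real \<Rightarrow> real^2"
  assumes p: "periodic (2 * pi) \<gamma>" and d: "\<And>t. (\<gamma> has_vector_derivative d t) (at t)"
    and c: "continuous_on UNIV d" and nz: "\<And>t. d t \<noteq> 0"
    and M: "\<And>n. dyadic_energy (2 * pi) d n \<le> M"
  shows "regular_curve \<gamma>"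
proof -
  have T: "0 < 2 * pi" by simp
  obtain g0 where g0: "primitive_on (2*pi) d g0" "set_integrable lborel {0..2*pi} (\<lambda>t. (norm (g0 t))\<^sup>2)"
    using L2_primitive_if_dyadic_energy_bounded[OF T continuous_on_subset[OF c subset_UNIV] M] by blast
  obtain g where g: "periodic (2*pi) g" "primitive_on (2*pi) d g"
    "set_integrable lborel {0..2*pi} (\<lambda>t. (norm (g t))\<^sup>2)"
    using primitive_on_periodic_representative[OF T g0] by blast
  have pd: "periodic (2*pi) d" by (rule periodic_vector_derivative[OF p d])
  have \<gamma>c: "continuous_on A \<gamma>" for A
    using d by (meson continuous_at_imp_continuous_on has_vector_derivative_continuous)
  have "W22_circle (2*pi) \<gamma>"
    unfolding W22_circle_def
  proof (intro exI conjI)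
    show "L2_circle (2*pi) \<gamma>" by (intro L2_circle_continuous p \<gamma>c)
    show "L2_circle (2*pi) d" by (intro L2_circle_continuous pd continuous_on_subset[OF c subset_UNIV])
    show "L2_circle (2*pi) g"
      using g unfolding L2_circle_def primitive_on_def by (auto intro: set_integrable_imp_measurable)
    show "has_weak_derivative (2*pi) \<gamma> d"
      by (rule primitive_has_weak_derivative[OF primitive_on_C1[OF d c] T p pd])
    show "has_weak_derivative (2*pi) d g"
      by (rule primitive_has_weak_derivative[OF g(2) T pd g(1)])
  qed
  moreover have "\<gamma> C1_differentiable_on UNIV"
    unfolding C1_differentiable_on_def using d c by blast
  moreover have "vector_derivative \<gamma> (at t) = d t" for t by (rule vector_derivative_at[OF d])
  ultimately show ?thesis using nz unfolding regular_curve_def by simp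
qed

lemma regular_curve_C1:
  assumes "regular_curve \<gamma>"
  obtains d where "\<And>t. (\<gamma> has_vector_derivative d t) (at t)" "continuous_on UNIV d" "\<And>t. d t \<noteq> 0"
    "periodic (2*pi) \<gamma>" "periodic (2*pi) d" "\<And>t. vector_derivative \<gamma> (at t) = d t"
proof -
  obtain d where d: "\<And>t. (\<gamma> has_vector_derivative d t) (at t)" "continuous_on UNIV d"
    using assms unfolding regular_curve_def C1_differentiable_on_def by auto
  have vd: "vector_derivative \<gamma> (at t) = d t" for t by (rule vector_derivative_at[OF d(1)])
  have nz: "d t \<noteq> 0" for t using assms unfolding regular_curve_def vd by auto
  have p: "periodic (2*pi) \<gamma>"
    using assms unfolding regular_curve_def W22_circle_def L2_circle_def by blast
  show ?thesis using that[OF d nz p periodic_vector_derivative[OF p d(1)] vd] .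
qed

lemma regular_curve_second_derivative:
  assumes \<gamma>: "regular_curve \<gamma>" and d: "\<And>t. (\<gamma> has_vector_derivative d t) (at t)"
    and c: "continuous_on UNIV d"
  obtains w where "primitive_on (2*pi) d w" "set_integrable lborel {0..2*pi} (\<lambda>t. (norm (w t))\<^sup>2)"
proof -
  have T: "0 < 2 * pi" by simp
  obtain v w where w: "L2_circle (2*pi) w"
    "has_weak_derivative (2*pi) \<gamma> v" "has_weak_derivative (2*pi) v w"
    using \<gamma> unfolding regular_curve_def W22_circle_def by blast
  have p: "periodic (2*pi) \<gamma>"
    using \<gamma> unfolding regular_curve_def W22_circle_def L2_circle_def by blast
  have "has_weak_derivative (2*pi) \<gamma> d"
    by (rule primitive_has_weak_derivative[OF primitive_on_C1[OF d c] T p periodic_vector_derivative[OF p d]])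
  then have "has_weak_derivative (2*pi) d w" using has_weak_derivative_second w(2,3) by blast
  then have "primitive_on (2*pi) d w"
    by (rule weak_derivative_imp_primitive[OF T continuous_on_subset[OF c subset_UNIV]])
  then show ?thesis using that w(1) unfolding L2_circle_def by blast
qed

section \<open>Arc length parametrization and bending energy\<close>

lemma periodic_reduce:
  assumes T: "0 < T" and p: "periodic T f"
  obtains s k where "s \<in> {0..<T}" "t = s + of_int k * T" "f t = f s"
proof -
  have nat: "f (r + real n * T) = f r" for r n
  proof (induction n)
    case (Suc n)
    have "f (r + real (Suc n) * T) = f ((r + real n * T) + T)" by (simp add: algebra_simps)
    then show ?case using Suc p by (simp add: periodic_def)
  qed simp
  have int: "f (r + of_int k * T) = f r" for r k
  proof (cases "0 \<le> k")
    case True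
    then show ?thesis using nat[of r "nat k"] by simp
  next
    case False
    then show ?thesis using nat[of "r + of_int k * T" "nat (- k)"] by (simp add: algebra_simps)
  qed
  define k where "k = \<lfloor>t / T\<rfloor>"
  have "of_int k \<le> t / T" "t / T < of_int k + 1" by (auto simp: k_def)
  then have "of_int k * T \<le> t" "t < (of_int k + 1) * T"
    using T by (auto simp: pos_le_divide_eq pos_divide_less_eq)
  then have "t - of_int k * T \<in> {0..<T}" by (simp add: algebra_simps)
  then show ?thesis using that[of "t - of_int k * T" k] int[of "t - of_int k * T" k] by simp
qed

text \<open>
  Normalization is Lipschitz away from the origin; this carries the square integrability of
  \<open>\<gamma>''\<close> over to the derivative of the unit tangent.
\<close>
lemma norm_sgn_diff_le:
  fixes x y :: "'a::real_normed_vector"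
  assumes m: "0 < m" "m \<le> norm x" and y: "y \<noteq> 0"
  shows "norm (sgn x - sgn y) \<le> 2 / m * norm (x - y)"
proof -
  have x: "0 < norm x" using m by linarith
  have "sgn x - sgn y = (x - y) /\<^sub>R norm x + ((norm y - norm x) / norm x) *\<^sub>R sgn y"
  proof -
    have 1: "(norm y / norm x) *\<^sub>R sgn y = y /\<^sub>R norm x"
      using y by (simp add: sgn_div_norm divide_inverse mult.commute)
    have 2: "(norm y - norm x) / norm x = norm y / norm x - 1" using x by (simp add: field_simps)
    show ?thesis
      by (simp add: 1 2 sgn_div_norm[of x] scaleR_diff_left scaleR_diff_right)
  qed
  then have "norm (sgn x - sgn y) \<le> norm ((x - y) /\<^sub>R norm x) + norm (((norm y - norm x) / norm x) *\<^sub>R sgn y)"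
    by (simp only: norm_triangle_ineq)
  also have "\<dots> = norm (x - y) / norm x + \<bar>norm y - norm x\<bar> / norm x"
    using y x by (simp add: norm_sgn abs_mult divide_inverse_commute)
  also have "\<dots> \<le> norm (x - y) / norm x + norm (x - y) / norm x"
    using norm_triangle_ineq3[of y x] x
    by (intro add_left_mono divide_right_mono) (auto simp: norm_minus_commute)
  also have "\<dots> \<le> norm (x - y) / m + norm (x - y) / m"
    using m x by (intro add_mono divide_left_mono) auto
  finally show ?thesis by simp
qed

lemma arc_length_has_derivative:
  fixes d :: "real \<Rightarrow> real^2"
  assumes vd: "\<And>t. vector_derivative \<gamma> (at t) = d t" and c: "continuous_on UNIV d"
  shows "(arc_length \<gamma> has_real_derivative norm (d t)) (at t)"
proof -
  have "\<exists>F. \<forall>x::real. - \<infinity> < ereal x \<longrightarrow> ereal x < \<infinity> \<longrightarrow> (F has_vector_derivative norm (d x)) (at x)"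
    using c by (intro einterval_antiderivative) (auto simp: continuous_on_eq_continuous_at intro: continuous_norm)
  then obtain F where F: "\<And>x. (F has_vector_derivative norm (d x)) (at x)" by auto
  have "arc_length \<gamma> t = F t - F 0" for t
  proof -
    have 1: "arc_length \<gamma> t = (LBINT r=ereal 0..ereal t. norm (d r))"
      by (simp only: arc_length_def vd zero_ereal_def)
    have c': "continuous_on {min 0 t..max 0 t} (\<lambda>r. norm (d r))"
      by (intro continuous_on_norm continuous_on_subset[OF c subset_UNIV])
    have F': "(F has_vector_derivative norm (d x)) (at x within {min 0 t..max 0 t})" for x
      by (rule has_vector_derivative_at_within[OF F])
    show ?thesis unfolding 1 using interval_integral_FTC_finite[OF c' F'] .
  qed
  then have "arc_length \<gamma> = (\<lambda>t. F t - F 0)" by auto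
  then show ?thesis
    unfolding has_real_derivative_iff_has_vector_derivative
    by (auto intro!: derivative_eq_intros F)
qed

text \<open>
  The speed of \<open>\<gamma>\<close> has a positive minimum \<open>m\<close>, so arc length is a bijection whose inverse \<open>\<iota>\<close> is
  Lipschitz with constant \<open>1 / m\<close>. The last conclusion is the control needed for the dyadic energy of the
  unit tangent \<open>sgn (\<gamma>' (\<iota> s))\<close>, with \<open>E s = (4 / m\<^sup>3) \<integral>\<bar>\<gamma>''\<bar>\<^sup>2\<close> over \<open>[0, \<iota> s]\<close>: normalization costs the
  factor \<open>(2 / m)\<^sup>2\<close> and the change of parameter the factor \<open>1 / m\<close>.
\<close>
lemma regular_curve_arc_length_param:
  assumes \<gamma>: "regular_curve \<gamma>"
  defines "L \<equiv> curve_length \<gamma>" and "\<sigma> \<equiv> arc_length_param \<gamma>" and "l \<equiv> arc_length \<gamma>"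
  obtains \<sigma>' E where "0 < L" "periodic L \<sigma>" "\<And>s. (\<sigma> has_vector_derivative \<sigma>' s) (at s)"
    "continuous_on UNIV \<sigma>'" "\<And>s. norm (\<sigma>' s) = 1"
    "surj l" "\<And>t. \<sigma> (l t) = \<gamma> t"
    "\<And>t. vector_derivative \<gamma> (at t) = norm (vector_derivative \<gamma> (at t)) *\<^sub>R \<sigma>' (l t)"
    "\<And>a b. 0 \<le> a \<Longrightarrow> a \<le> b \<Longrightarrow> b \<le> L \<Longrightarrow> (norm (\<sigma>' b - \<sigma>' a))\<^sup>2 \<le> (b - a) * (E b - E a)"
proof -
  obtain d where d: "\<And>t. (\<gamma> has_vector_derivative d t) (at t)" "continuous_on UNIV d" "\<And>t. d t \<noteq> 0"
    and p\<gamma>: "periodic (2*pi) \<gamma>" and pd: "periodic (2*pi) d" and vd: "\<And>t. vector_derivative \<gamma> (at t) = d t"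
    using regular_curve_C1[OF \<gamma>] by blast
  obtain w where w: "primitive_on (2*pi) d w" "set_integrable lborel {0..2*pi} (\<lambda>t. (norm (w t))\<^sup>2)"
    using regular_curve_second_derivative[OF \<gamma> d(1,2)] by blast
  obtain m where m: "0 < m" "\<And>t. m \<le> norm (d t)"
  proof -
    have "\<exists>t0\<in>{0..2*pi}. \<forall>t\<in>{0..2*pi}. norm (d t0) \<le> norm (d t)"
      by (intro continuous_attains_inf continuous_on_norm continuous_on_subset[OF d(2) subset_UNIV]) auto
    then obtain t0 where t0: "\<And>t. t \<in> {0..2*pi} \<Longrightarrow> norm (d t0) \<le> norm (d t)" by blast
    have "norm (d t0) \<le> norm (d t)" for t
    proof -
      obtain s k where "s \<in> {0..<2*pi}" "d t = d s" using periodic_reduce[OF _ pd, of t] by auto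
      then show ?thesis using t0[of s] by auto
    qed
    then show ?thesis using that[of "norm (d t0)"] d(3) by simp
  qed
  have lD: "(l has_real_derivative norm (d t)) (at t)" for t
    unfolding l_def by (rule arc_length_has_derivative[OF vd d(2)])
  have l0: "l 0 = 0" by (simp add: l_def arc_length_def flip: zero_ereal_def)
  have lc: "continuous_on A l" for A by (meson lD DERIV_continuous continuous_at_imp_continuous_on)
  have lge: "m * (b - a) \<le> l b - l a" if "a \<le> b" for a b
  proof -
    have "l a - m * a \<le> l b - m * b"
      using that
    proof (rule DERIV_nonneg_imp_nondecreasing)
      fix x
      have "((\<lambda>t. l t - m * t) has_real_derivative norm (d x) - m) (at x)"
        by (auto intro!: derivative_eq_intros lD)
      then show "\<exists>y. ((\<lambda>t. l t - m * t) has_real_derivative y) (at x) \<and> 0 \<le> y"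
        using m(2)[of x] by (intro exI[of _ "norm (d x) - m"]) auto
    qed
    then show ?thesis by (simp add: algebra_simps)
  qed
  have linj: "inj l"
  proof (rule injI)
    fix a b assume e: "l a = l b"
    have le: "b' \<le> a'" if "a' \<le> b'" "l a' = l b'" for a' b'
      using lge[OF that(1)] that(2) m(1) by (simp add: mult_le_0_iff)
    show "a = b"
    proof (rule antisym)
      show "a \<le> b" using le[of a b] le[of b a] e by linarith
      show "b \<le> a" using le[of a b] le[of b a] e by linarith
    qed
  qed
  have surj: "surj l"
    unfolding surj_def
  proof
    fix s
    define c where "c = \<bar>s\<bar> / m"
    have c: "0 \<le> c" "m * c = \<bar>s\<bar>" using m(1) by (auto simp: c_def)
    have "l (- c) \<le> s" "s \<le> l c"
      using lge[of "-c" 0] lge[of 0 c] c l0 by auto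
    then have "\<exists>x\<ge>- c. x \<le> c \<and> l x = s"
      by (rule IVT') (use c lc in auto)
    then show "\<exists>x. s = l x" by blast
  qed
  define \<iota> where "\<iota> = inv l"
  have l\<iota>: "l (\<iota> s) = s" for s unfolding \<iota>_def by (rule surj_f_inv_f[OF surj])
  have \<iota>l: "\<iota> (l t) = t" for t unfolding \<iota>_def by (rule inv_f_f[OF linj])
  have \<iota>mono: "\<iota> a \<le> \<iota> b" if "a \<le> b" for a b
  proof (rule ccontr)
    assume n: "\<not> \<iota> a \<le> \<iota> b"
    then have "m * (\<iota> a - \<iota> b) \<le> a - b" using lge[of "\<iota> b" "\<iota> a"] by (simp add: l\<iota>)
    moreover have "0 < m * (\<iota> a - \<iota> b)" using n m by simp
    ultimately show False using that by linarith
  qed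
  have \<iota>lip: "\<iota> b - \<iota> a \<le> (b - a) / m" if "a \<le> b" for a b
    using lge[OF \<iota>mono[OF that]] m(1) by (simp add: l\<iota> field_simps)
  have "(1/m)-lipschitz_on UNIV \<iota>"
  proof (rule lipschitz_onI)
    fix a b show "dist (\<iota> a) (\<iota> b) \<le> 1 / m * dist a b"
    proof (cases "a \<le> b")
      case True then show ?thesis using \<iota>lip[OF True] \<iota>mono[OF True] by (simp add: dist_real_def)
    next
      case False then show ?thesis using \<iota>lip[of b a] \<iota>mono[of b a] by (simp add: dist_real_def)
    qed
  qed (use m in simp)
  then have \<iota>c: "continuous_on UNIV \<iota>" by (rule lipschitz_on_continuous_on)
  have \<iota>D: "(\<iota> has_real_derivative inverse (norm (d (\<iota> s)))) (at s)" for s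
    by (rule DERIV_inverse_function[where a = "s - 1" and b = "s + 1", OF lD])
       (use d(3) l\<iota> \<iota>c in \<open>auto simp: continuous_on_eq_continuous_at\<close>)
  have L: "L = l (2 * pi)" by (simp add: L_def l_def curve_length_def)
  have lper: "l (t + 2 * pi) = l t + L" for t
  proof -
    have "((\<lambda>t. l (t + 2*pi) - l t) has_real_derivative 0) (at t)" for t
    proof -
      have "((\<lambda>t. l (t + 2*pi) - l t) has_real_derivative norm (d (t + 2*pi)) * 1 - norm (d t)) (at t)"
        by (intro DERIV_diff DERIV_chain2[OF lD] lD) (auto intro!: derivative_eq_intros)
      then show ?thesis using pd by (simp add: periodic_def)
    qed
    then have "l (t + 2*pi) - l t = l (0 + 2*pi) - l 0" by (intro DERIV_isconst_all) auto
    then show ?thesis by (simp add: l0 L)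
  qed
  have \<sigma>: "\<sigma> = \<gamma> \<circ> \<iota>" by (simp add: \<sigma>_def arc_length_param_def \<iota>_def l_def)
  define \<sigma>' where "\<sigma>' s = sgn (d (\<iota> s))" for s
  have Lpos: "0 < L" using lge[of 0 "2*pi"] m(1) l0 L by (smt (verit) mult_pos_pos pi_gt_zero)
  have \<iota>per: "\<iota> (s + L) = \<iota> s + 2 * pi" for s
    using lper[of "\<iota> s"] \<iota>l[of "\<iota> s + 2*pi"] by (simp add: l\<iota>)
  have per: "periodic L \<sigma>" using p\<gamma> by (simp add: periodic_def \<sigma> \<iota>per)
  have \<sigma>D: "(\<sigma> has_vector_derivative \<sigma>' s) (at s)" for s
    unfolding \<sigma> \<sigma>'_def sgn_div_norm
    by (rule vector_diff_chain_at[OF \<iota>D[unfolded has_real_derivative_iff_has_vector_derivative] d(1)])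
  have \<sigma>'c: "continuous_on UNIV \<sigma>'"
    unfolding \<sigma>'_def sgn_div_norm using d(3)
    by (intro continuous_intros continuous_on_compose2[OF d(2) \<iota>c]) auto
  have \<sigma>'n: "norm (\<sigma>' s) = 1" for s using d(3) by (simp add: \<sigma>'_def norm_sgn)
  define W where "W t = (LBINT r:{0..t}. (norm (w r))\<^sup>2)" for t
  define E where "E s = 4 / m^3 * W (\<iota> s)" for s
  have ctrl: "(norm (\<sigma>' b - \<sigma>' a))\<^sup>2 \<le> (b - a) * (E b - E a)" if ab: "0 \<le> a" "a \<le> b" "b \<le> L" for a b
  proof -
    have i0: "\<iota> 0 = 0" "\<iota> L = 2*pi" using \<iota>l[of 0] \<iota>l[of "2*pi"] by (auto simp: l0 L)
    have r: "0 \<le> \<iota> a" "\<iota> a \<le> \<iota> b" "\<iota> b \<le> 2*pi"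
      using \<iota>mono[of 0 a] \<iota>mono[of a b] \<iota>mono[of b L] ab i0 by auto
    have "norm (\<sigma>' b - \<sigma>' a) \<le> 2 / m * norm (d (\<iota> b) - d (\<iota> a))"
      unfolding \<sigma>'_def by (rule norm_sgn_diff_le[OF m(1) m(2) d(3)])
    then have "(norm (\<sigma>' b - \<sigma>' a))\<^sup>2 \<le> (2 / m * norm (d (\<iota> b) - d (\<iota> a)))\<^sup>2"
      by (rule power_mono) simp
    also have "\<dots> = 4 / m\<^sup>2 * (norm (d (\<iota> b) - d (\<iota> a)))\<^sup>2" by (simp add: power_mult_distrib power_divide)
    also have "\<dots> \<le> 4 / m\<^sup>2 * ((\<iota> b - \<iota> a) * (W (\<iota> b) - W (\<iota> a)))"
      unfolding W_def by (intro mult_left_mono primitive_increment_sq_le[OF w r]) auto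
    also have "\<dots> \<le> 4 / m\<^sup>2 * ((b - a) / m * (W (\<iota> b) - W (\<iota> a)))"
    proof -
      have "0 \<le> W (\<iota> b) - W (\<iota> a)"
      proof -
        have "W (\<iota> b) = W (\<iota> a) + (LBINT r:{\<iota> a..\<iota> b}. (norm (w r))\<^sup>2)"
          unfolding W_def using r
          by (intro set_integral_split_Icc) (auto intro: set_integrable_subset[OF w(2)])
        moreover have "0 \<le> (LBINT r:{\<iota> a..\<iota> b}. (norm (w r))\<^sup>2)"
          unfolding set_lebesgue_integral_def by (intro integral_nonneg_AE) auto
        ultimately show ?thesis by linarith
      qed
      then show ?thesis by (intro mult_left_mono mult_right_mono \<iota>lip ab) auto
    qed
    also have "\<dots> = (b - a) * (E b - E a)"
      using m(1) by (simp add: E_def power2_eq_square power3_eq_cube field_simps)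
    finally show ?thesis .
  qed
  show ?thesis
  proof (rule that[of \<sigma>' E, OF Lpos per \<sigma>D \<sigma>'c \<sigma>'n surj _ _ ctrl])
    show "\<sigma> (l t) = \<gamma> t" for t by (simp add: \<sigma> \<iota>l)
    show "vector_derivative \<gamma> (at t) = norm (vector_derivative \<gamma> (at t)) *\<^sub>R \<sigma>' (l t)" for t
      using d(3) by (simp add: vd \<sigma>'_def \<iota>l sgn_div_norm)
  qed
qed

lemma bending_energy_eq_L2:
  fixes \<gamma> :: "real \<Rightarrow> real^2"
  assumes "0 < curve_length \<gamma>" "periodic (curve_length \<gamma>) (arc_length_param \<gamma>)"
    and "\<And>s. (arc_length_param \<gamma> has_vector_derivative \<sigma>' s) (at s)" "continuous_on UNIV \<sigma>'"
    and "primitive_on (curve_length \<gamma>) \<sigma>' g"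
    and "set_integrable lborel {0..curve_length \<gamma>} (\<lambda>t. (norm (g t))\<^sup>2)"
  shows "bending_energy \<gamma> = (LBINT t:{0..curve_length \<gamma>}. (norm (g t))\<^sup>2)"
  unfolding bending_energy_def Let_def by (rule weak_derivative_twice_L2[OF assms])

lemma bending_energy_le:
  fixes \<gamma> :: "real \<Rightarrow> real^2"
  assumes "0 < curve_length \<gamma>" "periodic (curve_length \<gamma>) (arc_length_param \<gamma>)"
    and "\<And>s. (arc_length_param \<gamma> has_vector_derivative \<sigma>' s) (at s)" "continuous_on UNIV \<sigma>'"
    and "\<And>n. dyadic_energy (curve_length \<gamma>) \<sigma>' n \<le> M"
  shows "bending_energy \<gamma> \<le> M"
proof -
  obtain g where "primitive_on (curve_length \<gamma>) \<sigma>' g"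
    "set_integrable lborel {0..curve_length \<gamma>} (\<lambda>t. (norm (g t))\<^sup>2)"
    "(LBINT t:{0..curve_length \<gamma>}. (norm (g t))\<^sup>2) \<le> M"
    using L2_primitive_if_dyadic_energy_bounded[OF assms(1) continuous_on_subset[OF assms(4) subset_UNIV] assms(5)]
    by blast
  then show ?thesis using bending_energy_eq_L2[OF assms(1-4)] by simp
qed

section \<open>Tangential self-intersections and their stability\<close>

definition cross2 :: "real^2 \<Rightarrow> real^2 \<Rightarrow> real" where
  "cross2 u v = u$1 * v$2 - u$2 * v$1"

lemma cross2_scaleR [simp]: "cross2 (a *\<^sub>R u) (b *\<^sub>R v) = a * b * cross2 u v"
  by (simp add: cross2_def algebra_simps)

lemma cross2_self [simp]: "cross2 u u = 0"
  by (simp add: cross2_def)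

lemma parallel_iff_cross2:
  assumes "v \<noteq> 0"
  shows "(\<exists>c. u = c *\<^sub>R v) \<longleftrightarrow> cross2 u v = 0"
proof
  assume "\<exists>c. u = c *\<^sub>R v" then show "cross2 u v = 0" by (auto simp: cross2_def)
next
  assume z: "cross2 u v = 0"
  have "v $ 1 \<noteq> 0 \<or> v $ 2 \<noteq> 0" using assms by (auto simp: vec_eq_iff forall_2)
  then show "\<exists>c. u = c *\<^sub>R v"
  proof
    assume "v $ 1 \<noteq> 0"
    then show ?thesis using z
      by (intro exI[of _ "u$1 / v$1"]) (auto simp: vec_eq_iff forall_2 cross2_def field_simps)
  next
    assume "v $ 2 \<noteq> 0"
    then show ?thesis using z
      by (intro exI[of _ "u$2 / v$2"]) (auto simp: vec_eq_iff forall_2 cross2_def field_simps)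
  qed
qed

text \<open>
  The form used below: a closed condition, and without restriction of the parameters to one period,
  because a coincidence of parameters modulo \<open>2\<pi>\<close> satisfies it trivially.
\<close>
lemma tangential_iff_cross2:
  assumes p: "periodic (2*pi) \<gamma>" and d: "\<And>t. (\<gamma> has_vector_derivative d t) (at t)" and nz: "\<And>t. d t \<noteq> 0"
  shows "tangential_self_intersections \<gamma> \<longleftrightarrow> (\<forall>x y. \<gamma> x = \<gamma> y \<longrightarrow> cross2 (d x) (d y) = 0)"
proof -
  have vd: "vector_derivative \<gamma> (at t) = d t" for t by (rule vector_derivative_at[OF d])
  have pd: "periodic (2*pi) d" by (rule periodic_vector_derivative[OF p d])
  have pp: "periodic (2*pi) (\<lambda>t. (\<gamma> t, d t))" using p pd by (simp add: periodic_def)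
  have "cross2 (d x) (d y) = 0" if t: "tangential_self_intersections \<gamma>" and e: "\<gamma> x = \<gamma> y" for x y
  proof -
    obtain x' k where x': "x' \<in> {0..<2*pi}" "\<gamma> x = \<gamma> x'" "d x = d x'"
      using periodic_reduce[OF _ pp, of x] by auto
    obtain y' j where y': "y' \<in> {0..<2*pi}" "\<gamma> y = \<gamma> y'" "d y = d y'"
      using periodic_reduce[OF _ pp, of y] by auto
    show ?thesis
    proof (cases "x' = y'")
      case False
      then have "\<exists>c. d x' = c *\<^sub>R d y'"
        using t x' y' e unfolding tangential_self_intersections_def vd by metis
      then show ?thesis using parallel_iff_cross2[OF nz] x' y' by metis
    qed (use x' y' in simp)
  qed
  moreover have "tangential_self_intersections \<gamma>" if "\<forall>x y. \<gamma> x = \<gamma> y \<longrightarrow> cross2 (d x) (d y) = 0"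
    unfolding tangential_self_intersections_def vd using that parallel_iff_cross2[OF nz] by metis
  ultimately show ?thesis by blast
qed

text \<open>
  Let \<open>F (x, y) = \<gamma> x - \<gamma> y\<close>. Its derivative \<open>A\<close> at \<open>(x0, y0)\<close> is invertible, with inverse \<open>B\<close> given by
  Cramer's rule. If \<open>Fn\<close> is uniformly close to \<open>F\<close>, then \<open>z \<mapsto> z - B (Fn z)\<close> maps a small ball around
  \<open>(x0, y0)\<close> into itself, and a fixed point of this map is a zero of \<open>Fn\<close>. Only differentiability at
  the one point and uniform convergence are used.
\<close>
lemma transversal_crossing_stable:
  fixes \<gamma> :: "real \<Rightarrow> real^2" and c :: "nat \<Rightarrow> real \<Rightarrow> real^2"
  assumes p: "(\<gamma> has_vector_derivative p) (at x0)" and q: "(\<gamma> has_vector_derivative q) (at y0)"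
    and eq: "\<gamma> x0 = \<gamma> y0" and tr: "cross2 p q \<noteq> 0"
    and cc: "\<And>n. continuous_on UNIV (c n)"
    and ul: "uniform_limit UNIV c \<gamma> sequentially" and \<delta>: "0 < \<delta>"
  shows "\<forall>\<^sub>F n in sequentially. \<exists>x y. \<bar>x - x0\<bar> \<le> \<delta> \<and> \<bar>y - y0\<bar> \<le> \<delta> \<and> c n x = c n y"
proof -
  define D where "D = cross2 p q"
  have D: "D \<noteq> 0" using tr by (simp add: D_def)
  define F where "F z = \<gamma> (fst z) - \<gamma> (snd z)" for z :: "real \<times> real"
  define A where "A z = fst z *\<^sub>R p - snd z *\<^sub>R q" for z :: "real \<times> real"
  define B where "B v = (cross2 v q / D, cross2 v p / D)" for v
  have lB: "linear B"
    by (rule linearI) (auto simp: B_def cross2_def algebra_simps add_divide_distrib diff_divide_distrib)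
  then have bB: "bounded_linear B" by (rule linear_conv_bounded_linear[THEN iffD1])
  have BA: "B (A z) = z" for z
    using D by (auto simp: B_def A_def D_def cross2_def prod_eq_iff field_simps)
  have Binj: "v = 0" if "B v = 0" for v
  proof -
    have "cross2 v q = 0" "cross2 v p = 0" using that D by (auto simp: B_def prod_eq_iff)
    moreover have "v $ 1 * D = p $ 1 * cross2 v q - q $ 1 * cross2 v p"
      "v $ 2 * D = p $ 2 * cross2 v q - q $ 2 * cross2 v p"
      by (auto simp: D_def cross2_def algebra_simps)
    ultimately show ?thesis using D by (simp add: vec_eq_iff forall_2)
  qed
  obtain K where K: "0 < K" "\<And>v. norm (B v) \<le> norm v * K"
    using bounded_linear.pos_bounded[OF bB] by blast
  let ?z0 = "(x0, y0)"
  have FD: "(F has_derivative A) (at ?z0)"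
    unfolding F_def A_def
    using p q unfolding has_vector_derivative_def
    by (auto intro!: derivative_eq_intros has_derivative_compose[of fst fst ?z0 UNIV \<gamma>]
          has_derivative_compose[of snd snd ?z0 UNIV \<gamma>])
  have F0: "F ?z0 = 0" using eq by (simp add: F_def)
  obtain d where d: "0 < d" "\<And>z. norm (z - ?z0) < d \<Longrightarrow> norm (F z - A (z - ?z0)) \<le> 1 / (2 * K) * norm (z - ?z0)"
  proof -
    have "0 < 1 / (2 * K)" using K(1) by simp
    then have "\<exists>d>0. \<forall>z. norm (z - ?z0) < d \<longrightarrow> norm (F z - F ?z0 - A (z - ?z0)) \<le> 1 / (2 * K) * norm (z - ?z0)"
      using FD unfolding has_derivative_at_alt by blast
    then show ?thesis using that F0 by auto
  qed
  define r where "r = min \<delta> (d / 2)"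
  have r: "0 < r" "r \<le> \<delta>" "r < d" using \<delta> d(1) by (auto simp: r_def)
  have "\<forall>\<^sub>F n in sequentially. \<forall>x\<in>UNIV. dist (c n x) (\<gamma> x) < r / (4 * K)"
    using ul r(1) K(1) by (intro uniform_limitD) auto
  then show ?thesis
  proof eventually_elim
    case (elim n)
    define Fn where "Fn z = c n (fst z) - c n (snd z)" for z :: "real \<times> real"
    define G where "G z = z - B (Fn z)" for z
    have Gc: "continuous_on (cball ?z0 r) G"
      unfolding G_def Fn_def
      by (intro continuous_intros bounded_linear.continuous_on[OF bB] continuous_on_compose2[OF cc]) auto
    have Gm: "G z \<in> cball ?z0 r" if z: "z \<in> cball ?z0 r" for z
    proof -
      have nz: "norm (z - ?z0) \<le> r" using z by (simp add: dist_norm norm_minus_commute)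
      have "G z - ?z0 = B (A (z - ?z0) - F z) + B (F z - Fn z)"
        using BA[of "z - ?z0"] by (simp add: G_def linear_diff[OF lB])
      then have "norm (G z - ?z0) \<le> norm (B (A (z - ?z0) - F z)) + norm (B (F z - Fn z))"
        by (simp only: norm_triangle_ineq)
      also have "\<dots> \<le> norm (A (z - ?z0) - F z) * K + norm (F z - Fn z) * K"
        by (intro add_mono K)
      also have "norm (A (z - ?z0) - F z) \<le> 1 / (2 * K) * r"
      proof -
        have "norm (F z - A (z - ?z0)) \<le> 1 / (2 * K) * norm (z - ?z0)" using d(2) nz r by simp
        also have "\<dots> \<le> 1 / (2 * K) * r" using nz K(1) by (intro mult_left_mono) auto
        finally show ?thesis by (simp add: norm_minus_commute)
      qed
      also have "norm (F z - Fn z) \<le> r / (4 * K) + r / (4 * K)"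
      proof -
        have "F z - Fn z = (c n (snd z) - \<gamma> (snd z)) - (c n (fst z) - \<gamma> (fst z))" by (simp add: F_def Fn_def)
        then have "norm (F z - Fn z) \<le> norm (c n (snd z) - \<gamma> (snd z)) + norm (c n (fst z) - \<gamma> (fst z))"
          by (simp only: norm_triangle_ineq4)
        also have "\<dots> \<le> r / (4 * K) + r / (4 * K)"
          using elim by (intro add_mono) (auto simp: dist_norm intro: less_imp_le)
        finally show ?thesis .
      qed
      finally have "norm (G z - ?z0) \<le> 1 / (2 * K) * r * K + (r / (4 * K) + r / (4 * K)) * K"
        using K(1) by (simp add: mult_right_mono)
      also have "\<dots> = r" using K(1) by (simp add: field_simps)
      finally show ?thesis by (simp add: dist_norm norm_minus_commute)
    qed
    obtain z where z: "z \<in> cball ?z0 r" "G z = z"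
      using brouwer_ball[OF r(1) Gc] Gm by blast
    have "Fn z = 0" using z(2) Binj by (simp add: G_def)
    moreover have "norm (fst z - x0) \<le> r" "norm (snd z - y0) \<le> r"
    proof -
      obtain a b where ab: "z = (a, b)" by (cases z)
      have "norm (a - x0, b - y0) \<le> r" using z(1) ab norm_minus_commute[of "(a, b)" ?z0] by (simp add: dist_norm)
      then show "norm (fst z - x0) \<le> r" "norm (snd z - y0) \<le> r"
        using norm_fst_le[of "a - x0" "b - y0"] norm_snd_le[of "b - y0" "a - x0"] ab by auto
    qed
    ultimately show ?case using r(2) by (intro exI[of _ "fst z"] exI[of _ "snd z"]) (auto simp: Fn_def)
  qed
qed

text \<open>
  A nonparallel crossing of the limit would force crossings of the \<open>c n\<close> at parameters converging to
  \<open>x0\<close> and \<open>y0\<close>. There the tangents of the \<open>c n\<close> are parallel, and they converge to the tangents of the limit.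
\<close>
lemma tangential_closed:
  fixes \<gamma> \<theta> :: "real \<Rightarrow> real^2" and c \<theta>n :: "nat \<Rightarrow> real \<Rightarrow> real^2"
  assumes d: "\<And>t. (\<gamma> has_vector_derivative r *\<^sub>R \<theta> t) (at t)" and r: "r \<noteq> 0"
    and cc: "\<And>n. continuous_on UNIV (c n)" and ul: "uniform_limit UNIV c \<gamma> sequentially"
    and \<theta>c: "continuous_on UNIV \<theta>" and ul': "uniform_limit UNIV \<theta>n \<theta> sequentially"
    and tan: "\<And>n x y. c n x = c n y \<Longrightarrow> cross2 (\<theta>n n x) (\<theta>n n y) = 0"
    and eq: "\<gamma> x0 = \<gamma> y0"
  shows "cross2 (\<theta> x0) (\<theta> y0) = 0"
proof (rule ccontr)
  assume nz: "cross2 (\<theta> x0) (\<theta> y0) \<noteq> 0"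
  then have nz': "cross2 (r *\<^sub>R \<theta> x0) (r *\<^sub>R \<theta> y0) \<noteq> 0" using r by simp
  have "\<exists>n\<ge>k. \<exists>x y. \<bar>x - x0\<bar> \<le> 1 / Suc k \<and> \<bar>y - y0\<bar> \<le> 1 / Suc k \<and> c n x = c n y" for k
    using transversal_crossing_stable[OF d d eq nz' cc ul, of "1 / Suc k"]
    unfolding eventually_sequentially by (metis divide_pos_pos le_cases of_nat_0_less_iff zero_less_Suc zero_less_one)
  then obtain n x y where nxy: "\<And>k. k \<le> n k" "\<And>k. \<bar>x k - x0\<bar> \<le> 1 / Suc k" "\<And>k. \<bar>y k - y0\<bar> \<le> 1 / Suc k"
    "\<And>k. c (n k) (x k) = c (n k) (y k)" by metis
  have lim0: "(\<lambda>k. 1 / real (Suc k)) \<longlonglongrightarrow> 0" using LIMSEQ_inverse_real_of_nat by (simp add: inverse_eq_divide)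
  have nlim: "filterlim n at_top sequentially"
    using nxy(1) by (auto simp: filterlim_at_top eventually_sequentially intro: order_trans)
  have conv: "(\<lambda>k. \<theta>n (n k) (z k)) \<longlonglongrightarrow> \<theta> z0" if z: "\<And>k. \<bar>z k - z0\<bar> \<le> 1 / Suc k" for z z0
  proof -
    have "z \<longlonglongrightarrow> z0"
      by (rule LIM_zero_cancel, rule Lim_null_comparison[OF _ lim0]) (use z in auto)
    then have 1: "(\<lambda>k. \<theta> (z k)) \<longlonglongrightarrow> \<theta> z0"
      using \<theta>c by (intro continuous_on_tendsto_compose[OF \<theta>c]) auto
    have 2: "(\<lambda>k. \<theta>n (n k) (z k) - \<theta> (z k)) \<longlonglongrightarrow> 0"
    proof (rule LIMSEQ_I)
      fix e :: real assume "0 < e"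
      then have "\<forall>\<^sub>F m in sequentially. \<forall>x\<in>UNIV. dist (\<theta>n m x) (\<theta> x) < e" using ul' by (intro uniform_limitD)
      then obtain N where "\<And>m x. N \<le> m \<Longrightarrow> dist (\<theta>n m x) (\<theta> x) < e" unfolding eventually_sequentially by auto
      then show "\<exists>no. \<forall>k\<ge>no. norm (\<theta>n (n k) (z k) - \<theta> (z k) - 0) < e"
        using nxy(1) by (intro exI[of _ N]) (auto simp: dist_norm intro: order_trans)
    qed
    show ?thesis using tendsto_add[OF 2 1] by simp
  qed
  have "(\<lambda>k. cross2 (\<theta>n (n k) (x k)) (\<theta>n (n k) (y k))) \<longlonglongrightarrow> cross2 (\<theta> x0) (\<theta> y0)"
    unfolding cross2_def by (intro tendsto_intros conv nxy)
  moreover have "cross2 (\<theta>n (n k) (x k)) (\<theta>n (n k) (y k)) = 0" for k by (rule tan[OF nxy(4)])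
  ultimately show False using nz by (simp add: LIMSEQ_const_iff)
qed

section \<open>Compactness of closed curves with bounded energy\<close>

text \<open>
  The lengths \<open>L n\<close> vary, so each loop is rescaled to the fixed period \<open>2\<pi>\<close>. A first subsequence
  makes the lengths and the base points converge, a second one, by Arzela--Ascoli, the tangents.
  Uniform convergence on one period is uniform convergence on the line, and uniform convergence of
  derivatives identifies the derivative of the limit.
\<close>
lemma unit_speed_loops_converge:
  fixes \<sigma> \<sigma>' :: "nat \<Rightarrow> real \<Rightarrow> real^2"
  assumes L: "\<And>n. L n \<in> {b0..B}" "0 < b0"
    and per: "\<And>n. periodic (L n) (\<sigma> n)"
    and d: "\<And>n s. (\<sigma> n has_vector_derivative \<sigma>' n s) (at s)" and c: "\<And>n. continuous_on UNIV (\<sigma>' n)"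
    and unit: "\<And>n s. norm (\<sigma>' n s) = 1"
    and K: "compact K" "\<And>n. range (\<sigma> n) \<subseteq> K"
    and C: "0 \<le> C" "\<And>n a b. 0 \<le> a \<Longrightarrow> a \<le> b \<Longrightarrow> b \<le> L n \<Longrightarrow> (norm (\<sigma>' n b - \<sigma>' n a))\<^sup>2 \<le> (b - a) * C"
  obtains k l \<gamma> \<theta> where "strict_mono k" "(\<lambda>n. L (k n)) \<longlonglongrightarrow> l" "b0 \<le> l"
    "periodic (2*pi) \<gamma>" "\<And>t. norm (\<theta> t) = 1"
    "\<And>t. (\<gamma> has_vector_derivative (l / (2*pi)) *\<^sub>R \<theta> t) (at t)" "continuous_on UNIV \<theta>"
    "uniform_limit UNIV (\<lambda>n t. \<sigma> (k n) (L (k n) / (2*pi) * t)) \<gamma> sequentially"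
    "uniform_limit UNIV (\<lambda>n t. \<sigma>' (k n) (L (k n) / (2*pi) * t)) \<theta> sequentially"
proof -
  have Lpos: "0 < L n" "L n \<le> B" "b0 \<le> L n" for n using L(1)[of n] L(2) by auto
  have B: "0 < B" using Lpos(1,2)[of 0] by linarith
  define u where "u n t = \<sigma> n (L n / (2*pi) * t)" for n t
  define \<tau> where "\<tau> n t = \<sigma>' n (L n / (2*pi) * t)" for n t
  have step: "L n / (2*pi) * (t + 2*pi) = L n / (2*pi) * t + L n" for n t by (simp add: field_simps)
  \<comment> \<open>Sequence-valued periodic functions: one reduction of \<open>t\<close> to \<open>[0, 2\<pi>)\<close> then serves all \<open>n\<close>.\<close>
  have uper: "periodic (2*pi) (\<lambda>t n. u n t)" and \<tau>per: "periodic (2*pi) (\<lambda>t n. \<tau> n t)"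
    using per periodic_vector_derivative[OF per d] unfolding periodic_def u_def \<tau>_def step by auto
  have ud: "(u n has_vector_derivative (L n / (2*pi)) *\<^sub>R \<tau> n t) (at t)" for n t
  proof -
    have "((\<lambda>t. L n / (2*pi) * t) has_vector_derivative L n / (2*pi)) (at t)"
      by (auto intro!: derivative_eq_intros simp flip: has_real_derivative_iff_has_vector_derivative)
    from vector_diff_chain_at[OF this d[of n]]
    have "(\<sigma> n \<circ> (\<lambda>t. L n / (2*pi) * t) has_vector_derivative (L n / (2*pi)) *\<^sub>R \<tau> n t) (at t)"
      by (simp only: \<tau>_def)
    moreover have "u n = \<sigma> n \<circ> (\<lambda>t. L n / (2*pi) * t)" by (auto simp: u_def)
    ultimately show ?thesis by (simp only:)
  qed
  have hold: "(norm (\<tau> n x - \<tau> n y))\<^sup>2 \<le> \<bar>x - y\<bar> * (B / (2*pi) * C)" if "x \<in> {0..2*pi}" "y \<in> {0..2*pi}" for n x y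
  proof -
    have *: "(norm (\<tau> n y - \<tau> n x))\<^sup>2 \<le> (y - x) * (B / (2*pi) * C)" if "0 \<le> x" "x \<le> y" "y \<le> 2*pi" for x y
    proof -
      have "(norm (\<tau> n y - \<tau> n x))\<^sup>2 \<le> (L n / (2*pi) * y - L n / (2*pi) * x) * C"
        unfolding \<tau>_def
      proof (rule C(2))
        have "L n / (2*pi) * y \<le> L n / (2*pi) * (2*pi)" using that Lpos[of n] by (intro mult_left_mono) auto
        then show "L n / (2*pi) * y \<le> L n" by simp
      qed (use that Lpos[of n] in \<open>auto intro!: mult_left_mono divide_right_mono\<close>)
      also have "\<dots> = (y - x) * (L n / (2*pi) * C)" by (simp add: field_simps)
      also have "\<dots> \<le> (y - x) * (B / (2*pi) * C)"
        using that Lpos[of n] C(1) by (intro mult_left_mono mult_right_mono divide_right_mono) auto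
      finally show ?thesis .
    qed
    show ?thesis
    proof (cases "x \<le> y")
      case True then show ?thesis using *[of x y] that by (simp add: norm_minus_commute)
    next
      case False then show ?thesis using *[of y x] that by simp
    qed
  qed
  have "compact ({b0..B} \<times> K)" using K by (intro compact_Times) auto
  moreover have "(L n, u n 0) \<in> {b0..B} \<times> K" for n
    using L(1)[of n] subsetD[OF K(2) rangeI[of "\<sigma> n" 0]] by (simp add: u_def)
  ultimately obtain lp k1 where k1: "lp \<in> {b0..B} \<times> K" "strict_mono k1" "((\<lambda>n. (L n, u n 0)) \<circ> k1) \<longlonglongrightarrow> lp"
    using compact_imp_seq_compact seq_compactE[of _ "\<lambda>n. (L n, u n 0)"] by blast
  obtain l p where lp: "lp = (l, p)" by fastforce
  have l1: "(\<lambda>n. L (k1 n)) \<longlonglongrightarrow> l" and p1: "(\<lambda>n. u (k1 n) 0) \<longlonglongrightarrow> p"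
    using tendsto_fst[OF k1(3)] tendsto_snd[OF k1(3)] by (auto simp: o_def lp)
  have l: "b0 \<le> l" using k1(1) by (simp add: lp)
  obtain g and k2 :: "nat \<Rightarrow> nat" where g: "strict_mono k2"
    "\<And>e. 0 < e \<Longrightarrow> \<exists>N. \<forall>n x. n \<ge> N \<and> x \<in> {0..2*pi} \<longrightarrow> norm (\<tau> (k1 (k2 n)) x - g x) < e"
  proof (rule Arzela_Ascoli[of "{0..2*pi}" "\<lambda>n. \<tau> (k1 n)" 1])
    fix x e :: real assume x: "x \<in> {0..2*pi}" and e: "0 < e"
    define H where "H = B / (2*pi) * C"
    have H: "0 \<le> H" using B C(1) by (simp add: H_def)
    have "norm (\<tau> (k1 n) x - \<tau> (k1 n) y) < e" if "y \<in> {0..2*pi}" "norm (x - y) < e\<^sup>2 / (H + 1)" for n y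
    proof -
      have "(norm (\<tau> (k1 n) x - \<tau> (k1 n) y))\<^sup>2 \<le> \<bar>x - y\<bar> * H" unfolding H_def by (rule hold[OF x that(1)])
      also have "\<dots> \<le> \<bar>x - y\<bar> * (H + 1)" by (intro mult_left_mono) auto
      also have "\<dots> < e\<^sup>2" using that(2) H by (simp add: pos_less_divide_eq)
      finally show ?thesis using e by (simp add: power_less_imp_less_base)
    qed
    then show "\<exists>d>0. \<forall>n y. y \<in> {0..2*pi} \<and> norm (x - y) < d \<longrightarrow> norm (\<tau> (k1 n) x - \<tau> (k1 n) y) < e"
      using e H by (intro exI[of _ "e\<^sup>2 / (H + 1)"]) auto
  next
    fix g' and k' :: "nat \<Rightarrow> nat" assume "strict_mono k'" "\<And>e. 0 < e \<Longrightarrow> \<exists>N. \<forall>n x. n \<ge> N \<and> x \<in> {0..2*pi} \<longrightarrow>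
      norm (\<tau> (k1 (k' n)) x - g' x) < e"
    then show thesis using that[of k' g'] by blast
  qed (simp_all add: \<tau>_def unit)
  define k where "k = k1 \<circ> k2"
  have k: "strict_mono k" unfolding k_def using k1(2) g(1) by (rule strict_mono_o)
  have lk: "(\<lambda>n. L (k n)) \<longlonglongrightarrow> l" and pk: "(\<lambda>n. u (k n) 0) \<longlonglongrightarrow> p"
    using LIMSEQ_subseq_LIMSEQ[OF l1 g(1)] LIMSEQ_subseq_LIMSEQ[OF p1 g(1)] by (auto simp: k_def o_def)
  define \<theta> where "\<theta> t = lim (\<lambda>n. \<tau> (k n) t)" for t
  have \<theta>g: "\<theta> s = g s" if "s \<in> {0..2*pi}" for s
    unfolding \<theta>_def
  proof (rule limI, rule LIMSEQ_I)
    fix e :: real assume "0 < e"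
    then show "\<exists>no. \<forall>n\<ge>no. norm (\<tau> (k n) s - g s) < e" using g(2)[of e] that by (auto simp: k_def)
  qed
  have ul\<theta>: "uniform_limit UNIV (\<lambda>n. \<tau> (k n)) \<theta> sequentially"
  proof (rule uniform_limitI)
    fix e :: real assume "0 < e"
    then obtain N where N: "\<And>n x. n \<ge> N \<Longrightarrow> x \<in> {0..2*pi} \<Longrightarrow> norm (\<tau> (k n) x - g x) < e"
      using g(2)[of e] by (auto simp: k_def)
    have "dist (\<tau> (k n) t) (\<theta> t) < e" if "N \<le> n" for n t
    proof -
      obtain s where s: "s \<in> {0..<2*pi}" "(\<lambda>n. \<tau> n t) = (\<lambda>n. \<tau> n s)"
        using periodic_reduce[OF _ \<tau>per, of t] by auto
      have "\<theta> t = \<theta> s" "\<tau> (k n) t = \<tau> (k n) s" using fun_cong[OF s(2)] by (simp_all add: \<theta>_def)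
      then show ?thesis using N[OF that, of s] \<theta>g[of s] s(1) by (simp add: dist_norm)
    qed
    then show "\<forall>\<^sub>F n in sequentially. \<forall>t\<in>UNIV. dist (\<tau> (k n) t) (\<theta> t) < e"
      unfolding eventually_sequentially by blast
  qed
  have \<tau>c: "continuous_on UNIV (\<tau> n)" for n
    unfolding \<tau>_def by (intro continuous_on_compose2[OF c] continuous_intros) auto
  have \<theta>c: "continuous_on UNIV \<theta>"
    by (rule uniform_limit_theorem[OF _ ul\<theta>]) (auto simp: \<tau>c)
  have \<theta>1: "norm (\<theta> t) = 1" for t
  proof -
    have "(\<lambda>n. \<tau> (k n) t) \<longlonglongrightarrow> \<theta> t" using tendsto_uniform_limitI[OF ul\<theta>] by simp
    from tendsto_norm[OF this] show ?thesis by (simp add: \<tau>_def unit LIMSEQ_const_iff)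
  qed
  have ulD: "\<forall>\<^sub>F n in sequentially. \<forall>x. norm ((L (k n) / (2*pi)) *\<^sub>R \<tau> (k n) x - (l / (2*pi)) *\<^sub>R \<theta> x) \<le> e"
    if e: "0 < e" for e
  proof -
    have "\<forall>\<^sub>F n in sequentially. \<forall>x\<in>UNIV. dist (\<tau> (k n) x) (\<theta> x) < e * pi / B"
      using ul\<theta> e B by (intro uniform_limitD) auto
    moreover have "\<forall>\<^sub>F n in sequentially. dist (L (k n)) l < e * pi"
      using lk e by (intro tendstoD) auto
    ultimately show ?thesis
    proof eventually_elim
      case (elim n)
      show ?case
      proof
        fix x
        have "(L (k n) / (2*pi)) *\<^sub>R \<tau> (k n) x - (l / (2*pi)) *\<^sub>R \<theta> x
          = (L (k n) / (2*pi)) *\<^sub>R (\<tau> (k n) x - \<theta> x) + ((L (k n) - l) / (2*pi)) *\<^sub>R \<theta> x"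
          by (simp add: scaleR_diff_right scaleR_diff_left diff_divide_distrib)
        then have "norm ((L (k n) / (2*pi)) *\<^sub>R \<tau> (k n) x - (l / (2*pi)) *\<^sub>R \<theta> x)
          \<le> norm ((L (k n) / (2*pi)) *\<^sub>R (\<tau> (k n) x - \<theta> x)) + norm (((L (k n) - l) / (2*pi)) *\<^sub>R \<theta> x)"
          by (simp only: norm_triangle_ineq)
        also have "\<dots> = L (k n) / (2*pi) * norm (\<tau> (k n) x - \<theta> x) + \<bar>L (k n) - l\<bar> / (2*pi)"
          using Lpos(1)[of "k n"] by (simp add: \<theta>1)
        also have "\<dots> \<le> B / (2*pi) * (e * pi / B) + e * pi / (2*pi)"
          using elim Lpos[of "k n"]
          by (intro add_mono mult_mono divide_right_mono) (auto simp: dist_norm intro: less_imp_le)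
        also have "\<dots> = e" using B by (simp add: field_simps)
        finally show "norm ((L (k n) / (2*pi)) *\<^sub>R \<tau> (k n) x - (l / (2*pi)) *\<^sub>R \<theta> x) \<le> e" .
      qed
    qed
  qed
  have ex: "\<exists>\<gamma>. \<forall>x\<in>UNIV. (\<lambda>n. u (k n) x) \<longlonglongrightarrow> \<gamma> x \<and>
      (\<gamma> has_derivative (\<lambda>h. h *\<^sub>R ((l / (2*pi)) *\<^sub>R \<theta> x))) (at x within UNIV)"
  proof (rule has_derivative_sequence[where ?x0.0 = 0 and f' = "\<lambda>n x h. h *\<^sub>R ((L (k n) / (2*pi)) *\<^sub>R \<tau> (k n) x)"])
    show "(\<lambda>n. u (k n) 0) \<longlonglongrightarrow> p" by (rule pk)
    show "(u (k n) has_derivative (\<lambda>h. h *\<^sub>R ((L (k n) / (2*pi)) *\<^sub>R \<tau> (k n) x))) (at x within UNIV)" for n x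
      using ud[of "k n" x] by (simp add: has_vector_derivative_def)
    fix e :: real assume e: "0 < e"
    show "\<forall>\<^sub>F n in sequentially. \<forall>x\<in>UNIV. \<forall>h. norm (h *\<^sub>R ((L (k n) / (2*pi)) *\<^sub>R \<tau> (k n) x)
        - h *\<^sub>R ((l / (2*pi)) *\<^sub>R \<theta> x)) \<le> e * norm h"
      using ulD[OF e]
    proof eventually_elim
      case (elim n)
      show ?case
      proof (intro ballI allI)
        fix x h
        have "norm (h *\<^sub>R ((L (k n) / (2*pi)) *\<^sub>R \<tau> (k n) x) - h *\<^sub>R ((l / (2*pi)) *\<^sub>R \<theta> x))
          = \<bar>h\<bar> * norm ((L (k n) / (2*pi)) *\<^sub>R \<tau> (k n) x - (l / (2*pi)) *\<^sub>R \<theta> x)"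
          by (simp only: norm_scaleR flip: scaleR_diff_right)
        also have "\<dots> \<le> \<bar>h\<bar> * e" using elim by (intro mult_left_mono) auto
        finally show "norm (h *\<^sub>R ((L (k n) / (2*pi)) *\<^sub>R \<tau> (k n) x) - h *\<^sub>R ((l / (2*pi)) *\<^sub>R \<theta> x)) \<le> e * norm h"
          by (simp add: mult.commute)
      qed
    qed
  qed auto
  then obtain \<gamma> where \<gamma>: "\<And>x. (\<lambda>n. u (k n) x) \<longlonglongrightarrow> \<gamma> x"
    "\<And>x. (\<gamma> has_vector_derivative (l / (2*pi)) *\<^sub>R \<theta> x) (at x)"
    unfolding has_vector_derivative_def by auto
  have ul\<gamma>: "uniform_limit UNIV (\<lambda>n. u (k n)) \<gamma> sequentially"
  proof (rule uniform_limitI)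
    fix e :: real assume e: "0 < e"
    have "\<forall>\<^sub>F n in sequentially. dist (u (k n) 0) (\<gamma> 0) < e / 2" using \<gamma>(1)[of 0] e by (intro tendstoD) auto
    moreover have "\<forall>\<^sub>F n in sequentially. \<forall>x. norm ((L (k n) / (2*pi)) *\<^sub>R \<tau> (k n) x - (l / (2*pi)) *\<^sub>R \<theta> x) \<le> e / (4*pi)"
      using e by (intro ulD) auto
    ultimately show "\<forall>\<^sub>F n in sequentially. \<forall>t\<in>UNIV. dist (u (k n) t) (\<gamma> t) < e"
    proof eventually_elim
      case (elim n)
      show ?case
      proof
        fix t
        obtain s where s: "s \<in> {0..<2*pi}" "(\<lambda>n. u n t) = (\<lambda>n. u n s)"
          using periodic_reduce[OF _ uper, of t] by auto
        have us: "u n t = u n s" for n by (rule fun_cong[OF s(2)])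
        have \<gamma>s: "\<gamma> t = \<gamma> s"
          using LIMSEQ_unique[OF \<gamma>(1)[of t]] \<gamma>(1)[of s] by (simp add: us)
        have "norm ((u (k n) s - \<gamma> s) - (u (k n) 0 - \<gamma> 0)) \<le> e / (4*pi) * norm (s - 0)"
        proof (rule differentiable_bound[of "{0..2*pi}" "\<lambda>x. u (k n) x - \<gamma> x"
              "\<lambda>x h. h *\<^sub>R ((L (k n) / (2*pi)) *\<^sub>R \<tau> (k n) x - (l / (2*pi)) *\<^sub>R \<theta> x)"])
          fix x
          show "((\<lambda>x. u (k n) x - \<gamma> x) has_derivative
              (\<lambda>h. h *\<^sub>R ((L (k n) / (2*pi)) *\<^sub>R \<tau> (k n) x - (l / (2*pi)) *\<^sub>R \<theta> x))) (at x within {0..2*pi})"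
            using has_vector_derivative_at_within[OF has_vector_derivative_diff[OF ud[of "k n" x] \<gamma>(2)[of x]]]
            by (simp only: has_vector_derivative_def)
          show "onorm (\<lambda>h. h *\<^sub>R ((L (k n) / (2*pi)) *\<^sub>R \<tau> (k n) x - (l / (2*pi)) *\<^sub>R \<theta> x)) \<le> e / (4*pi)"
          proof (rule onorm_le)
            fix h :: real
            have "\<bar>h\<bar> * norm ((L (k n) / (2*pi)) *\<^sub>R \<tau> (k n) x - (l / (2*pi)) *\<^sub>R \<theta> x) \<le> \<bar>h\<bar> * (e / (4*pi))"
              using elim(2) by (intro mult_left_mono) auto
            then show "norm (h *\<^sub>R ((L (k n) / (2*pi)) *\<^sub>R \<tau> (k n) x - (l / (2*pi)) *\<^sub>R \<theta> x)) \<le> e / (4*pi) * norm h"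
              by (simp only: norm_scaleR real_norm_def mult.commute)
          qed
        qed (use s(1) in auto)
        also have "\<dots> \<le> e / (4*pi) * (2*pi)" using s(1) e by (intro mult_left_mono) auto
        also have "\<dots> = e / 2" by simp
        finally have "norm ((u (k n) s - \<gamma> s) - (u (k n) 0 - \<gamma> 0)) \<le> e / 2" .
        moreover have "norm (u (k n) 0 - \<gamma> 0) < e / 2" using elim(1) by (simp add: dist_norm)
        ultimately have "norm (u (k n) s - \<gamma> s) < e"
          using norm_triangle_sub[of "u (k n) s - \<gamma> s" "u (k n) 0 - \<gamma> 0"] by linarith
        then show "dist (u (k n) t) (\<gamma> t) < e" by (simp add: dist_norm us \<gamma>s)
      qed
    qed
  qed
  have \<gamma>per: "periodic (2*pi) \<gamma>"
    unfolding periodic_def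
  proof (rule allI)
    fix t
    have "u n (t + 2*pi) = u n t" for n using fun_cong[OF uper[unfolded periodic_def, THEN spec]] .
    then show "\<gamma> (t + 2*pi) = \<gamma> t" using LIMSEQ_unique[OF \<gamma>(1)[of "t + 2*pi"]] \<gamma>(1)[of t] by simp
  qed
  have eu: "u n = (\<lambda>t. \<sigma> n (L n / (2*pi) * t))" and e\<tau>: "\<tau> n = (\<lambda>t. \<sigma>' n (L n / (2*pi) * t))" for n
    by (auto simp: u_def \<tau>_def)
  show ?thesis
    by (rule that[OF k lk l \<gamma>per \<theta>1 \<gamma>(2) \<theta>c ul\<gamma>[unfolded eu] ul\<theta>[unfolded e\<tau>]])
qed

section \<open>Length bounds\<close>

lemma dyadic_energy_rescale:
  assumes "0 < c"
  shows "dyadic_energy (c * T) f n = dyadic_energy T (\<lambda>t. f (c * t)) n / c"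
  unfolding dyadic_energy_def sum_divide_distrib
  using assms by (intro sum.cong refl) (simp add: field_simps)

lemma dyadic_energy_scaleR: "dyadic_energy T (\<lambda>t. r *\<^sub>R f t) n = r\<^sup>2 * dyadic_energy T f n"
proof -
  have "norm (r *\<^sub>R x - r *\<^sub>R y) = \<bar>r\<bar> * norm (x - y)" for x y :: 'a
    by (metis norm_scaleR scaleR_diff_right)
  then show ?thesis
    unfolding dyadic_energy_def sum_distrib_left
    by (intro sum.cong refl) (simp only: power_mult_distrib power2_abs times_divide_eq_right)
qed

lemma dyadic_energy_tendsto:
  assumes "\<And>t. ((\<lambda>n. f n t) \<longlongrightarrow> g t) F" and "0 < T"
  shows "((\<lambda>n. dyadic_energy T (f n) j) \<longlongrightarrow> dyadic_energy T g j) F"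
  unfolding dyadic_energy_def using assms(2) by (intro tendsto_intros assms(1)) auto

text \<open>
  By Rolle's theorem for \<open>\<sigma> s \<bullet> \<sigma>' 0\<close>, some tangent \<open>\<sigma>' z\<close> is orthogonal to \<open>\<sigma>' 0\<close>, so
  \<open>2 = \<bar>\<sigma>' z - \<sigma>' 0\<bar>\<^sup>2 \<le> z W\<close>.
\<close>
lemma unit_speed_loop_length_lower_bound:
  fixes \<sigma> \<sigma>' :: "real \<Rightarrow> real^2"
  assumes L: "0 < L" and per: "periodic L \<sigma>" and d: "\<And>s. (\<sigma> has_vector_derivative \<sigma>' s) (at s)"
    and unit: "\<And>s. norm (\<sigma>' s) = 1"
    and W: "\<And>a b. 0 \<le> a \<Longrightarrow> a \<le> b \<Longrightarrow> b \<le> L \<Longrightarrow> (norm (\<sigma>' b - \<sigma>' a))\<^sup>2 \<le> (b - a) * W"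
  shows "2 \<le> L * W"
proof -
  have D: "((\<lambda>s. \<sigma> s \<bullet> \<sigma>' 0) has_real_derivative \<sigma>' s \<bullet> \<sigma>' 0) (at s)" for s
    unfolding has_real_derivative_iff_has_vector_derivative
    by (rule bounded_linear.has_vector_derivative[OF bounded_linear_inner_left d])
  have "\<sigma> L = \<sigma> 0" using per by (metis add_0 periodic_def)
  then have "\<exists>z. 0 < z \<and> z < L \<and> ((\<lambda>s. \<sigma> s \<bullet> \<sigma>' 0) has_real_derivative 0) (at z)"
    using D L by (intro Rolle) (auto intro!: continuous_at_imp_continuous_on DERIV_continuous simp: real_differentiable_def)
  then obtain z where z: "0 < z" "z < L" "\<sigma>' z \<bullet> \<sigma>' 0 = 0" using D DERIV_unique by blast
  have "(norm (\<sigma>' z - \<sigma>' 0))\<^sup>2 = (norm (\<sigma>' z))\<^sup>2 + (norm (\<sigma>' 0))\<^sup>2"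
    using z(3) by (simp add: power2_norm_eq_inner inner_diff_left inner_diff_right inner_commute)
  then have "2 \<le> z * W" using W[of 0 z] z by (simp add: unit)
  also have "z * W \<le> L * W"
  proof (rule mult_right_mono)
    have "0 < z * W" using \<open>2 \<le> z * W\<close> by linarith
    then show "0 \<le> W" using z(1) by (simp add: zero_less_mult_iff)
  qed (use z in simp)
  finally show ?thesis .
qed

text \<open>
  Integration by parts gives \<open>L = \<integral>\<bar>\<sigma>'\<bar>\<^sup>2 = - \<integral>\<sigma> \<bullet> g \<le> R \<integral>\<bar>g\<bar>\<close>, and \<open>(\<integral>\<bar>g\<bar>)\<^sup>2 \<le> L \<integral>\<bar>g\<bar>\<^sup>2\<close>.
\<close>
lemma unit_speed_loop_length_upper_bound:
  fixes \<sigma> \<sigma>' g :: "real \<Rightarrow> real^2"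
  assumes L: "0 < L" and per: "periodic L \<sigma>" and d: "\<And>s. (\<sigma> has_vector_derivative \<sigma>' s) (at s)"
    and c: "continuous_on UNIV \<sigma>'" and unit: "\<And>s. norm (\<sigma>' s) = 1"
    and R: "\<And>s. norm (\<sigma> s) \<le> R"
    and g: "primitive_on L \<sigma>' g" "set_integrable lborel {0..L} (\<lambda>t. (norm (g t))\<^sup>2)"
  shows "L \<le> R\<^sup>2 * (LBINT t:{0..L}. (norm (g t))\<^sup>2)"
proof -
  have eL: "\<sigma> L = \<sigma> 0" "\<sigma>' L = \<sigma>' 0"
    using per periodic_vector_derivative[OF per d] by (metis add_0 periodic_def)+
  have c': "continuous_on A \<sigma>'" for A using c continuous_on_subset by blast
  have \<sigma>c: "continuous_on A \<sigma>" for A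
    using d by (meson continuous_at_imp_continuous_on has_vector_derivative_continuous)
  have gi: "set_integrable lborel {0..L} g" using g(1) by (simp add: primitive_on_def)
  have R0: "0 \<le> R" using R[of 0] norm_ge_zero order_trans by blast
  have i1: "set_integrable lborel {0..L} (\<lambda>t. \<sigma>' t $ i *\<^sub>R \<sigma>' t)" for i
    by (intro borel_integrable_atLeastAtMost' continuous_intros c')
  have i2: "set_integrable lborel {0..L} (\<lambda>t. \<sigma> t $ i *\<^sub>R g t)" for i
    by (intro set_integrable_continuous_scaleR continuous_intros \<sigma>c gi)
  have comp: "set_integrable lborel {0..L} (\<lambda>t. f t $ i)"
    "(LBINT t:{0..L}. f t $ i) = (LBINT t:{0..L}. f t) $ i"
    if "set_integrable lborel {0..L} f" for f :: "real \<Rightarrow> real^2" and i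
    using integral_bounded_linear[OF bounded_linear_vec_nth that[unfolded set_integrable_def], of i]
      integrable_bounded_linear[OF bounded_linear_vec_nth that[unfolded set_integrable_def], of i]
    by (simp_all add: set_lebesgue_integral_def set_integrable_def)
  have parts: "(LBINT t:{0..L}. \<sigma>' t $ i * \<sigma>' t $ i) + (LBINT t:{0..L}. \<sigma> t $ i * g t $ i) = 0" for i
  proof -
    have di: "((\<lambda>t. \<sigma> t $ i) has_vector_derivative \<sigma>' t $ i) (at t within {0..L})" for t
      by (rule has_vector_derivative_at_within, rule bounded_linear.has_vector_derivative[OF bounded_linear_vec_nth d])
    have "(LBINT t:{0..L}. \<sigma>' t $ i *\<^sub>R \<sigma>' t) + (LBINT t:{0..L}. \<sigma> t $ i *\<^sub>R g t)
        = \<sigma> L $ i *\<^sub>R \<sigma>' L - \<sigma> 0 $ i *\<^sub>R \<sigma>' 0"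
      using L by (intro primitive_on_by_parts[OF g(1)] di continuous_intros c') auto
    then have "((LBINT t:{0..L}. \<sigma>' t $ i *\<^sub>R \<sigma>' t) + (LBINT t:{0..L}. \<sigma> t $ i *\<^sub>R g t)) $ i = 0"
      by (simp add: eL)
    then show ?thesis using comp(2)[OF i1, of i i] comp(2)[OF i2, of i i] by simp
  qed
  have j: "set_integrable lborel {0..L} (\<lambda>t. \<sigma>' t $ i * \<sigma>' t $ i)" "set_integrable lborel {0..L} (\<lambda>t. \<sigma> t $ i * g t $ i)" for i
    using comp(1)[OF i1, of i i] comp(1)[OF i2, of i i] by simp_all
  have "L = (LBINT t:{0..L}. (1::real))" using L by (simp add: set_lebesgue_integral_def)
  also have "(LBINT t:{0..L}. (1::real)) = (LBINT t:{0..L}. \<sigma>' t $ 1 * \<sigma>' t $ 1 + \<sigma>' t $ 2 * \<sigma>' t $ 2)"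
  proof -
    have "\<sigma>' t $ 1 * \<sigma>' t $ 1 + \<sigma>' t $ 2 * \<sigma>' t $ 2 = (norm (\<sigma>' t))\<^sup>2" for t
      by (simp add: power2_norm_eq_inner inner_vec_def sum_2)
    then show ?thesis by (simp add: unit)
  qed
  also have "\<dots> = (LBINT t:{0..L}. \<sigma>' t $ 1 * \<sigma>' t $ 1) + (LBINT t:{0..L}. \<sigma>' t $ 2 * \<sigma>' t $ 2)"
    by (rule set_integral_add(2)[OF j(1) j(1)])
  also have "\<dots> = - ((LBINT t:{0..L}. \<sigma> t $ 1 * g t $ 1) + (LBINT t:{0..L}. \<sigma> t $ 2 * g t $ 2))"
    using parts[of 1] parts[of 2] by linarith
  finally have eq1: "L = - ((LBINT t:{0..L}. \<sigma> t $ 1 * g t $ 1) + (LBINT t:{0..L}. \<sigma> t $ 2 * g t $ 2))" .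
  have eq2: "(LBINT t:{0..L}. \<sigma> t $ 1 * g t $ 1) + (LBINT t:{0..L}. \<sigma> t $ 2 * g t $ 2)
      = (LBINT t:{0..L}. \<sigma> t $ 1 * g t $ 1 + \<sigma> t $ 2 * g t $ 2)"
    by (rule set_integral_add(2)[OF j(2) j(2), symmetric])
  have le: "- (LBINT t:{0..L}. \<sigma> t $ 1 * g t $ 1 + \<sigma> t $ 2 * g t $ 2) \<le> (LBINT t:{0..L}. R * norm (g t))"
  proof -
    have "- (\<sigma> t $ 1 * g t $ 1 + \<sigma> t $ 2 * g t $ 2) \<le> R * norm (g t)" for t
    proof -
      have "\<bar>\<sigma> t \<bullet> g t\<bar> \<le> norm (\<sigma> t) * norm (g t)" by (rule Cauchy_Schwarz_ineq2)
      also have "\<dots> \<le> R * norm (g t)" using R by (intro mult_right_mono) auto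
      finally show ?thesis by (simp add: inner_vec_def sum_2)
    qed
    then have "(LBINT t:{0..L}. - (\<sigma> t $ 1 * g t $ 1 + \<sigma> t $ 2 * g t $ 2)) \<le> (LBINT t:{0..L}. R * norm (g t))"
    proof (intro set_integral_mono)
      show "set_integrable lborel {0..L} (\<lambda>t. - (\<sigma> t $ 1 * g t $ 1 + \<sigma> t $ 2 * g t $ 2))"
        using set_integrable_mult_right[of "-1", OF set_integral_add(1)[OF j(2)[of 1] j(2)[of 2]]] by simp
      show "set_integrable lborel {0..L} (\<lambda>t. R * norm (g t))"
        using set_integrable_norm[OF gi] by simp
    qed auto
    moreover have "(LBINT t:{0..L}. - (\<sigma> t $ 1 * g t $ 1 + \<sigma> t $ 2 * g t $ 2))
        = - (LBINT t:{0..L}. \<sigma> t $ 1 * g t $ 1 + \<sigma> t $ 2 * g t $ 2)"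
      using set_integral_mult_right[of lborel "{0..L}" "-1" "\<lambda>t. \<sigma> t $ 1 * g t $ 1 + \<sigma> t $ 2 * g t $ 2"] by simp
    ultimately show ?thesis by linarith
  qed
  have "(LBINT t:{0..L}. R * norm (g t)) = R * (LBINT t:{0..L}. norm (g t))" by simp
  with eq1 eq2 le have "L \<le> R * (LBINT t:{0..L}. norm (g t))" by linarith
  then have "L\<^sup>2 \<le> (R * (LBINT t:{0..L}. norm (g t)))\<^sup>2" using L by (intro power_mono) auto
  also have "\<dots> = R\<^sup>2 * (LBINT t:{0..L}. norm (g t))\<^sup>2" by (rule power_mult_distrib)
  also have "\<dots> \<le> R\<^sup>2 * ((L - 0) * (LBINT t:{0..L}. (norm (g t))\<^sup>2))"
    using L by (intro mult_left_mono Cauchy_Schwarz_Icc(1) set_integrable_imp_measurable gi g(2)) auto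
  finally have "L * L \<le> L * (R\<^sup>2 * (LBINT t:{0..L}. (norm (g t))\<^sup>2))"
    by (simp add: power2_eq_square mult_ac)
  then show ?thesis using L by simp
qed

section \<open>Admissible curves and the minimizer\<close>

text \<open>
  Everything that the minimization uses about an admissible curve, in terms of its arc length
  parametrization.
\<close>
lemma admissible_curve_arc_length_param:
  assumes \<gamma>: "\<gamma> \<in> admissible_curves \<Omega>" and R: "\<And>x. x \<in> closure \<Omega> \<Longrightarrow> norm x \<le> R"
  defines "L \<equiv> curve_length \<gamma>" and "\<sigma> \<equiv> arc_length_param \<gamma>" and "W \<equiv> bending_energy \<gamma>"
  shows "\<exists>\<sigma>'. periodic L \<sigma> \<and> (\<forall>s. (\<sigma> has_vector_derivative \<sigma>' s) (at s)) \<and> continuous_on UNIV \<sigma>' \<and>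
    (\<forall>s. norm (\<sigma>' s) = 1) \<and> range \<sigma> \<subseteq> closure \<Omega> \<and>
    (\<forall>x y. \<sigma> x = \<sigma> y \<longrightarrow> cross2 (\<sigma>' x) (\<sigma>' y) = 0) \<and>
    (\<forall>a b. 0 \<le> a \<longrightarrow> a \<le> b \<longrightarrow> b \<le> L \<longrightarrow> (norm (\<sigma>' b - \<sigma>' a))\<^sup>2 \<le> (b - a) * W) \<and>
    (\<forall>n. dyadic_energy L \<sigma>' n \<le> W) \<and> 0 < L \<and> 2 \<le> L * W \<and> L \<le> R\<^sup>2 * W"
proof -
  have reg: "regular_curve \<gamma>" and conf: "range \<gamma> \<subseteq> closure \<Omega>" and tan: "tangential_self_intersections \<gamma>"
    using \<gamma> by (auto simp: admissible_curves_def confined_def)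
  obtain d where d: "\<And>t. (\<gamma> has_vector_derivative d t) (at t)" "\<And>t. d t \<noteq> 0"
    and p\<gamma>: "periodic (2*pi) \<gamma>" and vd: "\<And>t. vector_derivative \<gamma> (at t) = d t"
    using regular_curve_C1[OF reg] by metis
  define l where "l = arc_length \<gamma>"
  obtain \<sigma>' E where L: "0 < L" and per: "periodic L \<sigma>"
    and \<sigma>d: "\<And>s. (\<sigma> has_vector_derivative \<sigma>' s) (at s)" and c: "continuous_on UNIV \<sigma>'"
    and unit: "\<And>s. norm (\<sigma>' s) = 1" and surj: "surj l" and \<sigma>l: "\<And>t. \<sigma> (l t) = \<gamma> t"
    and dl: "\<And>t. vector_derivative \<gamma> (at t) = norm (vector_derivative \<gamma> (at t)) *\<^sub>R \<sigma>' (l t)"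
    and E: "\<And>a b. 0 \<le> a \<Longrightarrow> a \<le> b \<Longrightarrow> b \<le> L \<Longrightarrow> (norm (\<sigma>' b - \<sigma>' a))\<^sup>2 \<le> (b - a) * (E b - E a)"
    using regular_curve_arc_length_param[OF reg] unfolding L_def \<sigma>_def l_def by metis
  obtain g where g: "primitive_on L \<sigma>' g" "set_integrable lborel {0..L} (\<lambda>t. (norm (g t))\<^sup>2)"
    using L2_primitive_if_dyadic_energy_bounded[OF L continuous_on_subset[OF c subset_UNIV] dyadic_energy_le_control[OF L E]]
    by blast
  have W: "W = (LBINT t:{0..L}. (norm (g t))\<^sup>2)"
    unfolding W_def L_def
    by (rule bending_energy_eq_L2[of _ \<sigma>']) (use L per \<sigma>d c g in \<open>auto simp: L_def \<sigma>_def\<close>)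
  have hold: "(norm (\<sigma>' b - \<sigma>' a))\<^sup>2 \<le> (b - a) * W" if ab: "0 \<le> a" "a \<le> b" "b \<le> L" for a b
  proof -
    have nn: "0 \<le> (LBINT t:{x..y}. (norm (g t))\<^sup>2)" for x y
      unfolding set_lebesgue_integral_def by (intro integral_nonneg_AE) auto
    have "W = (LBINT t:{0..b}. (norm (g t))\<^sup>2) + (LBINT t:{b..L}. (norm (g t))\<^sup>2)"
      unfolding W using ab by (intro set_integral_split_Icc g) auto
    then have "(LBINT t:{0..b}. (norm (g t))\<^sup>2) - (LBINT t:{0..a}. (norm (g t))\<^sup>2) \<le> W"
      using nn[of b L] nn[of 0 a] by linarith
    then have "(b - a) * ((LBINT t:{0..b}. (norm (g t))\<^sup>2) - (LBINT t:{0..a}. (norm (g t))\<^sup>2)) \<le> (b - a) * W"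
      using ab by (intro mult_left_mono) auto
    then show ?thesis using primitive_increment_sq_le[OF g ab] by linarith
  qed
  have dy: "dyadic_energy L \<sigma>' n \<le> W" for n unfolding W by (rule dyadic_energy_le_L2[OF L g])
  have ran: "range \<sigma> \<subseteq> closure \<Omega>"
    using conf surj \<sigma>l by (metis image_subset_iff surjE UNIV_I)
  have tan': "cross2 (\<sigma>' x) (\<sigma>' y) = 0" if "\<sigma> x = \<sigma> y" for x y
  proof -
    obtain s t where st: "x = l s" "y = l t" using surj by (metis surjE)
    have "cross2 (d s) (d t) = 0"
      using tan that unfolding tangential_iff_cross2[OF p\<gamma> d] st \<sigma>l by blast
    then have "cross2 (norm (d s) *\<^sub>R \<sigma>' (l s)) (norm (d t) *\<^sub>R \<sigma>' (l t)) = 0"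
      using dl[of s] dl[of t] by (simp only: vd)
    then show ?thesis using d(2) by (simp add: st)
  qed
  have low: "2 \<le> L * W" by (rule unit_speed_loop_length_lower_bound[OF L per \<sigma>d unit hold])
  have "norm (\<sigma> s) \<le> R" for s using ran R by blast
  then have up: "L \<le> R\<^sup>2 * W"
    unfolding W by (rule unit_speed_loop_length_upper_bound[OF L per \<sigma>d c unit _ g])
  show ?thesis
    by (intro exI[of _ \<sigma>'] conjI allI impI per \<sigma>d c unit ran tan' hold dy L low up)
qed

text \<open>
  Small circles inside \<open>\<Omega>\<close> are admissible.
\<close>
lemma admissible_curves_nonempty:
  assumes "\<Omega> \<noteq> {}" "open \<Omega>"
  shows "admissible_curves \<Omega> \<noteq> {}"
proof -
  obtain p e where e: "0 < e" "cball p e \<subseteq> \<Omega>"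
    using assms open_contains_cball by (metis ex_in_conv)
  define r where "r = e / 2"
  have r: "0 < r" using e by (simp add: r_def)
  define \<nu> :: "real \<Rightarrow> real^2" where "\<nu> t = cos t *\<^sub>R axis 1 1 + sin t *\<^sub>R axis 2 1" for t
  define \<tau> :: "real \<Rightarrow> real^2" where "\<tau> t = (- sin t) *\<^sub>R axis 1 1 + cos t *\<^sub>R axis 2 1" for t
  define \<gamma> where "\<gamma> t = p + r *\<^sub>R \<nu> t" for t
  have \<nu>i: "\<nu> t $ 1 = cos t" "\<nu> t $ 2 = sin t" for t by (auto simp: \<nu>_def axis_def)
  have \<tau>i: "\<tau> t $ 1 = - sin t" "\<tau> t $ 2 = cos t" for t by (auto simp: \<tau>_def axis_def)
  have d: "(\<gamma> has_vector_derivative r *\<^sub>R \<tau> t) (at t)" for t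
    unfolding \<gamma>_def \<nu>_def \<tau>_def
    by (auto intro!: derivative_eq_intros simp flip: has_real_derivative_iff_has_vector_derivative)
  have d2: "((\<lambda>t. r *\<^sub>R \<tau> t) has_vector_derivative - (r *\<^sub>R \<nu> t)) (at t)" for t
    unfolding \<nu>_def \<tau>_def
    by (auto intro!: derivative_eq_intros simp: algebra_simps simp flip: has_real_derivative_iff_has_vector_derivative)
  have c\<nu>: "continuous_on A (\<lambda>t. - (r *\<^sub>R \<nu> t))" for A unfolding \<nu>_def by (intro continuous_intros)
  have c\<tau>: "continuous_on A (\<lambda>t. r *\<^sub>R \<tau> t)" for A unfolding \<tau>_def by (intro continuous_intros)
  have per: "periodic (2*pi) \<gamma>" by (simp add: periodic_def \<gamma>_def \<nu>_def)
  have nz: "r *\<^sub>R \<tau> t \<noteq> 0" for t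
  proof
    assume "r *\<^sub>R \<tau> t = 0"
    then have "\<tau> t $ 1 = 0" "\<tau> t $ 2 = 0" using r by auto
    then show False using sin_cos_squared_add[of t] by (simp add: \<tau>i)
  qed
  have "set_integrable lborel {0..2*pi} (\<lambda>t. (norm (- (r *\<^sub>R \<nu> t)))\<^sup>2)"
    by (intro borel_integrable_atLeastAtMost' continuous_on_power continuous_on_norm c\<nu>)
  then have "regular_curve \<gamma>"
    using regular_curveI[OF per d c\<tau> nz dyadic_energy_le_L2[OF _ primitive_on_C1[OF d2 c\<nu>]]] by simp
  moreover have "confined \<Omega> \<gamma>"
  proof -
    have "norm (\<nu> t) \<le> 2" for t
    proof -
      have "norm (\<nu> t) \<le> norm (cos t *\<^sub>R (axis 1 1 :: real^2)) + norm (sin t *\<^sub>R (axis 2 1 :: real^2))"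
        unfolding \<nu>_def by (rule norm_triangle_ineq)
      also have "\<dots> \<le> 2" using add_mono[OF abs_cos_le_one[of t] abs_sin_le_one[of t]] by simp
      finally show ?thesis .
    qed
    then have "norm (r *\<^sub>R \<nu> t) \<le> r * 2" for t using r by (simp add: mult_left_mono)
    then have "\<gamma> t \<in> cball p e" for t by (simp add: \<gamma>_def r_def dist_norm)
    then show ?thesis using e(2) closure_subset unfolding confined_def by blast
  qed
  moreover have "tangential_self_intersections \<gamma>"
    unfolding tangential_iff_cross2[OF per d nz]
  proof (intro allI impI)
    fix x y assume "\<gamma> x = \<gamma> y"
    then have "\<nu> x = \<nu> y" using r by (simp add: \<gamma>_def)
    then have "cos x = cos y" "sin x = sin y" using \<nu>i by metis+
    then show "cross2 (r *\<^sub>R \<tau> x) (r *\<^sub>R \<tau> y) = 0" by (simp add: cross2_def \<tau>i)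
  qed
  ultimately show ?thesis by (auto simp: admissible_curves_def)
qed

text \<open>
  For a curve of constant speed \<open>r\<close>, passing to arc length is the linear substitution \<open>t = s / r\<close>. This
  multiplies the dyadic energies of the unit tangent by \<open>1 / r\<close>, which explains the bound \<open>r * M\<close>.
\<close>
lemma bending_energy_constant_speed:
  fixes \<gamma> \<theta> :: "real \<Rightarrow> real^2"
  assumes r: "0 < r" and per: "periodic (2*pi) \<gamma>"
    and d: "\<And>t. (\<gamma> has_vector_derivative r *\<^sub>R \<theta> t) (at t)" and c: "continuous_on UNIV \<theta>"
    and unit: "\<And>t. norm (\<theta> t) = 1" and M: "\<And>n. dyadic_energy (2*pi) \<theta> n \<le> r * M"
  shows "regular_curve \<gamma>" "bending_energy \<gamma> \<le> M"
proof -
  have nz: "r *\<^sub>R \<theta> t \<noteq> 0" for t using r unit[of t] by auto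
  have cr: "continuous_on UNIV (\<lambda>t. r *\<^sub>R \<theta> t)" by (intro continuous_intros c)
  have "dyadic_energy (2*pi) (\<lambda>t. r *\<^sub>R \<theta> t) n \<le> r\<^sup>2 * (r * M)" for n
    unfolding dyadic_energy_scaleR by (intro mult_left_mono M) auto
  then show "regular_curve \<gamma>" by (rule regular_curveI[OF per d cr nz])
  have vd: "vector_derivative \<gamma> (at t) = r *\<^sub>R \<theta> t" for t by (rule vector_derivative_at[OF d])
  have al: "arc_length \<gamma> t = r * t" for t
  proof -
    have "(arc_length \<gamma> has_real_derivative r) (at t)" for t
      using arc_length_has_derivative[OF vd cr, of t] r by (simp add: unit)
    then have "((\<lambda>t. arc_length \<gamma> t - r * t) has_real_derivative 0) (at t)" for t
      by (auto intro!: derivative_eq_intros)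
    then have "arc_length \<gamma> t - r * t = arc_length \<gamma> 0 - r * 0" by (intro DERIV_isconst_all) auto
    moreover have "arc_length \<gamma> 0 = 0" by (simp add: arc_length_def flip: zero_ereal_def)
    ultimately show ?thesis by simp
  qed
  have len: "curve_length \<gamma> = r * (2*pi)" by (simp only: curve_length_def al)
  have "inv (arc_length \<gamma>) = (\<lambda>s. s / r)"
    by (rule inv_equality) (use r in \<open>auto simp: al\<close>)
  then have par: "arc_length_param \<gamma> = \<gamma> \<circ> (\<lambda>s. s / r)" by (simp add: arc_length_param_def)
  show "bending_energy \<gamma> \<le> M"
  proof (rule bending_energy_le[of _ "\<lambda>s. \<theta> (s / r)"])
    show "0 < curve_length \<gamma>" using r by (simp add: len)
    show "periodic (curve_length \<gamma>) (arc_length_param \<gamma>)"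
      using per r by (simp add: periodic_def par len add_divide_distrib)
    show "continuous_on UNIV (\<lambda>s. \<theta> (s / r))"
      using r by (intro continuous_on_compose2[OF c] continuous_intros) auto
    fix s
    have "((\<lambda>s. s / r) has_vector_derivative 1 / r) (at s)"
      using r by (auto intro!: derivative_eq_intros simp flip: has_real_derivative_iff_has_vector_derivative)
    from vector_diff_chain_at[OF this d]
    show "(arc_length_param \<gamma> has_vector_derivative \<theta> (s / r)) (at s)" using r by (simp add: par)
  next
    fix n
    have "dyadic_energy (r * (2*pi)) (\<lambda>s. \<theta> (s / r)) n = dyadic_energy (2*pi) \<theta> n / r"
      using r by (simp add: dyadic_energy_rescale)
    also have "\<dots> \<le> M" using M[of n] r by (simp add: pos_divide_le_eq mult.commute)
    finally show "dyadic_energy (curve_length \<gamma>) (\<lambda>s. \<theta> (s / r)) n \<le> M" by (simp only: len)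
  qed
qed

theorem theorem3p3:
  fixes \<Omega> :: "(real^2) set"
  assumes "\<Omega> \<noteq> {}" and "bounded \<Omega>" and "open \<Omega>" and "lipschitz_boundary \<Omega>"
  shows "\<exists>\<gamma>\<in>admissible_curves \<Omega>. \<forall>\<eta>\<in>admissible_curves \<Omega>.
           bending_energy \<gamma> \<le> bending_energy \<eta>"
proof -
  define m where "m = Inf (bending_energy ` admissible_curves \<Omega>)"
  have ne: "bending_energy ` admissible_curves \<Omega> \<noteq> {}"
    using admissible_curves_nonempty[OF assms(1,3)] by simp
  have "0 \<le> bending_energy \<eta>" for \<eta>
    unfolding bending_energy_def Let_def set_lebesgue_integral_def by (intro integral_nonneg_AE) auto
  then have bdd: "bdd_below (bending_energy ` admissible_curves \<Omega>)" by (intro bdd_belowI[of _ 0]) auto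
  have m_le: "m \<le> bending_energy \<eta>" if "\<eta> \<in> admissible_curves \<Omega>" for \<eta>
    unfolding m_def using that bdd by (intro cInf_lower) auto
  have "\<exists>\<eta>\<in>admissible_curves \<Omega>. bending_energy \<eta> < m + 1 / Suc n" for n
    using cInf_lessD[OF ne, of "m + 1 / Suc n"] by (auto simp: m_def)
  then obtain c where c: "\<And>n. c n \<in> admissible_curves \<Omega>" "\<And>n. bending_energy (c n) < m + 1 / Suc n"
    by metis
  define W where "W n = bending_energy (c n)" for n
  define L where "L n = curve_length (c n)" for n
  define \<sigma> where "\<sigma> n = arc_length_param (c n)" for n
  have Wm: "W \<longlonglongrightarrow> m"
  proof (rule real_tendsto_sandwich)
    show "\<forall>\<^sub>F n in sequentially. m \<le> W n" using m_le c(1) by (simp add: W_def)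
    show "\<forall>\<^sub>F n in sequentially. W n \<le> m + 1 / Suc n" using less_imp_le[OF c(2)] by (simp add: W_def)
    have "(\<lambda>n. m + inverse (real (Suc n))) \<longlonglongrightarrow> m + 0" by (intro tendsto_intros LIMSEQ_inverse_real_of_nat)
    then show "(\<lambda>n. m + 1 / Suc n) \<longlonglongrightarrow> m" by (simp add: inverse_eq_divide)
  qed auto
  have "bounded (closure \<Omega>)" by (rule bounded_closure[OF assms(2)])
  then obtain R where R: "\<And>x. x \<in> closure \<Omega> \<Longrightarrow> norm x \<le> R" unfolding bounded_iff by blast
  have "\<forall>n. \<exists>\<sigma>'. periodic (L n) (\<sigma> n) \<and> (\<forall>s. (\<sigma> n has_vector_derivative \<sigma>' s) (at s)) \<and> continuous_on UNIV \<sigma>' \<and>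
    (\<forall>s. norm (\<sigma>' s) = 1) \<and> range (\<sigma> n) \<subseteq> closure \<Omega> \<and>
    (\<forall>x y. \<sigma> n x = \<sigma> n y \<longrightarrow> cross2 (\<sigma>' x) (\<sigma>' y) = 0) \<and>
    (\<forall>a b. 0 \<le> a \<longrightarrow> a \<le> b \<longrightarrow> b \<le> L n \<longrightarrow> (norm (\<sigma>' b - \<sigma>' a))\<^sup>2 \<le> (b - a) * W n) \<and>
    (\<forall>j. dyadic_energy (L n) \<sigma>' j \<le> W n) \<and> 0 < L n \<and> 2 \<le> L n * W n \<and> L n \<le> R\<^sup>2 * W n"
    unfolding L_def \<sigma>_def W_def using admissible_curve_arc_length_param[OF c(1) R] by blast
  then obtain \<sigma>' where "\<forall>n. periodic (L n) (\<sigma> n) \<and> (\<forall>s. (\<sigma> n has_vector_derivative \<sigma>' n s) (at s)) \<and> continuous_on UNIV (\<sigma>' n) \<and>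
    (\<forall>s. norm (\<sigma>' n s) = 1) \<and> range (\<sigma> n) \<subseteq> closure \<Omega> \<and>
    (\<forall>x y. \<sigma> n x = \<sigma> n y \<longrightarrow> cross2 (\<sigma>' n x) (\<sigma>' n y) = 0) \<and>
    (\<forall>a b. 0 \<le> a \<longrightarrow> a \<le> b \<longrightarrow> b \<le> L n \<longrightarrow> (norm (\<sigma>' n b - \<sigma>' n a))\<^sup>2 \<le> (b - a) * W n) \<and>
    (\<forall>j. dyadic_energy (L n) (\<sigma>' n) j \<le> W n) \<and> 0 < L n \<and> 2 \<le> L n * W n \<and> L n \<le> R\<^sup>2 * W n"
    by (rule choice[THEN exE])
  then have per: "\<And>n. periodic (L n) (\<sigma> n)" and d: "\<And>n s. (\<sigma> n has_vector_derivative \<sigma>' n s) (at s)"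
    and cont: "\<And>n. continuous_on UNIV (\<sigma>' n)" and unit: "\<And>n s. norm (\<sigma>' n s) = 1"
    and ran: "\<And>n. range (\<sigma> n) \<subseteq> closure \<Omega>"
    and tan: "\<And>n x y. \<sigma> n x = \<sigma> n y \<Longrightarrow> cross2 (\<sigma>' n x) (\<sigma>' n y) = 0"
    and hold: "\<And>n a b. 0 \<le> a \<Longrightarrow> a \<le> b \<Longrightarrow> b \<le> L n \<Longrightarrow> (norm (\<sigma>' n b - \<sigma>' n a))\<^sup>2 \<le> (b - a) * W n"
    and dy: "\<And>n j. dyadic_energy (L n) (\<sigma>' n) j \<le> W n"
    and Lpos: "\<And>n. 0 < L n" and low: "\<And>n. 2 \<le> L n * W n" and up: "\<And>n. L n \<le> R\<^sup>2 * W n"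
    by blast+
  define C where "C = m + 1"
  have WC: "0 < W n" "W n \<le> C" for n
  proof -
    have "0 < L n * W n" using low[of n] by linarith
    then show "0 < W n" using Lpos[of n] by (simp add: zero_less_mult_iff)
    have "1 / real (Suc n) \<le> 1" by simp
    then show "W n \<le> C" using c(2)[of n] unfolding C_def W_def by linarith
  qed
  have Cpos: "0 < C" using WC[of 0] by linarith
  have Lb: "L n \<in> {2 / C..R\<^sup>2 * C}" for n
  proof -
    have "2 \<le> L n * C" using low[of n] mult_left_mono[OF WC(2)[of n], of "L n"] Lpos[of n] by linarith
    moreover have "R\<^sup>2 * W n \<le> R\<^sup>2 * C" by (intro mult_left_mono WC) auto
    ultimately show ?thesis using Cpos up[of n] by (simp add: pos_divide_le_eq)
  qed
  have holdC: "(norm (\<sigma>' n b - \<sigma>' n a))\<^sup>2 \<le> (b - a) * C" if "0 \<le> a" "a \<le> b" "b \<le> L n" for n a b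
    using hold[OF that] mult_left_mono[OF WC(2)[of n], of "b - a"] that by linarith
  have b0: "0 < 2 / C" using Cpos by simp
  have Kc: "compact (closure \<Omega>)" unfolding compact_closure by (rule assms(2))
  obtain k l \<gamma> \<theta> where k: "strict_mono k" "(\<lambda>n. L (k n)) \<longlonglongrightarrow> l" "2 / C \<le> l"
    and \<gamma>per: "periodic (2*pi) \<gamma>" and \<theta>1: "\<And>t. norm (\<theta> t) = 1"
    and \<gamma>d: "\<And>t. (\<gamma> has_vector_derivative (l / (2*pi)) *\<^sub>R \<theta> t) (at t)" and \<theta>c: "continuous_on UNIV \<theta>"
    and ul\<gamma>: "uniform_limit UNIV (\<lambda>n t. \<sigma> (k n) (L (k n) / (2*pi) * t)) \<gamma> sequentially"
    and ul\<theta>: "uniform_limit UNIV (\<lambda>n t. \<sigma>' (k n) (L (k n) / (2*pi) * t)) \<theta> sequentially"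
  proof (rule unit_speed_loops_converge[OF Lb b0 per d cont unit Kc ran less_imp_le[OF Cpos] holdC])
    fix k l \<gamma> \<theta>
    assume A: "strict_mono (k :: nat \<Rightarrow> nat)" "(\<lambda>n. L (k n)) \<longlonglongrightarrow> l" "2 / C \<le> l" "periodic (2*pi) \<gamma>" "\<And>t. norm (\<theta> t) = 1"
      "\<And>t. (\<gamma> has_vector_derivative (l / (2*pi)) *\<^sub>R \<theta> t) (at t)" "continuous_on UNIV \<theta>"
      "uniform_limit UNIV (\<lambda>n t. \<sigma> (k n) (L (k n) / (2*pi) * t)) \<gamma> sequentially"
      "uniform_limit UNIV (\<lambda>n t. \<sigma>' (k n) (L (k n) / (2*pi) * t)) \<theta> sequentially"
    show thesis by (rule that[OF A])
  qed
  define r where "r = l / (2*pi)"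
  have "0 < l" using k(3) b0 by linarith
  then have r: "0 < r" by (simp add: r_def)
  have \<gamma>d': "(\<gamma> has_vector_derivative r *\<^sub>R \<theta> t) (at t)" for t using \<gamma>d by (simp add: r_def)
  have Wk: "(\<lambda>n. W (k n)) \<longlonglongrightarrow> m" using LIMSEQ_subseq_LIMSEQ[OF Wm k(1)] by (simp add: o_def)
  \<comment> \<open>Lower semicontinuity: each dyadic energy converges along the sequence, where it is bounded by
        the bending energies up to the scaling factor \<open>L / (2\<pi>)\<close>.\<close>
  have lsc: "dyadic_energy (2*pi) \<theta> j \<le> r * m" for j
  proof (rule LIMSEQ_le)
    show "(\<lambda>n. dyadic_energy (2*pi) (\<lambda>t. \<sigma>' (k n) (L (k n) / (2*pi) * t)) j) \<longlonglongrightarrow> dyadic_energy (2*pi) \<theta> j"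
      by (intro dyadic_energy_tendsto tendsto_uniform_limitI[OF ul\<theta>]) auto
    show "(\<lambda>n. L (k n) / (2*pi) * W (k n)) \<longlonglongrightarrow> r * m"
      unfolding r_def by (intro tendsto_intros k(2) Wk) auto
    have "dyadic_energy (2*pi) (\<lambda>t. \<sigma>' n (L n / (2*pi) * t)) j \<le> L n / (2*pi) * W n" for n
    proof -
      have p: "0 < L n / (2*pi)" using Lpos[of n] by simp
      have "dyadic_energy (L n) (\<sigma>' n) j = dyadic_energy (2*pi) (\<lambda>t. \<sigma>' n (L n / (2*pi) * t)) j / (L n / (2*pi))"
        using dyadic_energy_rescale[OF p, of "2*pi" "\<sigma>' n" j] by simp
      then show ?thesis using dy[of n j] p by (simp only: pos_divide_le_eq mult.commute)
    qed
    then show "\<exists>N. \<forall>n\<ge>N. dyadic_energy (2*pi) (\<lambda>t. \<sigma>' (k n) (L (k n) / (2*pi) * t)) j \<le> L (k n) / (2*pi) * W (k n)"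
      by blast
  qed
  have reg: "regular_curve \<gamma>" and energy: "bending_energy \<gamma> \<le> m"
    using bending_energy_constant_speed[OF r \<gamma>per \<gamma>d' \<theta>c \<theta>1 lsc] by auto
  have "\<gamma> t \<in> closure \<Omega>" for t
  proof (rule closed_sequentially[OF closed_closure])
    show "(\<lambda>n. \<sigma> (k n) (L (k n) / (2*pi) * t)) \<longlonglongrightarrow> \<gamma> t" using tendsto_uniform_limitI[OF ul\<gamma>] by simp
    show "\<sigma> (k n) (L (k n) / (2*pi) * t) \<in> closure \<Omega>" for n using ran by blast
  qed
  then have conf: "confined \<Omega> \<gamma>" by (auto simp: confined_def)
  have rn: "r \<noteq> 0" using r by simp
  have \<sigma>c: "continuous_on UNIV (\<lambda>t. \<sigma> (k n) (L (k n) / (2*pi) * t))" for n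
  proof -
    have "continuous_on UNIV (\<sigma> (k n))"
      using d by (meson continuous_at_imp_continuous_on has_vector_derivative_continuous)
    then show ?thesis by (rule continuous_on_compose2) (auto intro!: continuous_intros)
  qed
  have nz: "r *\<^sub>R \<theta> t \<noteq> 0" for t using r \<theta>1[of t] by auto
  have "tangential_self_intersections \<gamma>"
    unfolding tangential_iff_cross2[OF \<gamma>per \<gamma>d' nz]
  proof (intro allI impI)
    fix x y assume xy: "\<gamma> x = \<gamma> y"
    have "cross2 (\<theta> x) (\<theta> y) = 0"
      by (rule tangential_closed[OF \<gamma>d' rn \<sigma>c ul\<gamma> \<theta>c ul\<theta> _ xy]) (rule tan)
    then show "cross2 (r *\<^sub>R \<theta> x) (r *\<^sub>R \<theta> y) = 0" by simp
  qed
  then have "\<gamma> \<in> admissible_curves \<Omega>" using reg conf by (simp add: admissible_curves_def)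
  then show ?thesis using energy m_le by (meson order_trans)
qed

end
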